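(* There exists a constant $C>0$ such that for every integer $n\ge C$ and every pair $e,f$ of non-adjacent edges of the complete graph $K_n$, $$\mathbb{P}_{\mathrm{MST}}^{(K_n)}\big[\omega(e)=\omega(f)=1\big]\le \mathbb{P}_{\mathrm{MST}}^{(K_n)}\big[\omega(e)=1\big]\cdot \mathbb{P}_{\mathrm{MST}}^{(K_n)}\big[\omega(f)=1\big].$$
   Context: $K_n$ is the complete graph on $n$ vertices. Two distinct edges are adjacent if they share a common endpoint, and non-adjacent if they share no endpoint. Minimal spanning tree (MST): for a finite, connected graph $G=(V,E)$, sample i.i.d. random variables $\{W(e): e\in E\}$ with the uniform $(0,1)$ distribution. $\mathrm{MST}(G)$ is the (almost surely unique) spanning tree of $G$ that minimizes the total weight (sum of its edge weights) among all spanning trees of $G$. $\mathbb{P}_{\mathrm{MST}}^{(G)}$ denotes the law of $\mathrm{MST}(G)$, viewed as a probability measure on $\{0,1\}^E$, where $\omega\in\{0,1\}^E$ is identified with the subgraph with vertex set $V$ and edge set $\{e:\omega(e)=1\}$. *)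

theory Defs
  imports "HOL-Probability.Probability" "HOL-Library.Ramsey"
begin

text \<open>A simple graph is a pair of a vertex set and a set of two-element sets of vertices.\<close>

type_synonym 'v ugraph = "'v set \<times> 'v set set"

definition is_cycle :: "'v set set \<Rightarrow> 'v list \<Rightarrow> bool" where
  "is_cycle E p \<longleftrightarrow> length p \<ge> 3 \<and> distinct p \<and>
     (\<forall>i<length p. {p ! i, p ! (Suc i mod length p)} \<in> E)"

definition connected_graph :: "'v ugraph \<Rightarrow> bool" where
  "connected_graph = (\<lambda>(V, E).
     V \<noteq> {} \<and> (\<forall>u\<in>V. \<forall>v\<in>V. (u, v) \<in> {(x, y). {x, y} \<in> E}\<^sup>*))"

definition tree :: "'v ugraph \<Rightarrow> bool" where
  "tree = (\<lambda>(V, E). connected_graph (V, E) \<and> (\<nexists>p. is_cycle E p))"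

text \<open>A spanning tree of \<open>(V, E)\<close> has vertex set \<open>V\<close>, so it is represented by its edge set.\<close>

definition spanning_tree :: "'v ugraph \<Rightarrow> 'v set set \<Rightarrow> bool" where
  "spanning_tree = (\<lambda>(V, E) T. T \<subseteq> E \<and> tree (V, T))"

definition is_MST :: "'v ugraph \<Rightarrow> ('v set \<Rightarrow> real) \<Rightarrow> 'v set set \<Rightarrow> bool" where
  "is_MST G W T \<longleftrightarrow> spanning_tree G T \<and>
     (\<forall>T'. spanning_tree G T' \<longrightarrow> (\<Sum>e\<in>T. W e) \<le> (\<Sum>e\<in>T'. W e))"

text \<open>For i.i.d. uniform weights the minimizer is almost surely unique, so the tie-breaking by
  \<open>SOME\<close> only matters on a null set.\<close>

definition MST :: "'v ugraph \<Rightarrow> ('v set \<Rightarrow> real) \<Rightarrow> 'v set set" where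
  "MST G W = (SOME T. is_MST G W T)"

definition weights :: "'v ugraph \<Rightarrow> ('v set \<Rightarrow> real) measure" where
  "weights G = (\<Pi>\<^sub>M e\<in>snd G. uniform_measure lborel {0<..<1})"

definition configs :: "'v ugraph \<Rightarrow> ('v set \<Rightarrow> nat) set" where
  "configs G = snd G \<rightarrow>\<^sub>E {0, 1}"

definition config_of :: "'v ugraph \<Rightarrow> 'v set set \<Rightarrow> 'v set \<Rightarrow> nat" where
  "config_of G T = restrict (indicator T) (snd G)"

definition MST_law :: "'v ugraph \<Rightarrow> ('v set \<Rightarrow> nat) measure" where
  "MST_law G = distr (weights G) (count_space (configs G)) (\<lambda>W. config_of G (MST G W))"

definition complete_graph :: "nat \<Rightarrow> nat ugraph" where
  "complete_graph n = ({..<n}, [{..<n}]\<^bsup>2\<^esup>)"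

text \<open>As \<^const>\<open>distr\<close> of a non-measurable map is the null measure, the following two facts are
  needed for \<^const>\<open>MST_law\<close> to be meaningful.\<close>

lemma measurable_MST:
  assumes "finite (snd G)"
  shows "(\<lambda>W. config_of G (MST G W)) \<in> measurable (weights G) (count_space (configs G))"
proof -
  define E where "E = snd G"
  define S where "S W = {T. is_MST G W T}" for W
  have fin: "finite E" using assms by (simp add: E_def)
  have sub: "T \<subseteq> E" if "spanning_tree G T" for T
    using that by (auto simp: spanning_tree_def E_def split: prod.splits)
  have S_sub: "S W \<subseteq> Pow E" for W
    using sub by (auto simp: S_def is_MST_def)
  have sum_meas: "(\<lambda>W. \<Sum>e\<in>T. W e) \<in> borel_measurable (weights G)" if "spanning_tree G T" for T
  proof (rule borel_measurable_sum)
    fix e assume "e \<in> T"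
    then have "e \<in> snd G" using sub[OF that] by (auto simp: E_def)
    then have "(\<lambda>W. W e) \<in> measurable (weights G) (uniform_measure lborel {0<..<1})"
      unfolding weights_def by (rule measurable_component_singleton)
    then show "(\<lambda>W. W e) \<in> borel_measurable (weights G)"
      by (simp cong: measurable_cong_sets)
  qed
  have MST_meas: "{W \<in> space (weights G). is_MST G W T} \<in> sets (weights G)" for T
  proof (cases "spanning_tree G T")
    case True
    have "{W \<in> space (weights G). \<forall>T' \<in> {T'. T' \<in> Pow E \<and> spanning_tree G T'}.
        (\<Sum>e\<in>T. W e) \<le> (\<Sum>e\<in>T'. W e)} \<in> sets (weights G)"
      by (rule sets.sets_Collect_finite_All')
         (use fin True sub[OF True] in \<open>auto intro!: borel_measurable_le sum_meas\<close>)
    moreover have "{W \<in> space (weights G). is_MST G W T} =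
        {W \<in> space (weights G). \<forall>T' \<in> {T'. T' \<in> Pow E \<and> spanning_tree G T'}.
        (\<Sum>e\<in>T. W e) \<le> (\<Sum>e\<in>T'. W e)}"
      using True sub by (auto simp: is_MST_def)
    ultimately show ?thesis by simp
  next
    case False
    then show ?thesis by (simp add: is_MST_def)
  qed
  have "S \<in> measurable (weights G) (count_space (Pow (Pow E)))"
  proof (subst measurable_count_space_eq2)
    show "finite (Pow (Pow E))" using fin by simp
    have "S -` {A} \<inter> space (weights G) \<in> sets (weights G)" if "A \<in> Pow (Pow E)" for A
    proof -
      have "S -` {A} \<inter> space (weights G) =
          {W \<in> space (weights G). \<forall>T\<in>Pow E. is_MST G W T = (T \<in> A)}"
        using S_sub that by (fastforce simp: S_def)
      moreover have "\<dots> \<in> sets (weights G)"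
      proof (rule sets.sets_Collect_finite_All)
        fix T
        show "{W \<in> space (weights G). is_MST G W T = (T \<in> A)} \<in> sets (weights G)"
          using MST_meas[of T] sets.sets_Collect_neg[OF MST_meas[of T]] by (cases "T \<in> A") auto
      qed (use fin in auto)
      ultimately show ?thesis by simp
    qed
    then show "S \<in> space (weights G) \<rightarrow> Pow (Pow E) \<and>
        (\<forall>A\<in>Pow (Pow E). S -` {A} \<inter> space (weights G) \<in> sets (weights G))"
      using S_sub by blast
  qed
  moreover have "(\<lambda>A. config_of G (SOME T. T \<in> A)) \<in>
      measurable (count_space (Pow (Pow E))) (count_space (configs G))"
    by (auto simp: config_of_def configs_def indicator_def)
  ultimately have "(\<lambda>W. config_of G (SOME T. T \<in> S W)) \<in>
      measurable (weights G) (count_space (configs G))"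
    by (rule measurable_compose)
  then show ?thesis by (simp add: S_def MST_def)
qed

lemma prob_space_MST_law:
  assumes "finite (snd G)"
  shows "prob_space (MST_law G)"
proof -
  have "prob_space (uniform_measure lborel {0<..<1::real})"
    by (rule prob_space_uniform_measure) auto
  then have "prob_space (weights G)"
    unfolding weights_def by (intro prob_space_PiM)
  then show ?thesis
    unfolding MST_law_def by (rule prob_space.prob_space_distr) (rule measurable_MST[OF assms])
qed

end

theory Submission
  imports Defs "HOL-Real_Asymp.Real_Asymp"
begin

text \<open>To leading order both sides of the inequality are \<open>4 / n^2\<close>, so a
  correction of relative order \<open>1 / n\<close> decides. The expected number of ordered disjoint
  pairs of tree edges is \<open>(n - 1) * (n - 2) - 2 * A = n^2 - (11 - 4 * L) * n + 10\<close>. The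
  product of the marginals, summed over the \<open>n (n - 1) (n - 2) (n - 3) / 4\<close> ordered
  disjoint pairs of edges of the complete graph, is
  \<open>(n - 1) (n - 2) (n - 3) / n = n^2 - 6 n + 11 - 6 / n\<close>. Comparing the linear terms
  gives the condition \<open>11 - 4 * L > 6\<close>, which is where \<open>5/4\<close> comes from.
  Since zeta(3) lies well below \<open>5/4\<close>, crude upper bounds on the number of components
  suffice; the bound proved for \<open>L\<close> is \<open>31/25\<close>.

  The factor \<open>1 / (1 - q)\<close> in \<open>L\<close> arises because an edge \<open>f\<close>
  whose ends are not joined in \<open>G_q\<close> has \<open>W f \<ge> q\<close>, an event of
  probability \<open>1 - q\<close>: fixing \<open>W f = q\<close> instead divides by this
  probability. The identity for \<open>A\<close> holds already before integration, for each graph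
  \<open>G_q\<close>: \<open>2 n\<close> times the number of components minus one is the amount by
  which adjacent forest edges, counted over all unjoined pairs, fall short of four per pair.\<close>

text \<open>Almost surely the minimal spanning tree is the output of Kruskal's algorithm: an edge is
  taken iff its endpoints are not joined by lighter edges.  Write \<open>V\<close> for the vertex set, \<open>n = card V\<close>
  and \<open>G\<^sub>q\<close> for the graph of all edges of weight below \<open>q\<close>.

  By symmetry an edge lies in the tree with probability \<open>2 / n\<close>, and all pairs of disjoint edges lie
  in it with the same probability.  As the number of pairs of tree edges is fixed, the theorem becomes
  a lower bound on the expected number of pairs of adjacent tree edges.  Conditioning on the weight
  \<open>q\<close> of the heavier edge \<open>f\<close> of such a pair, the lighter ones are the edges of the Kruskal forest of
  \<open>G\<^sub>q\<close> that meet \<open>f\<close>, and a forest on a component of size \<open>c\<close> has degree sum \<open>2 (c - 1)\<close>.  Summing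
  over \<open>f\<close>, the expected number \<open>A\<close> of unordered adjacent pairs satisfies \<open>A + 2 n L = 4 (n - 1)\<close>,
  where \<open>L\<close> is the integral over \<open>q\<close> of \<open>(E[number of components of G\<^sub>q] - 1) / (1 - q)\<close>.

  Hence it suffices that \<open>L\<close> stays below \<open>5/4\<close>, and Frieze's argument gives \<open>L \<rightarrow> \<zeta>(3) = 1.202\<dots>\<close>: by a
  union bound over vertex sets and spanning trees, the components with \<open>k\<close> vertices contribute at most
  about \<open>1 / k\<^sup>3\<close>, and the large components are negligible.\<close>

section \<open>Components and the Kruskal forest\<close>

text \<open>A relation on the whole type, in which every point is joined to itself; a vertex set
  enters only in \<open>clusters\<close>.\<close>

definition joined :: "'v set set \<Rightarrow> ('v \<times> 'v) set" where
  "joined F = {(x, y). {x, y} \<in> F}\<^sup>*"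

definition linked :: "'v set set \<Rightarrow> 'v set \<Rightarrow> bool" where
  "linked F e \<longleftrightarrow> (\<exists>u v. e = {u, v} \<and> (u, v) \<in> joined F)"

definition cluster :: "'v set set \<Rightarrow> 'v \<Rightarrow> 'v set" where
  "cluster F v = joined F `` {v}"

definition clusters :: "'v set \<Rightarrow> 'v set set \<Rightarrow> 'v set set" where
  "clusters V F = cluster F ` V"

text \<open>A description without recursion: the ends of an edge are tested against all lighter
  edges, accepted or not. For injective weights this agrees with testing against the accepted ones,
  because these have the same components (first part of \<open>kruskal_sum\<close>).\<close>

definition kruskal :: "('v set \<Rightarrow> real) \<Rightarrow> 'v set set \<Rightarrow> 'v set set" where
  "kruskal W H = {e \<in> H. \<not> linked {g \<in> H. W g < W e} e}"

lemma joined_refl [simp]: "(x, x) \<in> joined F"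
  by (simp add: joined_def)

lemma joined_sym: "(x, y) \<in> joined F \<Longrightarrow> (y, x) \<in> joined F"
  unfolding joined_def
  by (rule symD[OF sym_rtrancl]) (auto intro!: symI simp: insert_commute)

lemma joined_trans: "(x, y) \<in> joined F \<Longrightarrow> (y, z) \<in> joined F \<Longrightarrow> (x, z) \<in> joined F"
  by (auto simp: joined_def)

lemma joined_edge: "{x, y} \<in> F \<Longrightarrow> (x, y) \<in> joined F"
  by (auto simp: joined_def)

lemma joined_mono: "F \<subseteq> F' \<Longrightarrow> joined F \<subseteq> joined F'"
  unfolding joined_def by (rule rtrancl_mono) auto

lemma joined_least:
  assumes "\<And>x y. {x, y} \<in> F \<Longrightarrow> (x, y) \<in> joined F'"
  shows "joined F \<subseteq> joined F'"
proof -
  have "{(x, y). {x, y} \<in> F} \<subseteq> joined F'"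
    using assms by auto
  then show ?thesis
    unfolding joined_def by (metis rtrancl_idemp rtrancl_mono)
qed

lemma joined_empty: "joined {} = Id"
  by (simp add: joined_def)

lemma joined_closed:
  assumes "(x, y) \<in> joined F" "x \<in> X" "\<And>u v. {u, v} \<in> F \<Longrightarrow> u \<in> X \<Longrightarrow> v \<in> X"
  shows "y \<in> X"
  using assms(1) unfolding joined_def
  by (induction rule: rtrancl_induct) (use assms in auto)

lemma linked_iff [simp]: "linked F {u, v} \<longleftrightarrow> (u, v) \<in> joined F"
  by (auto simp: linked_def doubleton_eq_iff intro: joined_sym)

lemma in_cluster_iff [simp]: "w \<in> cluster F v \<longleftrightarrow> (v, w) \<in> joined F"
  by (simp add: cluster_def)

lemma cluster_eq_iff: "cluster F u = cluster F v \<longleftrightarrow> (u, v) \<in> joined F"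
  by (auto simp: set_eq_iff intro: joined_trans joined_sym)

lemma cluster_subset:
  assumes "F \<subseteq> [V]\<^bsup>2\<^esup>" "v \<in> V"
  shows "cluster F v \<subseteq> V"
proof
  fix w assume "w \<in> cluster F v"
  then have "(v, w) \<in> joined F" by simp
  then show "w \<in> V"
    by (rule joined_closed) (use assms in \<open>auto simp: nsets_def\<close>)
qed

text \<open>A path can be shortened until it uses the new edge at most once, in one of its two
  directions.\<close>

lemma joined_insert:
  "(x, y) \<in> joined (insert {a, b} F) \<longleftrightarrow> (x, y) \<in> joined F \<or>
    (x, a) \<in> joined F \<and> (b, y) \<in> joined F \<or> (x, b) \<in> joined F \<and> (a, y) \<in> joined F"
proof -
  have "{(x, y). {x, y} \<in> insert {a, b} F} = insert (a, b) (insert (b, a) {(x, y). {x, y} \<in> F})"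
    by (auto simp: doubleton_eq_iff)
  then have "joined (insert {a, b} F) = (insert (a, b) (insert (b, a) {(x, y). {x, y} \<in> F}))\<^sup>*"
    by (simp add: joined_def)
  also have "(x, y) \<in> \<dots> \<longleftrightarrow> (x, y) \<in> joined F \<or>
    (x, a) \<in> joined F \<and> (b, y) \<in> joined F \<or> (x, b) \<in> joined F \<and> (a, y) \<in> joined F"
    unfolding rtrancl_insert joined_def[symmetric]
    by (auto intro: joined_trans joined_sym)
  finally show ?thesis .
qed

lemma joined_insert_linked:
  assumes "(a, b) \<in> joined F"
  shows "joined (insert {a, b} F) = joined F"
proof
  show "joined (insert {a, b} F) \<subseteq> joined F"
    by (rule joined_least) (use assms joined_sym[OF assms] in \<open>auto simp: doubleton_eq_iff joined_edge\<close>)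
qed (rule joined_mono, blast)

lemma cluster_insert:
  "cluster (insert {a, b} F) v =
    (if (v, a) \<in> joined F \<or> (v, b) \<in> joined F then cluster F a \<union> cluster F b else cluster F v)"
proof -
  have cong: "(v, w) \<in> joined F \<longleftrightarrow> (x, w) \<in> joined F" if "(v, x) \<in> joined F" for w x
    using that joined_sym[OF that] by (meson joined_trans)
  show ?thesis
    by (auto simp: joined_insert dest: cong)
qed

lemma clusters_insert:
  assumes "(a, b) \<notin> joined F" "a \<in> V" "b \<in> V"
  shows "clusters V (insert {a, b} F) =
    insert (cluster F a \<union> cluster F b) (clusters V F - {cluster F a, cluster F b})"
    (is "_ = insert ?U _")
proof (intro equalityI subsetI)
  fix C assume "C \<in> clusters V (insert {a, b} F)"
  then obtain v where "v \<in> V" "C = cluster (insert {a, b} F) v"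
    by (auto simp: clusters_def)
  then show "C \<in> insert ?U (clusters V F - {cluster F a, cluster F b})"
    by (cases "(v, a) \<in> joined F \<or> (v, b) \<in> joined F")
      (auto simp: clusters_def cluster_insert cluster_eq_iff)
next
  fix C assume "C \<in> insert ?U (clusters V F - {cluster F a, cluster F b})"
  then consider "C = ?U" | v where "v \<in> V" "C = cluster F v" "C \<noteq> cluster F a" "C \<noteq> cluster F b"
    by (auto simp: clusters_def)
  then show "C \<in> clusters V (insert {a, b} F)"
  proof cases
    case 1
    then have "C = cluster (insert {a, b} F) a"
      by (simp add: cluster_insert)
    then show ?thesis
      using assms(2) by (simp add: clusters_def)
  next
    case 2
    then have "C = cluster (insert {a, b} F) v"
      by (simp add: cluster_insert cluster_eq_iff)
    then show ?thesis
      using 2 by (simp add: clusters_def)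
  qed
qed

text \<open>Edges are added by increasing weight. An edge between joined vertices changes nothing;
  any other edge \<open>{a, b}\<close> is accepted and merges two clusters on which \<open>g\<close>
  has the same value, so the left side grows by \<open>2 * g a\<close> and the sum over clusters
  loses one term \<open>g a\<close>. As \<open>g\<close> is constant on clusters, the representative
  chosen by \<open>SOME\<close> does not matter. With \<open>g = 1\<close> this counts the forest
  edges; with \<open>g\<close> depending on the cluster size it is a weighted degree sum.\<close>

lemma kruskal_sum:
  fixes g :: "'v \<Rightarrow> real"
  assumes "finite V" "H \<subseteq> [V]\<^bsup>2\<^esup>" "inj_on W H"
    and "\<And>u v. (u, v) \<in> joined H \<Longrightarrow> g u = g v"
  shows "joined (kruskal W H) = joined H \<and>
    (\<Sum>e\<in>kruskal W H. \<Sum>u\<in>e. g u) =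
      2 * ((\<Sum>v\<in>V. g v) - (\<Sum>C\<in>clusters V H. g (SOME v. v \<in> C)))"
proof -
  have "finite H"
    using assms(1,2) finite_subset by (metis finite_imp_finite_nsets)
  then show ?thesis
    using assms(2-)
  proof (induction H rule: finite_ranking_induct[where f = W])
    case empty
    have "inj_on (\<lambda>v. {v}) V" by auto
    then show ?case
      by (simp add: kruskal_def clusters_def joined_empty sum.reindex cluster_def[abs_def])
  next
    case (insert e H)
    show ?case
    proof (cases "e \<in> H")
      case True
      then show ?thesis
        using insert.IH insert.prems by (simp add: insert_absorb)
    next
      case eH: False
      have fin: "finite (clusters V H)"
        using \<open>finite V\<close> by (simp add: clusters_def)
      have less: "W h < W e" if "h \<in> H" for h
        using insert.hyps(2)[OF that] inj_onD[OF insert.prems(2), of h e] that eH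
        by (auto simp: less_le)
      \<comment> \<open>As \<open>e\<close> is the heaviest edge, its test sees all of
        \<open>H\<close>, while the tests of the other edges do not see \<open>e\<close>.\<close>
      have S1: "{g \<in> insert e H. W g < W e} = H"
        using less by auto
      have S2: "{g \<in> insert e H. W g < W h} = {g \<in> H. W g < W h}" if "h \<in> H" for h
        using less[OF that] by auto
      have "e \<in> kruskal W (insert e H) \<longleftrightarrow> \<not> linked H e"
        by (simp only: kruskal_def mem_Collect_eq S1) simp
      moreover have "h \<in> kruskal W (insert e H) \<longleftrightarrow> h \<in> kruskal W H" if "h \<in> H" for h
        using that by (simp only: kruskal_def mem_Collect_eq S2) simp
      moreover have "kruskal W (insert e H) \<subseteq> insert e H" "kruskal W H \<subseteq> H"
        by (auto simp: kruskal_def)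
      ultimately have K: "kruskal W (insert e H) =
          (if linked H e then kruskal W H else insert e (kruskal W H))"
        using eH by auto
      have "e \<in> [V]\<^bsup>2\<^esup>"
        using insert.prems(1) by simp
      then obtain a b where e: "e = {a, b}" "a \<in> V" "b \<in> V" "a \<noteq> b"
        by (rule nsets2_E)
      have g: "g u = g v" if "(u, v) \<in> joined H" for u v
        using insert.prems(3) that joined_mono[of H "insert e H"] by blast
      have IH: "joined (kruskal W H) = joined H"
        "(\<Sum>e\<in>kruskal W H. \<Sum>u\<in>e. g u) =
          2 * ((\<Sum>v\<in>V. g v) - (\<Sum>C\<in>clusters V H. g (SOME v. v \<in> C)))"
        using insert.IH[OF _ _ g] insert.prems(1) inj_on_subset[OF insert.prems(2)] by blast+
      show ?thesis
      proof (cases "linked H e")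
        case True
        then have "joined (insert e H) = joined H"
          by (simp add: e joined_insert_linked)
        then have "clusters V (insert e H) = clusters V H"
          by (simp add: clusters_def cluster_def[abs_def])
        then show ?thesis
          using True IH \<open>joined (insert e H) = joined H\<close> by (simp add: K)
      next
        case False
        then have nab: "(a, b) \<notin> joined H" by (simp add: e)
        have gab: "g a = g b"
          using insert.prems(3)[of a b] by (auto simp: e intro: joined_edge)
        have gc: "g (SOME v. v \<in> cluster H x) = g x" for x
          using g[of x] someI[of "\<lambda>v. v \<in> cluster H x" x] by simp
        have "(SOME v. v \<in> cluster H a \<union> cluster H b) \<in> cluster H a \<union> cluster H b"
          by (rule someI[of _ a]) simp
        then have gu: "g (SOME v. v \<in> cluster H a \<union> cluster H b) = g a"
          using gab g by fastforce
        have neq: "cluster H a \<noteq> cluster H b"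
          using nab by (simp add: cluster_eq_iff)
        have in_comps: "cluster H a \<in> clusters V H" "cluster H b \<in> clusters V H"
          using e by (auto simp: clusters_def)
        have "cluster H a \<union> cluster H b \<noteq> cluster H x" for x
        proof
          assume "cluster H a \<union> cluster H b = cluster H x"
          then have "a \<in> cluster H x" "b \<in> cluster H x"
            by (metis UnCI in_cluster_iff joined_refl)+
          then show False
            using nab by (auto intro: joined_trans joined_sym)
        qed
        then have notin: "cluster H a \<union> cluster H b \<notin> clusters V H"
          by (auto simp: clusters_def)
        have "(\<Sum>C\<in>clusters V (insert e H). g (SOME v. v \<in> C)) =
            (\<Sum>C\<in>clusters V H. g (SOME v. v \<in> C)) - g a"
          using fin notin neq in_comps gab
          by (simp add: e clusters_insert[OF nab e(2,3)] gu[simplified] gc[simplified] sum_diff)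
        moreover have "joined (insert e (kruskal W H)) = joined (insert e H)"
          using IH(1) by (auto simp: e joined_insert)
        moreover have "finite (kruskal W H)" "e \<notin> kruskal W H"
          using insert.hyps eH by (auto simp: kruskal_def)
        ultimately show ?thesis
          using False IH(2) gab by (simp add: K) (simp add: e)
      qed
    qed
  qed
qed

section \<open>The minimal spanning tree\<close>

text \<open>The case \<open>g = 1\<close> of \<open>kruskal_sum\<close>: each forest edge
  contributes 2 to the left side.\<close>

lemma card_kruskal:
  assumes "finite V" "H \<subseteq> [V]\<^bsup>2\<^esup>" "inj_on W H"
  shows "card (kruskal W H) + card (clusters V H) = card V"
proof -
  have "real (card e) = 2" if "e \<in> kruskal W H" for e
    using that assms(2) by (auto simp: kruskal_def nsets_def)
  then have "2 * real (card (kruskal W H)) = 2 * (real (card V) - real (card (clusters V H)))"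
    using kruskal_sum[OF assms, of "\<lambda>_. 1"] by simp
  then have "real (card (kruskal W H) + card (clusters V H)) = real (card V)"
    by simp
  then show ?thesis by (simp only: of_nat_eq_iff)
qed

lemma is_cycle_mono: "is_cycle F p \<Longrightarrow> F \<subseteq> F' \<Longrightarrow> is_cycle F' p"
  by (auto simp: is_cycle_def)

text \<open>The requirement of length at least 3 matters here: on two vertices both steps of the
  closed walk would use the same edge.\<close>

lemma cycle_edges_distinct:
  assumes "length p \<ge> 3" "distinct p" "i < length p" "j < length p"
    and "{p ! i, p ! (Suc i mod length p)} = {p ! j, p ! (Suc j mod length p)}"
  shows "i = j"
proof (rule ccontr)
  assume "i \<noteq> j"
  have less: "Suc k mod length p < length p" for k
    using assms(1) by (intro mod_less_divisor) linarith
  from assms(5) \<open>i \<noteq> j\<close> have "i = Suc j mod length p" "j = Suc i mod length p"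
    using assms(2-4) less by (auto simp: doubleton_eq_iff nth_eq_iff_index_eq)
  moreover have "Suc k mod length p = (if Suc k = length p then 0 else Suc k)" if "k < length p" for k
    using that by (simp add: mod_Suc)
  ultimately show False
    using assms(1,3,4) by (auto split: if_splits)
qed

text \<open>The rest of the cycle joins the ends of the edge, and by
  \<open>cycle_edges_distinct\<close> it never uses the edge itself.\<close>

lemma cycle_edge_linked:
  assumes "is_cycle F p" "i < length p"
  defines "e \<equiv> {p ! i, p ! (Suc i mod length p)}"
  shows "linked (F - {e}) e"
proof -
  let ?n = "length p"
  have n: "?n \<ge> 3" "distinct p" and edge: "\<And>j. j < ?n \<Longrightarrow> {p ! j, p ! (Suc j mod ?n)} \<in> F"
    using assms(1) by (auto simp: is_cycle_def)
  have "(p ! (Suc i mod ?n), p ! ((i + Suc k) mod ?n)) \<in> joined (F - {e})" if "k < ?n" for k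
    using that
  proof (induction k)
    case 0
    then show ?case by simp
  next
    case (Suc k)
    let ?j = "(i + Suc k) mod ?n"
    have j: "?j < ?n" using n by (intro mod_less_divisor) linarith
    have "?j \<noteq> i"
    proof
      assume "?j = i"
      then have "(i + Suc k) mod ?n = i mod ?n" using assms(2) by simp
      then have "?n dvd Suc k" by (metis mod_eq_dvd_iff_nat le_add1 add_diff_cancel_left')
      then show False using Suc.prems by (auto dest: dvd_imp_le)
    qed
    then have "{p ! ?j, p ! (Suc ?j mod ?n)} \<noteq> e"
      using cycle_edges_distinct[OF n j assms(2)] by (auto simp: e_def)
    then have "{p ! ?j, p ! (Suc ?j mod ?n)} \<in> F - {e}"
      using edge[OF j] by simp
    moreover have "Suc ?j mod ?n = (i + Suc (Suc k)) mod ?n"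
      by (simp add: mod_Suc_eq)
    ultimately show ?case
      using Suc.IH Suc.prems by (metis Suc_lessD joined_edge joined_trans)
  qed
  \<comment> \<open>After \<open>?n - 1\<close> further steps the walk that started at
    \<open>Suc i\<close> is back at index \<open>i + ?n\<close>, which is \<open>i\<close> modulo
    \<open>?n\<close>.\<close>
  from this[of "?n - 1"] have "(p ! (Suc i mod ?n), p ! ((i + ?n) mod ?n)) \<in> joined (F - {e})"
    using n by (simp add: Suc_diff_le[symmetric])
  then have "(p ! (Suc i mod ?n), p ! i) \<in> joined (F - {e})"
    using assms(2) by simp
  then show ?thesis
    unfolding e_def by (simp add: joined_sym)
qed

text \<open>The heaviest edge of a cycle has its ends joined by the other, lighter edges of the
  cycle, so it would have been rejected.\<close>

lemma kruskal_no_cycle: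
  assumes "inj_on W H"
  shows "\<not> is_cycle (kruskal W H) p"
proof
  assume cyc: "is_cycle (kruskal W H) p"
  let ?e = "\<lambda>i. {p ! i, p ! (Suc i mod length p)}"
  define F where "F = ?e ` {..<length p}"
  have F: "F \<subseteq> kruskal W H" "finite F" "F \<noteq> {}"
    using cyc by (auto simp: is_cycle_def F_def lessThan_empty_iff)
  have "is_cycle F p"
    using cyc by (auto simp: is_cycle_def F_def)
  obtain e where "e \<in> F" "W e = Max (W ` F)"
    using obtains_MAX[OF F(2,3), of W] by metis
  then have e: "e \<in> F" "\<And>g. g \<in> F \<Longrightarrow> W g \<le> W e"
    using F(2) by auto
  then obtain i where i: "i < length p" "e = ?e i"
    by (auto simp: F_def)
  have FH: "F \<subseteq> H" using F(1) by (auto simp: kruskal_def)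
  then have "F - {e} \<subseteq> {g \<in> H. W g < W e}"
    using e inj_onD[OF assms] by (fastforce simp: less_le)
  moreover have "linked (F - {e}) e"
    using cycle_edge_linked[OF \<open>is_cycle F p\<close> i(1)] i(2) by simp
  ultimately have "linked {g \<in> H. W g < W e} e"
    using joined_mono[of "F - {e}" "{g \<in> H. W g < W e}"] by (auto simp: linked_def)
  then show False
    using e(1) F(1) by (auto simp: kruskal_def)
qed

lemma connected_graph_iff:
  "connected_graph (V, F) \<longleftrightarrow> V \<noteq> {} \<and> (\<forall>u\<in>V. \<forall>v\<in>V. (u, v) \<in> joined F)"
  by (simp add: connected_graph_def joined_def)

lemma card_clusters_connected:
  assumes "connected_graph (V, F)"
  shows "card (clusters V F) = 1"
proof -
  obtain v where v: "v \<in> V" "\<And>w. w \<in> V \<Longrightarrow> cluster F w = cluster F v"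
    using assms by (auto simp: connected_graph_iff cluster_eq_iff)
  have "clusters V F = (\<lambda>_. cluster F v) ` V"
    unfolding clusters_def by (rule image_cong[OF refl v(2)])
  also have "\<dots> = {cluster F v}"
    using v(1) by (rule image_constant)
  finally show ?thesis by simp
qed

lemma spanning_tree_kruskal:
  assumes "finite V" "E \<subseteq> [V]\<^bsup>2\<^esup>" "inj_on W E" "connected_graph (V, E)"
  shows "spanning_tree (V, E) (kruskal W E)"
  using kruskal_sum[OF assms(1-3), of "\<lambda>_. 0"] assms(4) kruskal_no_cycle[OF assms(3)]
  by (auto simp: spanning_tree_def tree_def connected_graph_iff kruskal_def)

text \<open>Exchange argument: if the ends of a tree edge \<open>e\<close> are joined by lighter
  edges, one of these crosses the cut left by removing \<open>e\<close>, and swapping it in gives a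
  lighter spanning tree.\<close>

lemma MST_subset_kruskal:
  assumes E: "finite V" "E \<subseteq> [V]\<^bsup>2\<^esup>" and W: "inj_on W E" "\<And>e. e \<in> E \<Longrightarrow> 0 < W e"
    and T: "is_MST (V, E) W T"
  shows "T \<subseteq> kruskal W E"
proof
  fix e assume "e \<in> T"
  have min: "(\<Sum>e\<in>T. W e) \<le> (\<Sum>e\<in>T'. W e)" if "spanning_tree (V, E) T'" for T'
    using T that by (auto simp: is_MST_def)
  have TE: "T \<subseteq> E" and conn: "V \<noteq> {}" "\<And>u v. u \<in> V \<Longrightarrow> v \<in> V \<Longrightarrow> (u, v) \<in> joined T"
    and acyc: "\<And>p. \<not> is_cycle T p"
    using T by (auto simp: is_MST_def spanning_tree_def tree_def connected_graph_iff)
  have finT: "finite T"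
    using TE E by (meson finite_imp_finite_nsets finite_subset)
  have "e \<in> E" using TE \<open>e \<in> T\<close> by blast
  then have "e \<in> [V]\<^bsup>2\<^esup>" using E by blast
  then obtain u v where e: "e = {u, v}" "u \<in> V" "v \<in> V" "u \<noteq> v"
    by (rule nsets2_E)
  have ins: "insert {u, v} (T - {e}) = T"
    using \<open>e \<in> T\<close> e by auto
  have sum_e: "(\<Sum>e\<in>T. W e) = W e + (\<Sum>e\<in>T - {e}. W e)"
    using finT \<open>e \<in> T\<close> by (rule sum.remove)
  \<comment> \<open>Positivity of the weights enters here: if \<open>T - {e}\<close> still joined
    \<open>u\<close> and \<open>v\<close>, it would be a spanning tree of smaller weight.\<close>
  have nuv: "(u, v) \<notin> joined (T - {e})"
  proof
    assume "(u, v) \<in> joined (T - {e})"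
    then have "joined (T - {e}) = joined T"
      using joined_insert_linked[of u v "T - {e}"] ins by simp
    then have "spanning_tree (V, E) (T - {e})"
      using TE conn acyc is_cycle_mono[of "T - {e}" _ T]
      by (auto simp: spanning_tree_def tree_def connected_graph_iff)
    from min[OF this] show False
      using sum_e W(2)[OF \<open>e \<in> E\<close>] by simp
  qed
  show "e \<in> kruskal W E"
  proof (rule ccontr)
    assume "e \<notin> kruskal W E"
    then have "(u, v) \<in> joined {g \<in> E. W g < W e}"
      using \<open>e \<in> E\<close> e(1) by (simp add: kruskal_def)
    \<comment> \<open>The path of lighter edges from \<open>u\<close> to \<open>v\<close> has to
      leave the component of \<open>u\<close> in \<open>T - {e}\<close>.\<close>
    then have "\<exists>a b. {a, b} \<in> {g \<in> E. W g < W e} \<and>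
        a \<in> cluster (T - {e}) u \<and> b \<notin> cluster (T - {e}) u"
      using joined_closed[of u v "{g \<in> E. W g < W e}" "cluster (T - {e}) u"] nuv by auto
    then obtain a b where ab: "{a, b} \<in> E" "W {a, b} < W e"
      "(u, a) \<in> joined (T - {e})" "(u, b) \<notin> joined (T - {e})"
      by auto
    have nab: "(a, b) \<notin> joined (T - {e})"
      using ab(3,4) joined_trans by metis
    then have nT: "{a, b} \<notin> T - {e}"
      using joined_edge by metis
    define T' where "T' = insert {a, b} (T - {e})"
    have "b \<in> V"
      using ab(1) E(2) by auto
    then have "(u, b) \<in> joined T"
      using conn(2) e(2) by auto
    \<comment> \<open>The vertex \<open>b\<close> is reachable from \<open>u\<close> in
      \<open>T\<close> but not in \<open>T - {e}\<close>, so the path passes through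
      \<open>e\<close> and \<open>b\<close> lies on the side of \<open>v\<close>.\<close>
    then have vb: "(v, b) \<in> joined (T - {e})"
      using joined_insert[of u b u v "T - {e}"] ab(4) nuv ins by auto
    have sub: "joined (T - {e}) \<subseteq> joined T'"
      unfolding T'_def by (rule joined_mono) auto
    have "(u, v) \<in> joined T'"
      using sub ab(3) vb joined_edge[of a b T']
      by (auto simp: T'_def) (meson joined_sym joined_trans subsetD)
    then have "joined (insert {u, v} T') = joined T'"
      by (rule joined_insert_linked)
    moreover have "joined T \<subseteq> joined (insert {u, v} T')"
      using ins by (intro joined_mono) (auto simp: T'_def)
    ultimately have "\<forall>u\<in>V. \<forall>v\<in>V. (u, v) \<in> joined T'"
      using conn(2) by auto
    moreover have "\<not> is_cycle T' p" for p
    proof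
      assume cyc: "is_cycle T' p"
      show False
      proof (cases "\<exists>i<length p. {p ! i, p ! (Suc i mod length p)} = {a, b}")
        case True
        then have "linked (T' - {{a, b}}) {a, b}"
          using cycle_edge_linked[OF cyc] by metis
        moreover have "T' - {{a, b}} \<subseteq> T - {e}"
          by (auto simp: T'_def)
        ultimately show False
          using nab joined_mono[of "T' - {{a, b}}" "T - {e}"] by auto
      next
        case False
        then have "is_cycle T p"
          using cyc by (auto simp: is_cycle_def T'_def)
        then show False using acyc by blast
      qed
    qed
    ultimately have "spanning_tree (V, E) T'"
      using conn(1) TE ab(1) by (auto simp: spanning_tree_def tree_def connected_graph_iff T'_def)
    from min[OF this] show False
      using sum_e ab(2) finT nT by (simp add: T'_def)
  qed
qed

text \<open>One inclusion is known, so comparing sizes is enough. Applying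
  \<open>card_kruskal\<close> to the tree itself gives a subset of it with \<open>card V - 1\<close>
  edges, hence the tree is at least as large as \<open>kruskal W E\<close>.\<close>

lemma MST_eq_kruskal:
  assumes E: "finite V" "E \<subseteq> [V]\<^bsup>2\<^esup>" "connected_graph (V, E)"
    and W: "inj_on W E" "\<And>e. e \<in> E \<Longrightarrow> 0 < W e"
  shows "MST (V, E) W = kruskal W E"
proof -
  let ?S = "{T. spanning_tree (V, E) T}"
  have "finite E"
    using E by (meson finite_imp_finite_nsets finite_subset)
  moreover have "?S \<subseteq> Pow E"
    by (auto simp: spanning_tree_def)
  ultimately have "finite ?S"
    by (meson finite_Pow_iff finite_subset)
  moreover have "?S \<noteq> {}"
    using spanning_tree_kruskal[OF E(1,2) W(1) E(3)] by blast
  ultimately obtain T where "is_arg_min (\<lambda>T. \<Sum>e\<in>T. W e) (\<lambda>T. T \<in> ?S) T"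
    using ex_is_arg_min_if_finite by blast
  then have "is_MST (V, E) W T"
    by (auto simp: is_MST_def is_arg_min_linorder)
  then have MST: "is_MST (V, E) W (MST (V, E) W)" (is "is_MST _ _ ?T")
    unfolding MST_def by (rule someI)
  then have sub: "?T \<subseteq> kruskal W E"
    by (intro MST_subset_kruskal[OF E(1,2) W])
  have "kruskal W E \<subseteq> E" by (auto simp: kruskal_def)
  with sub have TE: "?T \<subseteq> E" by blast
  have finK: "finite (kruskal W E)" "finite ?T"
    using \<open>finite E\<close> TE \<open>kruskal W E \<subseteq> E\<close> finite_subset by blast+
  have "connected_graph (V, ?T)"
    using MST by (auto simp: is_MST_def spanning_tree_def tree_def)
  then have "card (kruskal W ?T) + 1 = card V"
    using card_kruskal[of V ?T W] E TE W(1) inj_on_subset[of W E ?T] card_clusters_connected[of V ?T]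
    by auto
  moreover have "card (kruskal W ?T) \<le> card ?T"
    using finK by (intro card_mono) (auto simp: kruskal_def)
  moreover have "card (kruskal W E) + 1 = card V"
    using card_kruskal[OF E(1,2) W(1)] card_clusters_connected[OF E(3)] by simp
  ultimately have "card (kruskal W E) \<le> card ?T" by linarith
  then show ?thesis
    using card_seteq[OF finK(1) sub] by simp
qed

section \<open>Counting spanning trees\<close>

text \<open>Grouped by the size of \<open>S\<close>, the left side is \<open>r\<close> times the
  derivative in \<open>r\<close> of the binomial expansion of
  \<open>(r + m) ^ card M\<close>.\<close>

lemma sum_Pow_card_power:
  fixes r m :: nat
  assumes "finite M" "card M = Suc m'"
  shows "(\<Sum>S\<in>Pow M. card S * r ^ card S * m ^ (card M - card S)) = Suc m' * r * (r + m) ^ m'"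
proof -
  have "(\<Sum>S\<in>Pow M. card S * r ^ card S * m ^ (card M - card S)) =
      (\<Sum>s\<le>Suc m'. \<Sum>S | S \<in> Pow M \<and> card S = s. card S * r ^ card S * m ^ (card M - card S))"
    using assms by (intro sum.group[symmetric]) (auto intro: card_mono simp flip: assms(2))
  also have "\<dots> = (\<Sum>s\<le>Suc m'. (Suc m' choose s) * (s * r ^ s * m ^ (Suc m' - s)))"
    using n_subsets[OF assms(1)] assms(2) by (intro sum.cong) auto
  also have "\<dots> = (\<Sum>j\<le>m'. (Suc m' choose Suc j) * (Suc j * r ^ Suc j * m ^ (m' - j)))"
    by (subst sum.atMost_Suc_shift) simp
  also have "\<dots> = (\<Sum>j\<le>m'. Suc m' * r * ((m' choose j) * r ^ j * m ^ (m' - j)))"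
  proof (rule sum.cong)
    fix j
    have "(Suc m' choose Suc j) * Suc j = Suc m' * (m' choose j)"
      using Suc_times_binomial_eq[of m' j] by simp
    then show "(Suc m' choose Suc j) * (Suc j * r ^ Suc j * m ^ (m' - j)) =
        Suc m' * r * ((m' choose j) * r ^ j * m ^ (m' - j))"
      by (metis (no_types, lifting) mult.assoc mult.commute mult.left_commute power_Suc)
  qed simp
  also have "\<dots> = Suc m' * r * (r + m) ^ m'"
    by (simp only: sum_distrib_left[symmetric] binomial_ring of_nat_id)
  finally show ?thesis .
qed

text \<open>The cut form of saying that every vertex of \<open>M\<close> is connected to
  \<open>R\<close> inside \<open>M \<union> R\<close>. It passes directly to subsets when a layer of
  vertices is removed.\<close>

definition reaches :: "'v set set \<Rightarrow> 'v set \<Rightarrow> 'v set \<Rightarrow> bool" where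
  "reaches G M R \<longleftrightarrow> (\<forall>X. X \<subseteq> M \<and> X \<noteq> {} \<longrightarrow> (\<exists>x\<in>X. \<exists>y\<in>(M \<union> R) - X. {x, y} \<in> G))"

text \<open>The family is meant to consist of the spanning forests of \<open>M\<close> rooted at
  \<open>R\<close>, which have \<open>card M\<close> edges. Acyclicity is not demanded: a union
  bound needs only the number and the size of the members.\<close>

definition forest_cover :: "'v set \<Rightarrow> 'v set \<Rightarrow> 'v set set set \<Rightarrow> bool" where
  "forest_cover M R \<F> \<longleftrightarrow> finite \<F> \<and> (\<forall>\<tau>\<in>\<F>. \<tau> \<subseteq> [M \<union> R]\<^bsup>2\<^esup> \<and> card \<tau> = card M) \<and>
     (\<forall>G. reaches G M R \<longrightarrow> (\<exists>\<tau>\<in>\<F>. \<tau> \<subseteq> G))"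

text \<open>Sort the vertices of \<open>M\<close> by their distance to \<open>R\<close>: if \<open>S\<close> is the first layer, a forest
  consists of a map from \<open>S\<close> to \<open>R\<close> and a forest for \<open>M - S\<close> rooted at \<open>S\<close>.  This gives the
  upper bound in Cayley's formula for rooted forests.\<close>

lemma forest_cover_step:
  assumes "finite M" "finite R" "M \<inter> R = {}" "M \<noteq> {}"
    and cov: "\<And>S. S \<subseteq> M \<Longrightarrow> S \<noteq> {} \<Longrightarrow> forest_cover (M - S) S (\<F> S)"
  defines "\<G> \<equiv> (\<Union>S\<in>Pow M - {{}}. (\<lambda>(g, \<tau>). (\<lambda>s. {s, g s}) ` S \<union> \<tau>) ` ((S \<rightarrow>\<^sub>E R) \<times> \<F> S))"
  shows "forest_cover M R \<G>"
    and "card \<G> \<le> (\<Sum>S\<in>Pow M - {{}}. card R ^ card S * card (\<F> S))"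
proof -
  have fin: "finite ((S \<rightarrow>\<^sub>E R) \<times> \<F> S)" if "S \<in> Pow M - {{}}" for S
    using that cov[of S] assms(1,2) finite_subset[of S M]
    by (auto simp: forest_cover_def intro!: finite_PiE)
  have fin': "finite (Pow M - {{}})"
    using assms(1) by simp
  show "forest_cover M R \<G>"
    unfolding forest_cover_def
  proof (intro conjI ballI allI impI)
    show "finite \<G>"
      unfolding \<G>_def using fin fin' by (intro finite_UN_I finite_imageI)
  next
    fix \<sigma> assume "\<sigma> \<in> \<G>"
    then obtain S g \<tau> where S: "S \<subseteq> M" "S \<noteq> {}" and g: "g \<in> S \<rightarrow>\<^sub>E R" and "\<tau> \<in> \<F> S"
      and \<sigma>: "\<sigma> = (\<lambda>s. {s, g s}) ` S \<union> \<tau>"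
      by (auto simp: \<G>_def)
    then have \<tau>: "\<tau> \<subseteq> [M]\<^bsup>2\<^esup>" "card \<tau> = card (M - S)"
      using cov[OF S] by (auto simp: forest_cover_def Un_absorb2)
    have finS: "finite S" "finite \<tau>"
      using S \<tau>(1) assms(1) finite_subset finite_imp_finite_nsets by blast+
    have gR: "g s \<in> R" if "s \<in> S" for s
      using g that by auto
    have "s \<in> M" "s \<noteq> g s" if "s \<in> S" for s
      using that gR[OF that] S assms(3) by auto
    then show "\<sigma> \<subseteq> [M \<union> R]\<^bsup>2\<^esup>"
      using \<tau>(1) nsets_mono[of M "M \<union> R" 2] gR by (auto simp: \<sigma>)
    have "inj_on (\<lambda>s. {s, g s}) S"
      using gR S assms(3) by (auto simp: inj_on_def doubleton_eq_iff)
    then have "card ((\<lambda>s. {s, g s}) ` S) = card S"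
      by (rule card_image)
    moreover have "(\<lambda>s. {s, g s}) ` S \<inter> \<tau> = {}"
    proof -
      have "{s, g s} \<notin> [M]\<^bsup>2\<^esup>" if "s \<in> S" for s
        using gR[OF that] assms(3) by auto
      then show ?thesis using \<tau>(1) by blast
    qed
    ultimately have "card \<sigma> = card S + card (M - S)"
      using finS \<tau>(2) by (simp add: \<sigma> card_Un_disjoint)
    also have "\<dots> = card M"
      using S(1) assms(1) finS by (simp add: card_Diff_subset card_mono)
    finally show "card \<sigma> = card M" .
  next
    fix G assume G: "reaches G M R"
    define S where "S = {x \<in> M. \<exists>y\<in>R. {x, y} \<in> G}"
    have "S \<subseteq> M" by (auto simp: S_def)
    have "S \<noteq> {}"
      using G assms(4) by (auto simp: reaches_def S_def)
    have "reaches G (M - S) S"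
      unfolding reaches_def
    proof (intro allI impI)
      fix X assume X: "X \<subseteq> M - S \<and> X \<noteq> {}"
      then obtain x y where xy: "x \<in> X" "y \<in> (M \<union> R) - X" "{x, y} \<in> G"
        using G unfolding reaches_def by (metis Diff_subset subset_trans)
      then have "y \<notin> R" using X by (auto simp: S_def)
      then show "\<exists>x\<in>X. \<exists>y\<in>(M - S \<union> S) - X. {x, y} \<in> G"
        using xy by auto
    qed
    then obtain \<tau> where \<tau>: "\<tau> \<in> \<F> S" "\<tau> \<subseteq> G"
      using cov[OF \<open>S \<subseteq> M\<close> \<open>S \<noteq> {}\<close>] by (auto simp: forest_cover_def)
    have "\<forall>x\<in>S. \<exists>y. y \<in> R \<and> {x, y} \<in> G"
      by (auto simp: S_def)
    then obtain g where g: "\<And>x. x \<in> S \<Longrightarrow> g x \<in> R \<and> {x, g x} \<in> G"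
      by metis
    let ?g = "restrict g S"
    have "(\<lambda>s. {s, ?g s}) ` S \<union> \<tau> \<in> \<G>"
      unfolding \<G>_def using \<open>S \<subseteq> M\<close> \<open>S \<noteq> {}\<close> \<tau>(1) g
      by (intro UN_I[of S] image_eqI[of _ _ "(?g, \<tau>)"]) auto
    moreover have "(\<lambda>s. {s, ?g s}) ` S \<union> \<tau> \<subseteq> G"
      using g \<tau>(2) by auto
    ultimately show "\<exists>\<tau>\<in>\<G>. \<tau> \<subseteq> G" by blast
  qed
  have "card \<G> \<le> (\<Sum>S\<in>Pow M - {{}}. card ((\<lambda>(g, \<tau>). (\<lambda>s. {s, g s}) ` S \<union> \<tau>) ` ((S \<rightarrow>\<^sub>E R) \<times> \<F> S)))"
    unfolding \<G>_def by (rule card_UN_le[OF fin'])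
  also have "\<dots> \<le> (\<Sum>S\<in>Pow M - {{}}. card ((S \<rightarrow>\<^sub>E R) \<times> \<F> S))"
    by (intro sum_mono card_image_le fin)
  also have "\<dots> = (\<Sum>S\<in>Pow M - {{}}. card R ^ card S * card (\<F> S))"
    using assms(1) by (intro sum.cong refl) (auto simp: card_cartesian_product card_PiE finite_subset)
  finally show "card \<G> \<le> (\<Sum>S\<in>Pow M - {{}}. card R ^ card S * card (\<F> S))" .
qed

text \<open>With \<open>m = card M\<close> and \<open>r = card R\<close> the bound is Cayley's
  \<open>r * (m + r) ^ (m - 1)\<close>, multiplied by \<open>m + r\<close> so that it also makes
  sense for \<open>m = 0\<close>. The recursion over the first layer is solved exactly by
  \<open>sum_Pow_card_power\<close>.\<close>

lemma forest_cover_exists: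
  assumes "finite M" "finite R" "M \<inter> R = {}"
  shows "\<exists>\<F>. forest_cover M R \<F> \<and>
    (card M + card R) * card \<F> \<le> card R * (card M + card R) ^ card M"
  using assms
proof (induction "card M" arbitrary: M R rule: less_induct)
  case less
  show ?case
  proof (cases "M = {}")
    case True
    then show ?thesis
      by (intro exI[of _ "{{}}"]) (auto simp: forest_cover_def)
  next
    case False
    have "\<exists>\<F>. forest_cover (M - S) S \<F> \<and>
        (card (M - S) + card S) * card \<F> \<le> card S * (card (M - S) + card S) ^ card (M - S)"
      if "S \<subseteq> M" "S \<noteq> {}" for S
    proof (rule less.hyps)
      show "card (M - S) < card M"
        using that less.prems(1) by (intro psubset_card_mono) auto
    qed (use that less.prems(1) finite_subset in auto)
    then obtain \<F> where \<F>: "\<And>S. S \<subseteq> M \<Longrightarrow> S \<noteq> {} \<Longrightarrow> forest_cover (M - S) S (\<F> S)"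
      "\<And>S. S \<subseteq> M \<Longrightarrow> S \<noteq> {} \<Longrightarrow>
        (card (M - S) + card S) * card (\<F> S) \<le> card S * (card (M - S) + card S) ^ card (M - S)"
      by metis
    obtain \<G> where \<G>: "forest_cover M R \<G>"
      "card \<G> \<le> (\<Sum>S\<in>Pow M - {{}}. card R ^ card S * card (\<F> S))"
      using forest_cover_step[OF less.prems False \<F>(1)] by blast
    obtain m' where m': "card M = Suc m'"
      using False less.prems(1) by (metis card_eq_0_iff not0_implies_Suc)
    \<comment> \<open>The bound on \<open>\<F> S\<close> comes with the factor
      \<open>card (M - S) + card S\<close>, which is \<open>card M\<close> for every
      \<open>S\<close>.\<close>
    have "card M * card \<G> \<le> card M * (\<Sum>S\<in>Pow M - {{}}. card R ^ card S * card (\<F> S))"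
      using \<G>(2) by (rule mult_left_mono) simp
    also have "\<dots> = (\<Sum>S\<in>Pow M - {{}}. card R ^ card S * (card M * card (\<F> S)))"
      by (simp add: sum_distrib_left mult.left_commute)
    also have "\<dots> \<le> (\<Sum>S\<in>Pow M - {{}}. card R ^ card S * (card S * card M ^ (card M - card S)))"
    proof (intro sum_mono mult_left_mono)
      fix S assume "S \<in> Pow M - {{}}"
      then have S: "S \<subseteq> M" "S \<noteq> {}" by auto
      have "card (M - S) = card M - card S" "card S \<le> card M"
        using S less.prems(1) by (auto simp: card_Diff_subset finite_subset card_mono)
      then show "card M * card (\<F> S) \<le> card S * card M ^ (card M - card S)"
        using \<F>(2)[OF S] by simp
    qed simp
    also have "\<dots> \<le> (\<Sum>S\<in>Pow M. card R ^ card S * (card S * card M ^ (card M - card S)))"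
      using less.prems(1) by (intro sum_mono2) auto
    also have "\<dots> = (\<Sum>S\<in>Pow M. card S * card R ^ card S * card M ^ (card M - card S))"
      by (simp add: ac_simps)
    also have "\<dots> = card M * (card R * (card R + card M) ^ m')"
      unfolding sum_Pow_card_power[OF less.prems(1) m'] by (simp only: m' mult.assoc)
    finally have "card \<G> \<le> card R * (card R + card M) ^ m'"
      using m' by (metis Suc_mult_le_cancel1)
    then have "(card M + card R) * card \<G> \<le> (card M + card R) * (card R * (card R + card M) ^ m')"
      by (rule mult_left_mono) simp
    also have "\<dots> = card R * (card M + card R) ^ card M"
      by (simp only: m' power_Suc ac_simps)
    finally show ?thesis
      using \<G>(1) by blast
  qed
qed

text \<open>A forest rooted at a single vertex \<open>v\<close> of \<open>A\<close> is a tree on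
  \<open>A\<close>, which leaves \<open>k ^ (k - 2)\<close> candidates for
  \<open>k = card A\<close>; the extra factor \<open>card A\<close> avoids the exponent
  \<open>k - 2\<close>. If \<open>A\<close> is a cluster, a nonempty part of it without
  \<open>v\<close> must have an edge to the rest of \<open>A\<close>. One family serves all graphs,
  as the union bound requires.\<close>

lemma cluster_tree_cover:
  assumes "finite A" "A \<noteq> {}"
  obtains \<F> where "finite \<F>" "card A * card \<F> \<le> card A ^ (card A - 1)"
    "\<And>\<tau>. \<tau> \<in> \<F> \<Longrightarrow> \<tau> \<subseteq> [A]\<^bsup>2\<^esup> \<and> card \<tau> = card A - 1"
    "\<And>V G. A \<in> clusters V G \<Longrightarrow> \<exists>\<tau>\<in>\<F>. \<tau> \<subseteq> G"
proof -
  obtain v where "v \<in> A" using assms(2) by blast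
  have reach: "reaches G (A - {v}) {v}" if A: "A \<in> clusters V G" for V G
    unfolding reaches_def
  proof (intro allI impI, rule ccontr)
    fix X assume X: "X \<subseteq> A - {v} \<and> X \<noteq> {}"
      and no: "\<not> (\<exists>x\<in>X. \<exists>y\<in>A - {v} \<union> {v} - X. {x, y} \<in> G)"
    obtain w where w: "A = cluster G w"
      using A by (auto simp: clusters_def)
    obtain x where "x \<in> X" using X by blast
    then have "x \<in> cluster G w" using X w by blast
    then have "(x, v) \<in> joined G"
      using \<open>v \<in> A\<close> w by (auto intro: joined_sym joined_trans)
    then have "v \<in> X"
    proof (rule joined_closed[OF _ \<open>x \<in> X\<close>])
      fix a b assume ab: "{a, b} \<in> G" "a \<in> X"
      then have "a \<in> cluster G w" using X w by blast
      then have "b \<in> A"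
        using joined_edge[OF ab(1)] w joined_trans[of w a G b] by simp
      then show "b \<in> X"
        using no ab by auto
    qed
    then show False using X by blast
  qed
  obtain \<F> where "forest_cover (A - {v}) {v} \<F>"
    "(card (A - {v}) + card {v}) * card \<F> \<le> card {v} * (card (A - {v}) + card {v}) ^ card (A - {v})"
    using forest_cover_exists[of "A - {v}" "{v}"] assms(1) by auto
  moreover have "A - {v} \<union> {v} = A" "card (A - {v}) = card A - 1" "card A - 1 + 1 = card A"
    using \<open>v \<in> A\<close> assms(1) card_gt_0_iff[of A] by auto
  ultimately show ?thesis
    using reach by (intro that[of \<F>]) (auto simp: forest_cover_def)
qed

section \<open>Unlinked pairs and components\<close>

lemma clusters_partition:
  assumes "finite V" "G \<subseteq> [V]\<^bsup>2\<^esup>"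
  shows "finite (clusters V G)" "(\<Sum>C\<in>clusters V G. card C) = card V"
    "\<And>C. C \<in> clusters V G \<Longrightarrow> finite C \<and> C \<noteq> {} \<and> C \<subseteq> V"
proof -
  show fin: "finite (clusters V G)"
    using assms(1) by (simp add: clusters_def)
  show C: "finite C \<and> C \<noteq> {} \<and> C \<subseteq> V" if A: "C \<in> clusters V G" for C
  proof -
    obtain v where v: "v \<in> V" "C = cluster G v"
      using A by (auto simp: clusters_def)
    then have "v \<in> C" "C \<subseteq> V"
      using cluster_subset[OF assms(2)] by auto
    then show ?thesis
      using assms(1) finite_subset by blast
  qed
  have "C = D" if CD: "C \<in> clusters V G" "D \<in> clusters V G" "x \<in> C" "x \<in> D" for C D x
  proof -
    obtain v w where v: "C = cluster G v" "D = cluster G w"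
      using CD(1,2) by (auto simp: clusters_def)
    then have "cluster G v = cluster G x" "cluster G w = cluster G x"
      using CD(3,4) by (simp_all add: cluster_eq_iff)
    then show ?thesis using v by simp
  qed
  then have "disjoint (clusters V G)"
    by (auto simp: disjoint_def)
  then have "card (\<Union>(clusters V G)) = (\<Sum>C\<in>clusters V G. card C)"
    using C by (intro card_Union_disjoint) (auto simp: disjoint_def)
  moreover have "\<Union>(clusters V G) = V"
    using C by (auto simp: clusters_def)
  ultimately show "(\<Sum>C\<in>clusters V G. card C) = card V"
    by simp
qed

text \<open>The pairs that Kruskal's algorithm would accept as the next edge once the edges of
  \<open>G\<close> have been treated.\<close>

definition unlinked :: "'v set \<Rightarrow> 'v set set \<Rightarrow> 'v set set" where
  "unlinked V G = {f \<in> [V]\<^bsup>2\<^esup>. \<not> linked G f}"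

lemma card_unlinked_at:
  assumes "finite V" "G \<subseteq> [V]\<^bsup>2\<^esup>" "v \<in> V"
  shows "card {f \<in> unlinked V G. v \<in> f} = card V - card (cluster G v)"
proof -
  have "{f \<in> unlinked V G. v \<in> f} = (\<lambda>w. {v, w}) ` (V - cluster G v)"
  proof (intro equalityI subsetI)
    fix f assume "f \<in> {f \<in> unlinked V G. v \<in> f}"
    then have f: "f \<in> [V]\<^bsup>2\<^esup>" "\<not> linked G f" "v \<in> f"
      by (auto simp: unlinked_def)
    obtain x y where "f = {x, y}" "x \<in> V" "y \<in> V" "x \<noteq> y"
      using f(1) by (rule nsets2_E)
    then obtain w where "f = {v, w}" "w \<in> V"
      using f(3) by (auto simp: insert_commute)
    then show "f \<in> (\<lambda>w. {v, w}) ` (V - cluster G v)"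
      using f(2) by auto
  qed (use assms in \<open>auto simp: unlinked_def\<close>)
  moreover have "inj_on (\<lambda>w. {v, w}) (V - cluster G v)"
    by (auto simp: inj_on_def doubleton_eq_iff)
  ultimately have "card {f \<in> unlinked V G. v \<in> f} = card (V - cluster G v)"
    by (simp add: card_image)
  then show ?thesis
    using cluster_subset[OF assms(2,3)] assms(1) by (simp add: card_Diff_subset finite_subset)
qed

text \<open>Both sides are, up to the last term, sums of \<open>card V - card (cluster G v)\<close>: over all
  vertices on the left, and over the endpoints of the edges of a spanning forest on the right.\<close>

lemma unlinked_identity:
  assumes "finite V" "G \<subseteq> [V]\<^bsup>2\<^esup>" "inj_on W G"
  shows "4 * real (card (unlinked V G)) =
    (\<Sum>f\<in>unlinked V G. real (card {e \<in> kruskal W G. e \<inter> f \<noteq> {}})) +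
    2 * real (card V) * (real (card (clusters V G)) - 1)"
proof -
  define g where "g v = real (card V) - real (card (cluster G v))" for v
  let ?U = "unlinked V G" and ?K = "kruskal W G"
  have finU: "finite ?U"
    unfolding unlinked_def using assms(1) by (simp add: finite_imp_finite_nsets)
  have KG: "?K \<subseteq> [V]\<^bsup>2\<^esup>"
    using assms(2) by (auto simp: kruskal_def)
  then have finK: "finite ?K"
    using assms(1) finite_imp_finite_nsets finite_subset by blast
  have cardU: "real (card {f \<in> ?U. v \<in> f}) = g v" if "v \<in> V" for v
    using card_unlinked_at[OF assms(1,2) that] cluster_subset[OF assms(2) that] assms(1)
    by (simp add: g_def of_nat_diff card_mono)
  have "2 * real (card ?U) = (\<Sum>f\<in>?U. real (card {v \<in> V. v \<in> f}))"
  proof -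
    have "card {v \<in> V. v \<in> f} = 2" if "f \<in> ?U" for f
    proof -
      have "{v \<in> V. v \<in> f} = f" "card f = 2"
        using that by (auto simp: unlinked_def nsets_def)
      then show ?thesis by simp
    qed
    then show ?thesis by simp
  qed
  also have "\<dots> = (\<Sum>f\<in>?U. \<Sum>v\<in>V. of_bool (v \<in> f))"
    using assms(1) by (simp add: Int_def)
  also have "\<dots> = (\<Sum>v\<in>V. \<Sum>f\<in>?U. of_bool (v \<in> f))"
    by (rule sum.swap)
  also have "\<dots> = (\<Sum>v\<in>V. real (card {f \<in> ?U. v \<in> f}))"
    using finU by (simp add: Int_def)
  also have "\<dots> = (\<Sum>v\<in>V. g v)"
    using cardU by simp
  finally have U: "2 * real (card ?U) = (\<Sum>v\<in>V. g v)" .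
  have meet: "real (card {f \<in> ?U. e \<inter> f \<noteq> {}}) = (\<Sum>u\<in>e. g u)" if "e \<in> ?K" for e
  proof -
    have "e \<in> [V]\<^bsup>2\<^esup>" using that KG by blast
    then obtain a b where e: "e = {a, b}" "a \<in> V" "b \<in> V" "a \<noteq> b"
      by (rule nsets2_E)
    have "(a, b) \<in> joined G"
      using that e(1) by (intro joined_edge) (auto simp: kruskal_def)
    have "\<not> (a \<in> f \<and> b \<in> f)" if "f \<in> ?U" for f
    proof
      assume ab: "a \<in> f \<and> b \<in> f"
      have "f \<in> [V]\<^bsup>2\<^esup>" "\<not> linked G f"
        using that by (auto simp: unlinked_def)
      then obtain x y where "f = {x, y}"
        by (meson nsets2_E)
      then have "f = {a, b}"
        using ab e(4) by auto
      then show False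
        using \<open>(a, b) \<in> joined G\<close> \<open>\<not> linked G f\<close> by simp
    qed
    then have "{f \<in> ?U. a \<in> f} \<inter> {f \<in> ?U. b \<in> f} = {}"
      by blast
    moreover have "{f \<in> ?U. e \<inter> f \<noteq> {}} = {f \<in> ?U. a \<in> f} \<union> {f \<in> ?U. b \<in> f}"
      by (auto simp: e)
    ultimately have "card {f \<in> ?U. e \<inter> f \<noteq> {}} = card {f \<in> ?U. a \<in> f} + card {f \<in> ?U. b \<in> f}"
      using finU by (simp add: card_Un_disjoint)
    then show ?thesis
      using e cardU by simp
  qed
  have "(\<Sum>f\<in>?U. real (card {e \<in> ?K. e \<inter> f \<noteq> {}})) = (\<Sum>f\<in>?U. \<Sum>e\<in>?K. of_bool (e \<inter> f \<noteq> {}))"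
    using finK by (simp add: Int_def)
  also have "\<dots> = (\<Sum>e\<in>?K. \<Sum>f\<in>?U. of_bool (e \<inter> f \<noteq> {}))"
    by (rule sum.swap)
  also have "\<dots> = (\<Sum>e\<in>?K. real (card {f \<in> ?U. e \<inter> f \<noteq> {}}))"
    using finU by (simp add: Int_def)
  also have "\<dots> = (\<Sum>e\<in>?K. \<Sum>u\<in>e. g u)"
    using meet by simp
  also have "\<dots> = 2 * ((\<Sum>v\<in>V. g v) - (\<Sum>C\<in>clusters V G. g (SOME v. v \<in> C)))"
  proof -
    have "g u = g v" if "(u, v) \<in> joined G" for u v
    proof -
      have "cluster G u = cluster G v"
        using that by (simp add: cluster_eq_iff)
      then show ?thesis by (simp add: g_def)
    qed
    then show ?thesis
      using kruskal_sum[OF assms] by blast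
  qed
  also have "(\<Sum>C\<in>clusters V G. g (SOME v. v \<in> C)) =
      (\<Sum>C\<in>clusters V G. real (card V) - real (card C))"
  proof (rule sum.cong[OF refl])
    fix C assume "C \<in> clusters V G"
    then obtain w where w: "C = cluster G w"
      by (auto simp: clusters_def)
    have "(SOME v. v \<in> C) \<in> C"
      by (rule someI[of _ w]) (simp add: w)
    then have "cluster G (SOME v. v \<in> C) = C"
      unfolding w in_cluster_iff cluster_eq_iff by (rule joined_sym)
    then show "g (SOME v. v \<in> C) = real (card V) - real (card C)"
      by (simp only: g_def)
  qed
  \<comment> \<open>The cluster sizes add up to \<open>card V\<close>, so the number of clusters
    enters here and yields the last term of the identity.\<close>
  also have "\<dots> = real (card (clusters V G)) * real (card V) - real (card V)"
    using clusters_partition(2)[OF assms(1,2)]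
    by (simp add: sum_subtractf flip: of_nat_sum)
  finally show ?thesis
    using U by (simp add: algebra_simps)
qed

text \<open>Two clusters cannot both contain more than half of the vertices. The \<open>1\<close> on
  the right cancels the \<open>- 1\<close> in the excess number of clusters.\<close>

lemma card_clusters_le_small:
  assumes "finite V" "G \<subseteq> [V]\<^bsup>2\<^esup>"
  shows "card (clusters V G) \<le> card {C \<in> clusters V G. 2 * card C \<le> card V} + 1"
proof -
  let ?L = "{C \<in> clusters V G. \<not> 2 * card C \<le> card V}"
  note P = clusters_partition[OF assms]
  have "card ?L \<le> 1"
  proof (rule ccontr)
    assume "\<not> card ?L \<le> 1"
    then obtain C D where CD: "C \<in> ?L" "D \<in> ?L" "C \<noteq> D"
      using P(1) by (metis (no_types, lifting) card_le_Suc0_iff_eq finite_Collect_conjI One_nat_def finite_subset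
        mem_Collect_eq subsetI)
    then have "card C + card D = (\<Sum>C\<in>{C, D}. card C)" by simp
    also have "\<dots> \<le> (\<Sum>C\<in>clusters V G. card C)"
      using P(1) CD by (intro sum_mono2) auto
    finally show False
      using CD P(2) by auto
  qed
  moreover have "{C \<in> clusters V G. 2 * card C \<le> card V} \<union> ?L = clusters V G"
    by auto
  then have "card (clusters V G) \<le> card {C \<in> clusters V G. 2 * card C \<le> card V} + card ?L"
    using card_Un_le[of "{C \<in> clusters V G. 2 * card C \<le> card V}" ?L] by (simp only:)
  ultimately show ?thesis by linarith
qed

text \<open>At most \<open>card V / K\<close> clusters have more than \<open>K\<close> vertices;
  everything is multiplied by \<open>K\<close> to stay in the natural numbers.\<close>

lemma card_clusters_le_bounded:
  assumes "finite V" "G \<subseteq> [V]\<^bsup>2\<^esup>"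
  shows "K * card (clusters V G) \<le> K * card {C \<in> clusters V G. card C \<le> K} + card V"
proof -
  let ?L = "{C \<in> clusters V G. \<not> card C \<le> K}"
  note P = clusters_partition[OF assms]
  have "K * card ?L = (\<Sum>C\<in>?L. K)" by simp
  also have "\<dots> \<le> (\<Sum>C\<in>?L. card C)"
    by (intro sum_mono) auto
  also have "\<dots> \<le> (\<Sum>C\<in>clusters V G. card C)"
    using P(1) by (intro sum_mono2) auto
  finally have "K * card ?L \<le> card V"
    using P(2) by simp
  moreover have "{C \<in> clusters V G. card C \<le> K} \<union> ?L = clusters V G"
    by auto
  then have "card (clusters V G) \<le> card {C \<in> clusters V G. card C \<le> K} + card ?L"
    using card_Un_le[of "{C \<in> clusters V G. card C \<le> K}" ?L] by (simp only:)
  then have "K * card (clusters V G) \<le> K * (card {C \<in> clusters V G. card C \<le> K} + card ?L)"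
    by (rule mult_le_mono2)
  ultimately show ?thesis
    by (simp add: algebra_simps)
qed

section \<open>Independent uniform weights\<close>

abbreviation unif :: "real measure" where
  "unif \<equiv> uniform_measure lborel {0<..<1}"

lemma prob_space_unif: "prob_space unif"
  by (rule prob_space_uniform_measure) auto

lemma AE_unif: "AE q in unif. 0 < q \<and> q < 1"
  by (rule AE_uniform_measureI) auto

lemma emeasure_unif_lessThan:
  assumes "0 \<le> q" "q \<le> 1"
  shows "emeasure unif {..<q} = ennreal q"
proof -
  have "{0<..<1} \<inter> {..<q} = {0<..<q}" using assms by auto
  then show ?thesis using assms by (simp add: divide_ennreal_def)
qed

lemma emeasure_unif_atLeast:
  assumes "0 \<le> q" "q \<le> 1"
  shows "emeasure unif {q..} = ennreal (1 - q)"
proof (cases "q = 0")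
  case True
  have "{0<..<1} \<inter> {0..} = {0<..<1::real}" by auto
  then show ?thesis using True by simp
next
  case False
  then have "{0<..<1} \<inter> {q..} = {q..<1}" using assms by auto
  then show ?thesis using assms by (simp add: divide_ennreal_def)
qed

lemma emeasure_unif_singleton: "emeasure unif {q} = 0"
proof -
  have "emeasure lborel ({0<..<1} \<inter> {q}) \<le> emeasure lborel {q}"
    by (intro emeasure_mono) auto
  then show ?thesis by simp
qed

lemma product_sigma_unif: "product_sigma_finite (\<lambda>_. unif)"
  by (intro product_sigma_finite.intro prob_space_imp_sigma_finite prob_space_unif)

abbreviation iid :: "'i set \<Rightarrow> ('i \<Rightarrow> real) measure" where
  "iid E \<equiv> \<Pi>\<^sub>M e\<in>E. unif"

lemma prob_space_iid: "prob_space (iid E)"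
  by (intro prob_space_PiM prob_space_unif)

lemma measurable_iid_component: "e \<in> E \<Longrightarrow> (\<lambda>W. W e) \<in> borel_measurable (iid E)"
  using measurable_component_singleton[of e E "\<lambda>_. unif"] by (simp cong: measurable_cong_sets)

lemma measurable_finite_Collect:
  assumes "finite I" "\<And>i. i \<in> I \<Longrightarrow> {x \<in> space M. P i x} \<in> sets M"
  shows "(\<lambda>x. {i \<in> I. P i x}) \<in> measurable M (count_space (Pow I))"
proof (subst measurable_count_space_eq2)
  show "finite (Pow I)" using assms(1) by simp
  have "(\<lambda>x. {i \<in> I. P i x}) -` {A} \<inter> space M \<in> sets M" if "A \<in> Pow I" for A
  proof -
    have "(\<lambda>x. {i \<in> I. P i x}) -` {A} \<inter> space M = {x \<in> space M. \<forall>i\<in>I. P i x = (i \<in> A)}"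
      using that by auto
    moreover have "\<dots> \<in> sets M"
    proof (rule sets.sets_Collect_finite_All[OF _ assms(1)])
      fix i assume "i \<in> I"
      then show "{x \<in> space M. P i x = (i \<in> A)} \<in> sets M"
        using assms(2) sets.sets_Collect_neg[OF assms(2)] by (cases "i \<in> A") auto
    qed
    ultimately show ?thesis by simp
  qed
  then show "(\<lambda>x. {i \<in> I. P i x}) \<in> space M \<rightarrow> Pow I \<and>
      (\<forall>A\<in>Pow I. (\<lambda>x. {i \<in> I. P i x}) -` {A} \<inter> space M \<in> sets M)"
    by auto
qed

definition below :: "'i set \<Rightarrow> ('i \<Rightarrow> real) \<Rightarrow> real \<Rightarrow> 'i set" where
  "below E W q = {g \<in> E. W g < q}"

definition ranking :: "'i set \<Rightarrow> ('i \<Rightarrow> real) \<Rightarrow> ('i \<times> 'i) set" where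
  "ranking E W = {(g, h) \<in> E \<times> E. W g < W h}"

text \<open>All quantities to be integrated depend on the weights only through finitely many
  comparisons, with each other and with \<open>q\<close>. The two sets record these comparisons and
  take finitely many values, so any function \<open>F\<close> of them is measurable.\<close>

lemma measurable_ranking_below:
  fixes E :: "'i set"
  assumes "finite E"
  shows "(\<lambda>W. F (ranking E W) (below E W q)) \<in> measurable (iid E) (count_space UNIV)"
proof -
  define P where "P i W = (case i of Inl (g, h) \<Rightarrow> W g < W h | Inr g \<Rightarrow> W g < q)"
    for i :: "('i \<times> 'i) + 'i" and W :: "'i \<Rightarrow> real"
  let ?I = "(E \<times> E) <+> E"
  have "(\<lambda>W. {i \<in> ?I. P i W}) \<in> measurable (iid E) (count_space (Pow ?I))"
  proof (rule measurable_finite_Collect)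
    fix i assume "i \<in> ?I"
    then show "{W \<in> space (iid E). P i W} \<in> sets (iid E)"
      by (auto simp: P_def intro!: borel_measurable_less measurable_iid_component)
  qed (use assms in auto)
  moreover have "(\<lambda>A. F {p. Inl p \<in> A} {g. Inr g \<in> A}) \<in> measurable (count_space (Pow ?I)) (count_space UNIV)"
    by simp
  ultimately have "(\<lambda>W. (\<lambda>A. F {p. Inl p \<in> A} {g. Inr g \<in> A}) {i \<in> ?I. P i W}) \<in> measurable (iid E) (count_space UNIV)"
    by (rule measurable_compose)
  moreover have "{p. Inl p \<in> {i \<in> ?I. P i W}} = ranking E W" "{g. Inr g \<in> {i \<in> ?I. P i W}} = below E W q" for W
    by (auto simp: P_def ranking_def below_def)
  ultimately show ?thesis by simp
qed

lemma measurable_ranking_below':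
  fixes F :: "('i \<times> 'i) set \<Rightarrow> 'i set \<Rightarrow> ennreal"
  assumes "finite E"
  shows "(\<lambda>W. F (ranking E W) (below E W q)) \<in> borel_measurable (iid E)"
  using measurable_compose[OF measurable_ranking_below[OF assms, of "\<lambda>R B. (R, B)" q],
      of "case_prod F" borel] by simp

text \<open>Conditioning on the value \<open>q\<close> of coordinate \<open>f\<close>.  A functional that does not depend on the
  exact value of that coordinate once it is at least \<open>q\<close> can then be integrated over all
  coordinates again, at the cost of the probability \<open>1 - q\<close> of \<open>W f \<ge> q\<close>.\<close>

lemma nn_integral_iid_threshold:
  fixes \<psi> :: "real \<Rightarrow> ('i \<Rightarrow> real) \<Rightarrow> ennreal"
  assumes "finite E" "f \<in> E"
    and meas: "(\<lambda>W. \<psi> (W f) W) \<in> borel_measurable (iid E)"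
    and measq: "\<And>q. \<psi> q \<in> borel_measurable (iid E)"
    and indep: "\<And>q y W. q \<le> y \<Longrightarrow> \<psi> q (W(f := y)) = \<psi> q (W(f := q))"
  shows "\<exists>G \<in> borel_measurable unif. (\<integral>\<^sup>+W. \<psi> (W f) W \<partial>iid E) = (\<integral>\<^sup>+q. G q \<partial>unif) \<and>
    (\<forall>q. 0 < q \<and> q < 1 \<longrightarrow>
      G q = (\<integral>\<^sup>+W. indicator {q..} (W f) * \<psi> q W \<partial>iid E) / ennreal (1 - q))"
proof -
  interpret product_sigma_finite "\<lambda>_. unif" by (rule product_sigma_unif)
  let ?I = "E - {f}"
  have E: "insert f ?I = E" "finite ?I" "f \<notin> ?I" using assms(1,2) by auto
  have upd: "(\<lambda>W. W(f := q)) \<in> measurable (iid ?I) (iid E)" for q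
    using measurable_compose[OF measurable_Pair2'[of q unif "iid ?I"] measurable_add_dim[of f ?I "\<lambda>_. unif"]]
    unfolding E by simp
  have "(\<integral>\<^sup>+W. indicator {q..} (W f) * \<psi> q W \<partial>iid E) / ennreal (1 - q) =
      (\<integral>\<^sup>+x. \<psi> q (x(f := q)) \<partial>iid ?I)" if q: "0 < q \<and> q < 1" for q
  proof -
    have "(\<lambda>W. indicator {q..} (W f) * \<psi> q W) \<in> borel_measurable (iid E)"
      using measurable_compose[OF measurable_iid_component[OF assms(2)] borel_measurable_indicator[of "{q..}"]]
      by (intro borel_measurable_times_ennreal measq) auto
    then have "(\<integral>\<^sup>+W. indicator {q..} (W f) * \<psi> q W \<partial>iid E) =
        (\<integral>\<^sup>+x. \<integral>\<^sup>+y. indicator {q..} y * \<psi> q (x(f := y)) \<partial>unif \<partial>iid ?I)"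
      using product_nn_integral_insert[OF E(2,3), of "\<lambda>W. indicator {q..} (W f) * \<psi> q W"]
      unfolding E by simp
    also have "\<dots> = (\<integral>\<^sup>+x. \<integral>\<^sup>+y. \<psi> q (x(f := q)) * indicator {q..} y \<partial>unif \<partial>iid ?I)"
    proof (intro nn_integral_cong)
      fix x y
      show "indicator {q..} y * \<psi> q (x(f := y)) = \<psi> q (x(f := q)) * indicator {q..} y"
        using indep[of q y x] by (cases "q \<le> y") simp_all
    qed
    also have "\<dots> = (\<integral>\<^sup>+x. \<psi> q (x(f := q)) * ennreal (1 - q) \<partial>iid ?I)"
      using q by (simp add: nn_integral_cmult_indicator emeasure_unif_atLeast del: emeasure_uniform_measure)
    also have "\<dots> = (\<integral>\<^sup>+x. \<psi> q (x(f := q)) \<partial>iid ?I) * ennreal (1 - q)"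
      by (intro nn_integral_multc measurable_compose[OF upd] measq)
    finally show ?thesis
      using q by (simp add: ennreal_mult_divide_eq)
  qed
  moreover have "(\<integral>\<^sup>+W. \<psi> (W f) W \<partial>iid E) = (\<integral>\<^sup>+q. \<integral>\<^sup>+x. \<psi> q (x(f := q)) \<partial>iid ?I \<partial>unif)"
    using product_nn_integral_insert_rev[OF E(2,3), of "\<lambda>W. \<psi> (W f) W"] meas
    unfolding E by simp
  moreover have "(\<lambda>q. \<integral>\<^sup>+x. \<psi> q (x(f := q)) \<partial>iid ?I) \<in> borel_measurable unif"
  proof -
    interpret I: sigma_finite_measure "iid ?I"
      by (rule prob_space_imp_sigma_finite[OF prob_space_iid])
    have "(\<lambda>z. (\<lambda>(x, y). x(f := y)) (snd z, fst z)) \<in> measurable (unif \<Otimes>\<^sub>M iid ?I) (iid (insert f ?I))"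
      by (rule measurable_compose[OF _ measurable_add_dim]) simp
    then have "(\<lambda>z. (snd z)(f := fst z)) \<in> measurable (unif \<Otimes>\<^sub>M iid ?I) (iid E)"
      unfolding E by simp
    from measurable_compose[OF this meas]
    have "(\<lambda>(q, x). \<psi> q (x(f := q))) \<in> borel_measurable (unif \<Otimes>\<^sub>M iid ?I)"
      by (simp add: case_prod_beta)
    then show ?thesis
      by (rule I.borel_measurable_nn_integral)
  qed
  ultimately show ?thesis
    by (intro bexI[of _ "\<lambda>q. \<integral>\<^sup>+x. \<psi> q (x(f := q)) \<partial>iid ?I"]) auto
qed

lemma AE_iid_distinct:
  assumes "finite E" "e \<in> E" "f \<in> E" "e \<noteq> f"
  shows "AE W in iid E. W e \<noteq> W f"
proof -
  interpret product_sigma_finite "\<lambda>_. unif" by (rule product_sigma_unif)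
  let ?I = "E - {f}"
  have E: "insert f ?I = E" "finite ?I" "f \<notin> ?I" using assms by auto
  have "{W \<in> space (iid E). W e = W f} \<in> sets (iid E)"
    using assms by (intro borel_measurable_eq measurable_iid_component)
  then have meas: "{W \<in> space (iid E). \<not> W e \<noteq> W f} \<in> sets (iid E)" by simp
  have "emeasure (iid E) {W \<in> space (iid E). \<not> W e \<noteq> W f} =
      (\<integral>\<^sup>+W. indicator {W \<in> space (iid E). \<not> W e \<noteq> W f} W \<partial>iid E)"
    using meas by simp
  also have "\<dots> = (\<integral>\<^sup>+x. \<integral>\<^sup>+y. indicator {W \<in> space (iid E). \<not> W e \<noteq> W f} (x(f := y)) \<partial>unif \<partial>iid ?I)"
    using product_nn_integral_insert[OF E(2,3), of "indicator {W \<in> space (iid E). \<not> W e \<noteq> W f}"] meas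
    unfolding E by simp
  also have "\<dots> \<le> (\<integral>\<^sup>+x. \<integral>\<^sup>+y. indicator {x e} y \<partial>unif \<partial>iid ?I)"
    using assms(4) by (intro nn_integral_mono) (auto simp: indicator_def)
  also have "\<dots> = 0"
    by (simp add: emeasure_unif_singleton del: emeasure_uniform_measure)
  finally show ?thesis
    using meas by (intro AE_I'[of "{W \<in> space (iid E). \<not> W e \<noteq> W f}"]) (auto simp: null_sets_def)
qed

lemma AE_iid_generic:
  assumes "finite E"
  shows "AE W in iid E. inj_on W E \<and> (\<forall>e\<in>E. 0 < W e)"
proof -
  have "AE W in iid E. \<forall>e\<in>E. \<forall>f\<in>E. e \<noteq> f \<longrightarrow> W e \<noteq> W f"
    using assms AE_iid_distinct[OF assms]
    by (intro AE_finite_allI) auto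
  moreover have "AE W in iid E. \<forall>e\<in>E. 0 < W e"
  proof (rule AE_finite_allI[OF assms])
    fix e assume "e \<in> E"
    have "AE q in unif. 0 < q" using AE_unif by auto
    then show "AE W in iid E. 0 < W e"
      by (rule AE_PiM_component[OF prob_space_unif \<open>e \<in> E\<close>])
  qed
  ultimately show ?thesis
    by eventually_elim (auto simp: inj_on_def)
qed

lemma emeasure_iid_box:
  assumes "finite E" "S \<subseteq> E" "T \<subseteq> E" "S \<inter> T = {}" "0 \<le> q" "q \<le> 1"
  shows "emeasure (iid E) {W \<in> space (iid E). (\<forall>e\<in>S. W e < q) \<and> (\<forall>e\<in>T. q \<le> W e)} =
    ennreal (q ^ card S * (1 - q) ^ card T)"
proof -
  interpret product_sigma_finite "\<lambda>_. unif" by (rule product_sigma_unif)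
  define A where "A e = (if e \<in> S then {..<q} else if e \<in> T then {q..} else UNIV)" for e
  have fin: "finite S" "finite T" using assms finite_subset by blast+
  have "{W \<in> space (iid E). (\<forall>e\<in>S. W e < q) \<and> (\<forall>e\<in>T. q \<le> W e)} = Pi\<^sub>E E A"
  proof -
    have "(\<forall>e\<in>S. W e < q) \<and> (\<forall>e\<in>T. q \<le> W e) \<longleftrightarrow> (\<forall>e\<in>E. W e \<in> A e)" for W
    proof
      assume "\<forall>e\<in>E. W e \<in> A e"
      then have "W e \<in> A e" if "e \<in> S \<union> T" for e
        using that assms(2,3) by blast
      then show "(\<forall>e\<in>S. W e < q) \<and> (\<forall>e\<in>T. q \<le> W e)"
        using assms(4) unfolding A_def by (metis Un_iff atLeast_iff disjoint_iff lessThan_iff)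
    qed (simp add: A_def)
    then show ?thesis
      by (auto simp: space_PiM PiE_iff extensional_def)
  qed
  also have "emeasure (iid E) \<dots> = (\<Prod>e\<in>E. emeasure unif (A e))"
    using assms(1) by (intro emeasure_PiM) (auto simp: A_def)
  also have "\<dots> = (\<Prod>e\<in>E. ennreal ((if e \<in> S then q else 1) * (if e \<in> T then 1 - q else 1)))"
  proof (rule prod.cong[OF refl])
    fix e
    have "emeasure unif UNIV = 1"
      using prob_space.emeasure_space_1[OF prob_space_unif] by simp
    then show "emeasure unif (A e) = ennreal ((if e \<in> S then q else 1) * (if e \<in> T then 1 - q else 1))"
      using assms(4-6) emeasure_unif_lessThan[of q] emeasure_unif_atLeast[of q]
      by (auto simp: A_def simp del: emeasure_uniform_measure)
  qed
  also have "\<dots> = ennreal (\<Prod>e\<in>E. (if e \<in> S then q else 1) * (if e \<in> T then 1 - q else 1))"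
    using assms(5,6) by (intro prod_ennreal) auto
  also have "(\<Prod>e\<in>E. (if e \<in> S then q else 1) * (if e \<in> T then 1 - q else 1)) =
      (\<Prod>e\<in>E. if e \<in> S then q else 1) * (\<Prod>e\<in>E. if e \<in> T then 1 - q else 1)"
    by (rule prod.distrib)
  also have "\<dots> = q ^ card S * (1 - q) ^ card T"
    using assms(1-3) by (simp add: prod.If_cases Int_absorb1)
  finally show ?thesis .
qed

section \<open>Adjacent pairs of tree edges\<close>

text \<open>Brings the forest into the form that \<open>measurable_ranking_below\<close>
  handles.\<close>

lemma kruskal_ranking:
  "B \<subseteq> E \<Longrightarrow> kruskal W B = {e \<in> B. \<not> linked {g \<in> B. (g, e) \<in> ranking E W} e}"
  unfolding kruskal_def ranking_def by (intro Collect_cong conj_cong refl arg_cong[of _ _ Not] arg_cong2[of _ _ _ _ linked]) auto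

text \<open>Only lighter edges enter the test of an edge, so cutting off at level \<open>q\<close>
  commutes with Kruskal's algorithm.\<close>

lemma kruskal_below: "kruskal W (below E W q) = {e \<in> kruskal W E. W e < q}"
proof -
  have "{g \<in> below E W q. W g < W e} = {g \<in> E. W g < W e}" if "W e < q" for e
    using that by (auto simp: below_def)
  then show ?thesis
    by (auto simp: kruskal_def below_def)
qed

lemma kruskal_eq_below: "kruskal W E = {e \<in> E. \<not> linked (below E W (W e)) e}"
  by (simp add: kruskal_def below_def)

text \<open>Conditions on the weight \<open>q\<close> of the tree edge \<open>f\<close>, which is
  accepted iff it is unlinked below \<open>q\<close>. Being unlinked already forces
  \<open>q \<le> W f\<close>, so the indicator of \<open>nn_integral_iid_threshold\<close>
  disappears and only the division by \<open>1 - q\<close> remains. The integrand \<open>G\<close>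
  is described only for \<open>0 < q < 1\<close>, which is almost every \<open>q\<close>, and
  carries its measurability with it.\<close>

lemma nn_integral_kruskal_sum:
  fixes \<phi> :: "'v set \<Rightarrow> 'v set set \<Rightarrow> ennreal"
  assumes "finite V"
  defines "E \<equiv> [V]\<^bsup>2\<^esup>"
  shows "\<exists>G \<in> borel_measurable unif.
    (\<integral>\<^sup>+W. (\<Sum>f\<in>kruskal W E. \<phi> f (kruskal W (below E W (W f)))) \<partial>iid E) = (\<integral>\<^sup>+q. G q \<partial>unif) \<and>
    (\<forall>q. 0 < q \<and> q < 1 \<longrightarrow>
      G q = (\<integral>\<^sup>+W. (\<Sum>f\<in>unlinked V (below E W q). \<phi> f (kruskal W (below E W q))) \<partial>iid E) / ennreal (1 - q))"
proof -
  have fin: "finite E"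
    using assms by (simp add: finite_imp_finite_nsets)
  \<comment> \<open>The contribution of \<open>f\<close>, with the level \<open>q\<close> separated
    from the weight \<open>W f\<close> that it will be set to.\<close>
  define \<psi> where "\<psi> f q W = (if linked (below E W q) f then 0 else \<phi> f (kruskal W (below E W q)))"
    for f q W
  have below_sub: "below E W q \<subseteq> E" for W q
    by (auto simp: below_def)
  have below_W: "below E W (W f) = {g. (g, f) \<in> ranking E W}" if "f \<in> E" for f W
    using that by (auto simp: below_def ranking_def)
  define \<Phi> where "\<Phi> f R B = (if linked B f then 0 else \<phi> f {e \<in> B. \<not> linked {g \<in> B. (g, e) \<in> R} e})"
    for f R B
  have \<psi>_\<Phi>: "\<psi> f q W = \<Phi> f (ranking E W) (below E W q)" for f q W
    using kruskal_ranking[OF below_sub] by (simp add: \<psi>_def \<Phi>_def)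
  have meas: "(\<lambda>W. \<psi> f (W f) W) \<in> borel_measurable (iid E)" if "f \<in> E" for f
    unfolding \<psi>_\<Phi> below_W[OF that]
    using measurable_ranking_below'[OF fin, of "\<lambda>R B. \<Phi> f R {g. (g, f) \<in> R}" 0] by simp
  have measq: "\<psi> f q \<in> borel_measurable (iid E)" for f q
    using measurable_ranking_below'[OF fin, of "\<Phi> f" q] by (simp add: \<psi>_\<Phi>[abs_def])
  \<comment> \<open>As long as the weight of \<open>f\<close> is at least \<open>q\<close>, the edge
    \<open>f\<close> is not below \<open>q\<close>, and neither the graph nor the forest there sees
    its value.\<close>
  have indep: "\<psi> f q (W(f := y)) = \<psi> f q (W(f := q))" if "q \<le> y" for f q y W
  proof -
    have eq: "below E (W(f := y)) q = below E (W(f := q)) q"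
      using that by (auto simp: below_def)
    have "f \<notin> below E (W(f := q)) q"
      by (simp add: below_def)
    then have "kruskal (W(f := y)) (below E (W(f := q)) q) = kruskal (W(f := q)) (below E (W(f := q)) q)"
      unfolding kruskal_def
      by (intro Collect_cong conj_cong refl arg_cong[of _ _ Not] arg_cong2[of _ _ _ _ linked]) auto
    then show ?thesis
      by (simp add: \<psi>_def eq)
  qed
  have "\<forall>f\<in>E. \<exists>G. G \<in> borel_measurable unif \<and> (\<integral>\<^sup>+W. \<psi> f (W f) W \<partial>iid E) = (\<integral>\<^sup>+q. G q \<partial>unif) \<and>
    (\<forall>q. 0 < q \<and> q < 1 \<longrightarrow>
      G q = (\<integral>\<^sup>+W. indicator {q..} (W f) * \<psi> f q W \<partial>iid E) / ennreal (1 - q))"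
  proof
    fix f assume f: "f \<in> E"
    show "\<exists>G. G \<in> borel_measurable unif \<and> (\<integral>\<^sup>+W. \<psi> f (W f) W \<partial>iid E) = (\<integral>\<^sup>+q. G q \<partial>unif) \<and>
      (\<forall>q. 0 < q \<and> q < 1 \<longrightarrow>
        G q = (\<integral>\<^sup>+W. indicator {q..} (W f) * \<psi> f q W \<partial>iid E) / ennreal (1 - q))"
      using nn_integral_iid_threshold[OF fin f meas[OF f] measq indep]
      unfolding Bex_def .
  qed
  from bchoice[OF this] obtain G where G: "\<And>f. f \<in> E \<Longrightarrow> G f \<in> borel_measurable unif"
    "\<And>f. f \<in> E \<Longrightarrow> (\<integral>\<^sup>+W. \<psi> f (W f) W \<partial>iid E) = (\<integral>\<^sup>+q. G f q \<partial>unif)"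
    "\<And>f q. f \<in> E \<Longrightarrow> 0 < q \<Longrightarrow> q < 1 \<Longrightarrow>
      G f q = (\<integral>\<^sup>+W. indicator {q..} (W f) * \<psi> f q W \<partial>iid E) / ennreal (1 - q)"
    by blast
  show ?thesis
  proof (intro bexI conjI allI impI)
    show "(\<lambda>q. \<Sum>f\<in>E. G f q) \<in> borel_measurable unif"
      using G(1) by (intro borel_measurable_sum) auto
  next
    have "(\<Sum>f\<in>kruskal W E. \<phi> f (kruskal W (below E W (W f)))) = (\<Sum>f\<in>E. \<psi> f (W f) W)" for W
    proof -
      have "(\<Sum>f\<in>kruskal W E. \<phi> f (kruskal W (below E W (W f)))) =
          (\<Sum>f\<in>{e \<in> E. \<not> linked (below E W (W e)) e}. \<phi> f (kruskal W (below E W (W f))))"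
        by (simp only: kruskal_eq_below[of W E])
      also have "\<dots> = (\<Sum>f\<in>E. if \<not> linked (below E W (W f)) f then \<phi> f (kruskal W (below E W (W f))) else 0)"
        using fin by (rule sum.inter_filter)
      also have "\<dots> = (\<Sum>f\<in>E. \<psi> f (W f) W)"
        by (intro sum.cong) (auto simp: \<psi>_def)
      finally show ?thesis .
    qed
    then have "(\<integral>\<^sup>+W. (\<Sum>f\<in>kruskal W E. \<phi> f (kruskal W (below E W (W f)))) \<partial>iid E) =
        (\<Sum>f\<in>E. \<integral>\<^sup>+W. \<psi> f (W f) W \<partial>iid E)"
      using meas by (simp add: nn_integral_sum)
    also have "\<dots> = (\<integral>\<^sup>+q. (\<Sum>f\<in>E. G f q) \<partial>unif)"
      using G(1,2) by (simp add: nn_integral_sum)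
    finally show "(\<integral>\<^sup>+W. (\<Sum>f\<in>kruskal W E. \<phi> f (kruskal W (below E W (W f)))) \<partial>iid E) =
        (\<integral>\<^sup>+q. (\<Sum>f\<in>E. G f q) \<partial>unif)" .
  next
    fix q :: real assume q: "0 < q \<and> q < 1"
    have meas2: "(\<lambda>W. indicator {q..} (W f) * \<psi> f q W) \<in> borel_measurable (iid E)" if "f \<in> E" for f
      using measurable_compose[OF measurable_iid_component[OF that] borel_measurable_indicator[of "{q..}"]]
      by (intro borel_measurable_times_ennreal measq) auto
    have "(\<Sum>f\<in>E. indicator {q..} (W f) * \<psi> f q W) =
        (\<Sum>f\<in>unlinked V (below E W q). \<phi> f (kruskal W (below E W q)))" for W
    proof -
      have "indicator {q..} (W f) * \<psi> f q W =
          (if \<not> linked (below E W q) f then \<phi> f (kruskal W (below E W q)) else 0)" if fE: "f \<in> E" for f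
      proof (cases "q \<le> W f")
        \<comment> \<open>If \<open>W f < q\<close>, then \<open>f\<close> itself links its own ends
          below \<open>q\<close>, so \<open>\<psi>\<close> vanishes.\<close>
        case False
        then have "f \<in> below E W q" using fE by (simp add: below_def)
        moreover obtain x y where "f = {x, y}"
          using fE unfolding E_def by (rule nsets2_E)
        ultimately have "linked (below E W q) f"
          by (simp add: joined_edge)
        then show ?thesis by (simp add: \<psi>_def)
      qed (simp add: \<psi>_def)
      then have "(\<Sum>f\<in>E. indicator {q..} (W f) * \<psi> f q W) =
          (\<Sum>f\<in>E. if \<not> linked (below E W q) f then \<phi> f (kruskal W (below E W q)) else 0)"
        by (intro sum.cong) auto
      also have "\<dots> = (\<Sum>f\<in>{f \<in> E. \<not> linked (below E W q) f}. \<phi> f (kruskal W (below E W q)))"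
        using fin by (rule sum.inter_filter[symmetric])
      finally show ?thesis
        by (simp add: unlinked_def E_def)
    qed
    then have "(\<integral>\<^sup>+W. (\<Sum>f\<in>unlinked V (below E W q). \<phi> f (kruskal W (below E W q))) \<partial>iid E) =
        (\<Sum>f\<in>E. \<integral>\<^sup>+W. indicator {q..} (W f) * \<psi> f q W \<partial>iid E)"
      using meas2 by (simp flip: nn_integral_sum)
    then show "(\<Sum>f\<in>E. G f q) =
        (\<integral>\<^sup>+W. (\<Sum>f\<in>unlinked V (below E W q). \<phi> f (kruskal W (below E W q))) \<partial>iid E) / ennreal (1 - q)"
      using G(3) q by (simp add: divide_ennreal_def sum_distrib_right)
  qed
qed

lemma connected_complete:
  assumes "V \<noteq> {}"
  shows "connected_graph (V, [V]\<^bsup>2\<^esup>)"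
  unfolding connected_graph_iff
proof (intro conjI ballI)
  fix u v assume "u \<in> V" "v \<in> V"
  then show "(u, v) \<in> joined ([V]\<^bsup>2\<^esup>)"
    by (cases "u = v") (auto intro: joined_edge)
qed (rule assms)

text \<open>Integrates \<open>unlinked_identity\<close> over \<open>q\<close>. The formula of
  \<open>nn_integral_kruskal_sum\<close> is used twice: with the constant 4 it yields four times the
  number of tree edges, and with the number of forest edges meeting \<open>f\<close> it counts each
  adjacent pair once, at its heavier edge. Asking only for a measurable bound \<open>l\<close>
  avoids proving that the expected number of clusters is measurable in \<open>q\<close>.\<close>

lemma adjacent_pairs_lower_bound:
  fixes V :: "'v set" and l :: "real \<Rightarrow> ennreal"
  assumes "finite V" "V \<noteq> {}"
  defines "E \<equiv> [V]\<^bsup>2\<^esup>"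
  assumes l: "l \<in> borel_measurable borel"
    and bound: "\<And>q. 0 < q \<Longrightarrow> q < 1 \<Longrightarrow>
      (\<integral>\<^sup>+W. ennreal (real (card (clusters V (below E W q))) - 1) \<partial>iid E) / ennreal (1 - q) \<le> l q"
  shows "ennreal (4 * (real (card V) - 1)) \<le>
    (\<integral>\<^sup>+W. (\<Sum>f\<in>kruskal W E. ennreal (real (card {e \<in> kruskal W E. W e < W f \<and> e \<inter> f \<noteq> {}}))) \<partial>iid E) +
    ennreal (2 * real (card V)) * (\<integral>\<^sup>+q. l q \<partial>unif)"
proof -
  have fin: "finite E"
    using assms(1) by (simp add: E_def finite_imp_finite_nsets)
  define \<phi> where "\<phi> f K = ennreal (real (card {e \<in> K. e \<inter> f \<noteq> {}}))" for f :: "'v set" and K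
  obtain G1 where G1: "G1 \<in> borel_measurable unif"
    "(\<integral>\<^sup>+W. (\<Sum>f\<in>kruskal W E. 4) \<partial>iid E) = (\<integral>\<^sup>+q. G1 q \<partial>unif)"
    "\<And>q. 0 < q \<and> q < 1 \<Longrightarrow> G1 q = (\<integral>\<^sup>+W. (\<Sum>f\<in>unlinked V (below E W q). 4) \<partial>iid E) / ennreal (1 - q)"
    using nn_integral_kruskal_sum[OF assms(1), of "\<lambda>_ _. 4"] unfolding E_def by blast
  obtain G2 where G2: "G2 \<in> borel_measurable unif"
    "(\<integral>\<^sup>+W. (\<Sum>f\<in>kruskal W E. \<phi> f (kruskal W (below E W (W f)))) \<partial>iid E) = (\<integral>\<^sup>+q. G2 q \<partial>unif)"
    "\<And>q. 0 < q \<and> q < 1 \<Longrightarrow>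
      G2 q = (\<integral>\<^sup>+W. (\<Sum>f\<in>unlinked V (below E W q). \<phi> f (kruskal W (below E W q))) \<partial>iid E) / ennreal (1 - q)"
    using nn_integral_kruskal_sum[OF assms(1), of \<phi>] unfolding E_def by blast
  have "ennreal (4 * (real (card V) - 1)) = (\<integral>\<^sup>+W. ennreal (4 * (real (card V) - 1)) \<partial>iid E)"
    using prob_space.emeasure_space_1[OF prob_space_iid, of E] by simp
  also have "\<dots> = (\<integral>\<^sup>+W. (\<Sum>f\<in>kruskal W E. 4) \<partial>iid E)"
  proof (intro nn_integral_cong_AE)
    show "AE W in iid E. ennreal (4 * (real (card V) - 1)) = (\<Sum>f\<in>kruskal W E. 4)"
      using AE_iid_generic[OF fin]
    proof eventually_elim
      case (elim W)
      then have "card (kruskal W E) + 1 = card V"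
        using card_kruskal[of V E W] card_clusters_connected[OF connected_complete[OF assms(2)]] assms(1)
        by (auto simp: E_def)
      then have "4 * (real (card V) - 1) = real (card (kruskal W E) * 4)"
        by (metis add_diff_cancel_right' mult.commute of_nat_1 of_nat_add of_nat_mult of_nat_numeral)
      then show ?case
        by (simp add: ennreal_mult ennreal_of_nat_eq_real_of_nat)
    qed
  qed
  also have "\<dots> = (\<integral>\<^sup>+q. G1 q \<partial>unif)"
    by (rule G1(2))
  also have "\<dots> \<le> (\<integral>\<^sup>+q. G2 q + ennreal (2 * real (card V)) * l q \<partial>unif)"
  proof (intro nn_integral_mono_AE)
    show "AE q in unif. G1 q \<le> G2 q + ennreal (2 * real (card V)) * l q"
      using AE_unif
    proof eventually_elim
      case (elim q)
      let ?B = "\<lambda>W. below E W q"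
      let ?\<kappa> = "\<lambda>W. ennreal (real (card (clusters V (?B W))) - 1)"
      have meas_\<kappa>: "?\<kappa> \<in> borel_measurable (iid E)"
        using measurable_ranking_below'[OF fin, of "\<lambda>_ B. ennreal (real (card (clusters V B)) - 1)" q] by simp
      have meas2: "(\<lambda>W. \<Sum>f\<in>unlinked V (?B W). \<phi> f (kruskal W (?B W))) \<in> borel_measurable (iid E)"
      proof -
        have "kruskal W (?B W) = {e \<in> ?B W. \<not> linked {g \<in> ?B W. (g, e) \<in> ranking E W} e}" for W
          by (rule kruskal_ranking) (auto simp: below_def)
        then show ?thesis
          using measurable_ranking_below'[OF fin, of "\<lambda>R B. \<Sum>f\<in>unlinked V B.
            \<phi> f {e \<in> B. \<not> linked {g \<in> B. (g, e) \<in> R} e}" q] by simp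
      qed
      have "(\<integral>\<^sup>+W. (\<Sum>f\<in>unlinked V (?B W). 4) \<partial>iid E) =
          (\<integral>\<^sup>+W. (\<Sum>f\<in>unlinked V (?B W). \<phi> f (kruskal W (?B W))) + ennreal (2 * real (card V)) * ?\<kappa> W \<partial>iid E)"
      proof (intro nn_integral_cong_AE)
        show "AE W in iid E. (\<Sum>f\<in>unlinked V (?B W). 4) =
            (\<Sum>f\<in>unlinked V (?B W). \<phi> f (kruskal W (?B W))) + ennreal (2 * real (card V)) * ?\<kappa> W"
          using AE_iid_generic[OF fin]
        proof eventually_elim
          case (elim W)
          have sub: "?B W \<subseteq> E" by (auto simp: below_def)
          then have inj: "inj_on W (?B W)"
            using elim inj_on_subset by blast
          \<comment> \<open>Having at least one cluster matters, because \<open>ennreal\<close>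
            sends negative reals to 0.\<close>
          have "clusters V (?B W) \<noteq> {}" "finite (clusters V (?B W))"
            using assms(1,2) by (auto simp: clusters_def)
          then have pos: "0 \<le> real (card (clusters V (?B W))) - 1"
            by (simp add: Suc_le_eq card_gt_0_iff)
          have "(\<Sum>f\<in>unlinked V (?B W). 4) = ennreal (4 * real (card (unlinked V (?B W))))"
            by (simp add: ennreal_mult ennreal_of_nat_eq_real_of_nat[symmetric] mult.commute)
          also have "4 * real (card (unlinked V (?B W))) =
              (\<Sum>f\<in>unlinked V (?B W). real (card {e \<in> kruskal W (?B W). e \<inter> f \<noteq> {}})) +
              2 * real (card V) * (real (card (clusters V (?B W))) - 1)"
            using unlinked_identity[OF assms(1) _ inj] sub by (simp add: E_def)
          also have "ennreal \<dots> = (\<Sum>f\<in>unlinked V (?B W). \<phi> f (kruskal W (?B W))) +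
              ennreal (2 * real (card V)) * ?\<kappa> W"
            using pos by (simp add: \<phi>_def ennreal_plus sum_nonneg ennreal_mult)
          finally show ?case .
        qed
      qed
      also have "\<dots> = (\<integral>\<^sup>+W. (\<Sum>f\<in>unlinked V (?B W). \<phi> f (kruskal W (?B W))) \<partial>iid E) +
          ennreal (2 * real (card V)) * (\<integral>\<^sup>+W. ?\<kappa> W \<partial>iid E)"
        using meas2 meas_\<kappa> by (simp add: nn_integral_add nn_integral_cmult)
      finally have "G1 q = G2 q + ennreal (2 * real (card V)) * ((\<integral>\<^sup>+W. ?\<kappa> W \<partial>iid E) / ennreal (1 - q))"
        using G1(3)[OF elim] G2(3)[OF elim]
        by (simp add: divide_ennreal_def distrib_right mult.assoc)
      then show ?case
        using bound[of q] elim by (simp add: add_left_mono mult_left_mono)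
    qed
  qed
  also have "\<dots> = (\<integral>\<^sup>+q. G2 q \<partial>unif) + ennreal (2 * real (card V)) * (\<integral>\<^sup>+q. l q \<partial>unif)"
    using G2(1) l by (simp add: nn_integral_add nn_integral_cmult cong: measurable_cong_sets)
  also have "(\<integral>\<^sup>+q. G2 q \<partial>unif) = (\<integral>\<^sup>+W. (\<Sum>f\<in>kruskal W E.
      ennreal (real (card {e \<in> kruskal W E. W e < W f \<and> e \<inter> f \<noteq> {}}))) \<partial>iid E)"
  proof -
    have "{e \<in> kruskal W (below E W (W f)). e \<inter> f \<noteq> {}} = {e \<in> kruskal W E. W e < W f \<and> e \<inter> f \<noteq> {}}" for W f
      by (auto simp: kruskal_below)
    then show ?thesis
      using G2(2) by (simp add: \<phi>_def)
  qed
  finally show ?thesis .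
qed

section \<open>Expected number of components\<close>

text \<open>The \<open>k\<close>-vertex components of a random graph on \<open>n\<close> vertices with edge probability \<open>q\<close> number
  at most \<open>cluster_bound n k q\<close> on average: choose the vertex set and a spanning tree
  (\<open>k ^ (k - 2)\<close> in number), whose edges must be present while those leaving the set are absent.\<close>

definition cluster_bound :: "nat \<Rightarrow> nat \<Rightarrow> real \<Rightarrow> real" where
  "cluster_bound n k q =
     real (n choose k) * (real k ^ (k - 1) / real k) * q ^ (k - 1) * (1 - q) ^ (k * (n - k))"

lemma cluster_prob_le:
  assumes V: "finite V" "A \<subseteq> V" "A \<noteq> {}" and q: "0 \<le> q" "q \<le> 1"
  defines "E \<equiv> [V]\<^bsup>2\<^esup>"
  shows "emeasure (iid E) {W \<in> space (iid E). A \<in> clusters V (below E W q)} \<le>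
    ennreal (real (card A) ^ (card A - 1) / real (card A) * q ^ (card A - 1) *
      (1 - q) ^ (card A * (card V - card A)))"
proof -
  have finE: "finite E"
    using V(1) by (simp add: E_def finite_imp_finite_nsets)
  have finA: "finite A" using V finite_subset by blast
  obtain \<F> where \<F>: "finite \<F>" "card A * card \<F> \<le> card A ^ (card A - 1)"
    "\<And>\<tau>. \<tau> \<in> \<F> \<Longrightarrow> \<tau> \<subseteq> [A]\<^bsup>2\<^esup> \<and> card \<tau> = card A - 1"
    "\<And>V G. A \<in> clusters V G \<Longrightarrow> \<exists>\<tau>\<in>\<F>. \<tau> \<subseteq> G"
    using cluster_tree_cover[OF finA V(3)] by blast
  \<comment> \<open>The pairs leaving \<open>A\<close>, all absent when \<open>A\<close> is a
    cluster. They are disjoint from the pairs inside \<open>A\<close>, so for each candidate tree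
    the probability is a product.\<close>
  define T where "T = (\<lambda>(x, y). {x, y}) ` (A \<times> (V - A))"
  have "inj_on (\<lambda>(x, y). {x, y}) (A \<times> (V - A))"
  proof (rule inj_onI)
    fix p p' assume p: "p \<in> A \<times> (V - A)" "p' \<in> A \<times> (V - A)"
      and "(\<lambda>(x, y). {x, y}) p = (\<lambda>(x, y). {x, y}) p'"
    then have "{fst p, snd p} = {fst p', snd p'}"
      by (simp add: case_prod_beta)
    then show "p = p'"
      using p by (metis DiffD2 doubleton_eq_iff mem_Times_iff prod.collapse)
  qed
  then have cardT: "card T = card A * (card V - card A)"
    using V finA by (simp add: T_def card_image card_cartesian_product card_Diff_subset)
  have TE: "T \<subseteq> E"
    using V(2) by (auto simp: T_def E_def)
  have AE: "[A]\<^bsup>2\<^esup> \<subseteq> E"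
    unfolding E_def by (rule nsets_mono[OF V(2)])
  have disj: "[A]\<^bsup>2\<^esup> \<inter> T = {}"
    by (auto simp: T_def)
  define B where "B \<tau> = {W \<in> space (iid E). (\<forall>e\<in>\<tau>. W e < q) \<and> (\<forall>e\<in>T. q \<le> W e)}" for \<tau>
  have B: "emeasure (iid E) (B \<tau>) = ennreal (q ^ (card A - 1) * (1 - q) ^ card T)" if "\<tau> \<in> \<F>" for \<tau>
    using emeasure_iid_box[OF finE _ TE _ q, of \<tau>] \<F>(3)[OF that] AE disj unfolding B_def by auto
  have B_sets: "B \<tau> \<in> sets (iid E)" if "\<tau> \<in> \<F>" for \<tau>
  proof -
    have "\<tau> \<subseteq> E" using \<F>(3)[OF that] AE by blast
    then have "{W \<in> space (iid E). \<forall>e\<in>\<tau>. W e < q} \<in> sets (iid E)" "{W \<in> space (iid E). \<forall>e\<in>T. q \<le> W e} \<in> sets (iid E)"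
      using TE finE finite_subset
      by (auto intro!: sets.sets_Collect_finite_All borel_measurable_less borel_measurable_le measurable_iid_component)
    from sets.sets_Collect_conj[OF this(2,1)] show ?thesis
      unfolding B_def by simp
  qed
  have "{W \<in> space (iid E). A \<in> clusters V (below E W q)} \<subseteq> (\<Union>\<tau>\<in>\<F>. B \<tau>)"
  proof
    fix W assume "W \<in> {W \<in> space (iid E). A \<in> clusters V (below E W q)}"
    then have W: "W \<in> space (iid E)" and A: "A \<in> clusters V (below E W q)" by auto
    obtain \<tau> where \<tau>: "\<tau> \<in> \<F>" "\<tau> \<subseteq> below E W q"
      using \<F>(4)[OF A] by blast
    have "q \<le> W e" if "e \<in> T" for e
    proof (rule ccontr)
      assume "\<not> q \<le> W e"
      then have "e \<in> below E W q"
        using that TE by (auto simp: below_def)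
      moreover obtain x y where xy: "e = {x, y}" "x \<in> A" "y \<notin> A"
        using \<open>e \<in> T\<close> by (auto simp: T_def)
      ultimately have "(x, y) \<in> joined (below E W q)"
        by (auto intro: joined_edge)
      moreover obtain w where "A = cluster (below E W q) w"
        using A by (auto simp: clusters_def)
      ultimately show False
        using xy joined_trans[of w x _ y] by simp
    qed
    then have "W \<in> B \<tau>"
      using W \<tau>(2) by (auto simp: B_def below_def)
    then show "W \<in> (\<Union>\<tau>\<in>\<F>. B \<tau>)" using \<tau>(1) by blast
  qed
  then have "emeasure (iid E) {W \<in> space (iid E). A \<in> clusters V (below E W q)} \<le> emeasure (iid E) (\<Union>\<tau>\<in>\<F>. B \<tau>)"
    using \<F>(1) B_sets by (intro emeasure_mono) auto
  also have "\<dots> \<le> (\<Sum>\<tau>\<in>\<F>. emeasure (iid E) (B \<tau>))"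
    using \<F>(1) B_sets by (intro emeasure_subadditive_finite) auto
  also have "\<dots> = ennreal (real (card \<F>) * (q ^ (card A - 1) * (1 - q) ^ card T))"
    using B q by (simp add: ennreal_mult ennreal_of_nat_eq_real_of_nat)
  also have "\<dots> \<le> ennreal (real (card A) ^ (card A - 1) / real (card A) * (q ^ (card A - 1) * (1 - q) ^ card T))"
  proof (intro ennreal_leI mult_right_mono)
    have "real (card A) * real (card \<F>) \<le> real (card A) ^ (card A - 1)"
      using \<F>(2) by (simp flip: of_nat_mult of_nat_power)
    then show "real (card \<F>) \<le> real (card A) ^ (card A - 1) / real (card A)"
      using V(3) finA by (simp add: pos_le_divide_eq card_gt_0_iff mult.commute)
  qed (use q in auto)
  finally show ?thesis
    by (simp add: cardT mult.assoc)
qed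

lemma expected_clusters_le:
  fixes V :: "'v set" and I :: "nat set"
  assumes V: "finite V" and q: "0 \<le> q" "q \<le> 1" and I: "finite I" "0 \<notin> I"
  defines "E \<equiv> [V]\<^bsup>2\<^esup>"
  shows "(\<integral>\<^sup>+W. ennreal (real (card {C \<in> clusters V (below E W q). card C \<in> I})) \<partial>iid E) \<le>
    ennreal (\<Sum>k\<in>I. cluster_bound (card V) k q)"
proof -
  have finE: "finite E"
    using V(1) by (simp add: E_def finite_imp_finite_nsets)
  define S where "S = {A. A \<subseteq> V \<and> card A \<in> I}"
  have finS: "finite S" using V by (simp add: S_def)
  let ?X = "\<lambda>A. {W \<in> space (iid E). A \<in> clusters V (below E W q)}"
  have X: "?X A \<in> sets (iid E)" for A
  proof -
    have "Measurable.pred (iid E) (\<lambda>W. A \<in> clusters V (below E W q))"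
      by (rule measurable_ranking_below[OF finE, of "\<lambda>_ B. A \<in> clusters V B" q])
    then show ?thesis by (simp add: pred_def)
  qed
  have "(\<integral>\<^sup>+W. ennreal (real (card {C \<in> clusters V (below E W q). card C \<in> I})) \<partial>iid E) =
      (\<integral>\<^sup>+W. (\<Sum>A\<in>S. indicator (?X A) W) \<partial>iid E)"
  proof (rule nn_integral_cong)
    fix W assume W: "W \<in> space (iid E)"
    have "below E W q \<subseteq> [V]\<^bsup>2\<^esup>" by (auto simp: below_def E_def)
    then have "{C \<in> clusters V (below E W q). card C \<in> I} = {A \<in> S. A \<in> clusters V (below E W q)}"
      using clusters_partition(3)[OF V] by (auto simp: S_def)
    then have "real (card {C \<in> clusters V (below E W q). card C \<in> I}) = (\<Sum>A\<in>S. if A \<in> clusters V (below E W q) then 1 else 0)"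
      using finS by (simp add: sum.If_cases Int_def)
    also have "ennreal \<dots> = (\<Sum>A\<in>S. ennreal (if A \<in> clusters V (below E W q) then 1 else 0))"
      by (rule sum_ennreal[symmetric]) auto
    also have "\<dots> = (\<Sum>A\<in>S. indicator (?X A) W)"
      using W by (intro sum.cong) (auto simp: indicator_def)
    finally show "ennreal (real (card {C \<in> clusters V (below E W q). card C \<in> I})) = (\<Sum>A\<in>S. indicator (?X A) W)" .
  qed
  also have "\<dots> = (\<Sum>A\<in>S. emeasure (iid E) (?X A))"
    using X by (simp add: nn_integral_sum)
  also have "\<dots> \<le> (\<Sum>A\<in>S. ennreal (real (card A) ^ (card A - 1) / real (card A) * q ^ (card A - 1) *
      (1 - q) ^ (card A * (card V - card A))))"
    using I(2) q unfolding E_def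
    by (intro sum_mono cluster_prob_le V) (auto simp: S_def)
  also have "\<dots> = (\<Sum>k\<in>I. \<Sum>A | A \<in> S \<and> card A = k. ennreal (real (card A) ^ (card A - 1) / real (card A) * q ^ (card A - 1) *
      (1 - q) ^ (card A * (card V - card A))))"
    using finS I(1) by (intro sum.group[symmetric]) (auto simp: S_def)
  also have "\<dots> = (\<Sum>k\<in>I. ennreal (cluster_bound (card V) k q))"
  proof (rule sum.cong[OF refl])
    fix k assume "k \<in> I"
    then have "{A. A \<in> S \<and> card A = k} = {A. A \<subseteq> V \<and> card A = k}"
      by (auto simp: S_def)
    then have "(\<Sum>A | A \<in> S \<and> card A = k. ennreal (real (card A) ^ (card A - 1) / real (card A) * q ^ (card A - 1) *
      (1 - q) ^ (card A * (card V - card A)))) = of_nat (card V choose k) *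
        ennreal (real k ^ (k - 1) / real k * q ^ (k - 1) * (1 - q) ^ (k * (card V - k)))"
    proof -
      have "(\<Sum>A | A \<subseteq> V \<and> card A = k. ennreal (real (card A) ^ (card A - 1) / real (card A) * q ^ (card A - 1) *
          (1 - q) ^ (card A * (card V - card A)))) =
        (\<Sum>A | A \<subseteq> V \<and> card A = k. ennreal (real k ^ (k - 1) / real k * q ^ (k - 1) * (1 - q) ^ (k * (card V - k))))"
        by (rule sum.cong) auto
      then show ?thesis
        using \<open>{A. A \<in> S \<and> card A = k} = _\<close> n_subsets[OF V, of k] by simp
    qed
    also have "\<dots> = ennreal (cluster_bound (card V) k q)"
      by (simp add: cluster_bound_def ennreal_of_nat_eq_real_of_nat ennreal_mult'[symmetric] mult.assoc)
    finally show "(\<Sum>A | A \<in> S \<and> card A = k. ennreal (real (card A) ^ (card A - 1) / real (card A) * q ^ (card A - 1) *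
      (1 - q) ^ (card A * (card V - card A)))) = ennreal (cluster_bound (card V) k q)" .
  qed
  also have "\<dots> = ennreal (\<Sum>k\<in>I. cluster_bound (card V) k q)"
    using q by (intro sum_ennreal) (auto simp: cluster_bound_def)
  finally show ?thesis .
qed

text \<open>Two bounds for two ranges of \<open>q\<close>. The first discards a cluster with more
  than half of the vertices and is used for \<open>q \<ge> 100 / n\<close>. The second estimates
  clusters with more than \<open>K\<close> vertices by their number, at most \<open>n / K\<close>,
  and is used for smaller \<open>q\<close>.\<close>

lemma expected_excess_clusters_le:
  fixes V :: "'v set"
  assumes V: "finite V" and q: "0 \<le> q" "q \<le> 1" and K: "0 < K"
  defines "E \<equiv> [V]\<^bsup>2\<^esup>" and "n \<equiv> card V"
  shows "(\<integral>\<^sup>+W. ennreal (real (card (clusters V (below E W q))) - 1) \<partial>iid E) \<le>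
      ennreal (\<Sum>k=1..n div 2. cluster_bound n k q)"
    and "(\<integral>\<^sup>+W. ennreal (real (card (clusters V (below E W q))) - 1) \<partial>iid E) \<le> ennreal ((\<Sum>k=1..K. cluster_bound n k q) + real n / real K)"
proof -
  let ?B = "\<lambda>W. below E W q"
  let ?L = "\<integral>\<^sup>+W. ennreal (real (card (clusters V (?B W))) - 1) \<partial>iid E"
  have finE: "finite E"
    using V(1) by (simp add: E_def finite_imp_finite_nsets)
  have sub: "?B W \<subseteq> [V]\<^bsup>2\<^esup>" for W by (auto simp: below_def E_def)
  have pos: "1 \<le> card C" if "C \<in> clusters V (?B W)" for C W
    using clusters_partition(3)[OF V sub that] by (simp add: Suc_le_eq card_gt_0_iff)
  have "?L \<le> (\<integral>\<^sup>+W. ennreal (real (card {C \<in> clusters V (?B W). card C \<in> {1..n div 2}})) \<partial>iid E)"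
  proof (intro nn_integral_mono ennreal_leI)
    fix W
    have "{C \<in> clusters V (?B W). card C \<in> {1..n div 2}} = {C \<in> clusters V (?B W). 2 * card C \<le> card V}"
      using pos by (auto simp: n_def)
    then show "real (card (clusters V (?B W))) - 1 \<le> real (card {C \<in> clusters V (?B W). card C \<in> {1..n div 2}})"
      using card_clusters_le_small[OF V sub, of W] by simp
  qed
  also have "\<dots> \<le> ennreal (\<Sum>k=1..n div 2. cluster_bound n k q)"
    unfolding E_def n_def by (rule expected_clusters_le[OF V q]) auto
  finally show "?L \<le> ennreal (\<Sum>k=1..n div 2. cluster_bound n k q)" .
  have "?L \<le> (\<integral>\<^sup>+W. ennreal (real (card {C \<in> clusters V (?B W). card C \<in> {1..K}})) + ennreal (real n / real K) \<partial>iid E)"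
  proof (intro nn_integral_mono)
    fix W
    let ?c = "card {C \<in> clusters V (?B W). card C \<in> {1..K}}"
    have "{C \<in> clusters V (?B W). card C \<in> {1..K}} = {C \<in> clusters V (?B W). card C \<le> K}"
      using pos by auto
    then have "K * card (clusters V (?B W)) \<le> K * ?c + n"
      using card_clusters_le_bounded[OF V sub, of K W] by (simp add: n_def)
    then have "real K * real (card (clusters V (?B W))) \<le> real K * real ?c + real n"
      by (simp flip: of_nat_mult of_nat_add)
    then have "real (card (clusters V (?B W))) \<le> real ?c + real n / real K"
      using K by (simp add: field_simps)
    then have "ennreal (real (card (clusters V (?B W))) - 1) \<le> ennreal (real ?c + real n / real K)"
      by (intro ennreal_leI) simp
    then show "ennreal (real (card (clusters V (?B W))) - 1) \<le> ennreal (real ?c) + ennreal (real n / real K)"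
      by (simp add: ennreal_plus)
  qed
  also have "\<dots> = (\<integral>\<^sup>+W. ennreal (real (card {C \<in> clusters V (?B W). card C \<in> {1..K}})) \<partial>iid E) + ennreal (real n / real K)"
    using measurable_ranking_below'[OF finE, of "\<lambda>_ B. ennreal (real (card {C \<in> clusters V B. card C \<in> {1..K}}))" q]
      prob_space.emeasure_space_1[OF prob_space_iid, of E]
    by (simp add: nn_integral_add)
  also have "\<dots> \<le> ennreal (\<Sum>k=1..K. cluster_bound n k q) + ennreal (real n / real K)"
    unfolding E_def n_def by (intro add_right_mono expected_clusters_le[OF V q]) auto
  also have "\<dots> = ennreal ((\<Sum>k=1..K. cluster_bound n k q) + real n / real K)"
    using q by (intro ennreal_plus[symmetric]) (auto intro!: sum_nonneg simp: cluster_bound_def)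
  finally show "?L \<le> ennreal ((\<Sum>k=1..K. cluster_bound n k q) + real n / real K)" .
qed

section \<open>The integrated number of components\<close>

lemma nn_integral_unif:
  assumes "f \<in> borel_measurable borel"
  shows "(\<integral>\<^sup>+q. f q \<partial>unif) = (\<integral>\<^sup>+q. f q * indicator {0<..<1} q \<partial>lborel)"
  using assms by (subst nn_integral_uniform_measure) (auto simp: divide_ennreal_def)

lemma fact_mult_power_le: "fact m * Suc m ^ k \<le> (fact (m + k) :: nat)"
proof (induction k)
  case (Suc k)
  have "fact m * Suc m ^ Suc k = Suc m * (fact m * Suc m ^ k)"
    by (simp only: power_Suc ac_simps)
  also have "\<dots> \<le> Suc (m + k) * fact (m + k)"
    using Suc by (intro mult_mono) auto
  finally show ?case by simp
qed simp

text \<open>The left side is \<open>(k - 1)! (m - 1)! / (m + k - 1)!\<close>, and the last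
  \<open>k\<close> factors of the denominator are each at least \<open>m\<close>.\<close>

lemma Beta_nat_le:
  fixes k m :: nat
  assumes "0 < k" "0 < m"
  shows "Beta (real k) (real m) \<le> fact (k - 1) / real m ^ k"
proof -
  obtain k' m' where km: "k = Suc k'" "m = Suc m'"
    using assms by (metis Suc_pred)
  have "Gamma (real (Suc j)) = fact j" for j
    using Gamma_fact[of j, where ?'a = real] by (simp add: add.commute)
  moreover have "real k + real m = real (Suc (m' + k))"
    by (simp add: km)
  ultimately have "Beta (real k) (real m) = fact k' * fact m' / fact (m' + k)"
    unfolding Beta_def km by (simp only:)
  moreover have "fact m' * real m ^ k \<le> fact (m' + k)"
  proof -
    have "real (fact m' * Suc m' ^ k) \<le> real (fact (m' + k))"
      by (rule of_nat_mono[OF fact_mult_power_le])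
    then show ?thesis
      by (simp only: km(2) of_nat_mult of_nat_fact of_nat_power)
  qed
  moreover have "a * b / F \<le> a / P" if "b * P \<le> F" "0 < F" "0 < P" "0 \<le> a" for a b F P :: real
  proof -
    have "b / F \<le> 1 / P"
      using that by (simp add: field_simps)
    then show ?thesis
      using mult_left_mono[of "b / F" "1 / P" a] that(4) by simp
  qed
  ultimately show ?thesis
    using assms by (simp add: km)
qed

lemma nn_integral_unif_beta:
  fixes k m :: nat
  assumes "0 < k" "0 < m" "0 \<le> c"
  shows "(\<integral>\<^sup>+q. ennreal (c * (q ^ (k - 1) * (1 - q) ^ (m - 1))) \<partial>unif) = ennreal (c * Beta k m)"
proof -
  have eq: "t powr (real k - 1) * (1 - t) powr (real m - 1) = t ^ (k - 1) * (1 - t) ^ (m - 1)"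
    if "t \<in> {0<..<1}" for t :: real
  proof -
    have "real k - 1 = real (k - 1)" "real m - 1 = real (m - 1)"
      using assms by auto
    then show ?thesis
      using that by (simp only: powr_realpow greaterThanLessThan_iff diff_gt_0_iff_gt)
  qed
  have "((\<lambda>t. t powr (real k - 1) * (1 - t) powr (real m - 1)) has_integral Beta k m) {0<..<1}"
    using has_integral_Beta_real[of "real k" "real m"] assms by (simp add: has_integral_Icc_iff_Ioo)
  then have "((\<lambda>t. t ^ (k - 1) * (1 - t) ^ (m - 1)) has_integral Beta k m) {0<..<1}"
    by (rule has_integral_eq[rotated]) (rule eq)
  then have "((\<lambda>t. c * (t ^ (k - 1) * (1 - t) ^ (m - 1))) has_integral c * Beta k m) {0<..<1}"
    by (rule has_integral_mult_right)
  then have "integral\<^sup>N lborel (\<lambda>q. ennreal (c * (q ^ (k - 1) * (1 - q) ^ (m - 1))) * indicator {0<..<1} q) = ennreal (c * Beta k m)"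
    using assms(3) by (intro nn_integral_has_integral_lebesgue') auto
  then show ?thesis
    by (subst nn_integral_unif) auto
qed

lemma nn_integral_unif_exp_le:
  fixes a c :: real
  assumes "0 < a" "0 \<le> c"
  shows "(\<integral>\<^sup>+q. ennreal (c * exp (- a * q)) \<partial>unif) \<le> ennreal (c / a)"
proof -
  have "(\<integral>\<^sup>+q. ennreal (c * exp (- a * q)) \<partial>unif) = (\<integral>\<^sup>+q. ennreal (c * exp (- a * q)) * indicator {0<..<1} q \<partial>lborel)"
    by (rule nn_integral_unif) simp
  also have "\<dots> \<le> (\<integral>\<^sup>+q. ennreal (c * exp (- a * q)) * indicator {0..} q \<partial>lborel)"
    by (intro nn_integral_mono) (auto simp: indicator_def)
  also have "\<dots> = ennreal (0 - (- c / a * exp (- a * 0)))"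
  proof (rule nn_integral_FTC_atLeast)
    show "((\<lambda>x. - c / a * exp (- a * x)) has_real_derivative c * exp (- a * x)) (at x)" for x
      using assms(1) by (auto intro!: derivative_eq_intros)
    have "filterlim (\<lambda>x. - a * x) at_bot at_top"
      using assms(1) by (simp add: filterlim_tendsto_pos_mult_at_top[of "\<lambda>_. a" a] filterlim_uminus_at_bot filterlim_ident)
    then have "((\<lambda>x. exp (- a * x)) \<longlongrightarrow> 0) at_top"
      by (rule filterlim_compose[OF exp_at_bot])
    from tendsto_mult_right_zero[OF this, of "- c / a"]
    show "((\<lambda>x. - c / a * exp (- a * x)) \<longlongrightarrow> 0) at_top" .
  qed (use assms in auto)
  finally show ?thesis by simp
qed

text \<open>The left side is the integral of \<open>cluster_bound n k q / (1 - q)\<close>; the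
  division lowers the exponent of \<open>1 - q\<close> to \<open>k (n - k) - 1\<close>, as in the
  Beta integral. The cube arises from
  \<open>k ^ (k - 2) * (k - 1)! / (k! * k ^ k) = 1 / k^3\<close>.\<close>

lemma cluster_bound_integral_le:
  assumes "0 < k" "k < n"
  shows "real (n choose k) * (real k ^ (k - 1) / real k) * Beta (real k) (real (k * (n - k))) \<le>
    (1 / real k ^ 3) * (real n / (real n - real k)) ^ k"
proof -
  have m: "0 < k * (n - k)" using assms by simp
  have nk: "real (n - k) = real n - real k" "0 < real n - real k"
    using assms by auto
  have kk: "real k ^ (k - 1) * real k = real k ^ k"
    using assms(1) by (cases k) auto
  have kf: "fact (k - 1) * real k = fact k"
    using assms(1) by (cases k) (auto simp: algebra_simps)
  have "real (n choose k) * fact k \<le> real n ^ k"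
    using binomial_fact_pow[of n k] by (metis of_nat_fact of_nat_le_iff of_nat_mult of_nat_power)
  then have binom: "real (n choose k) \<le> real n ^ k / fact k"
    by (simp add: pos_le_divide_eq)
  have "real (n choose k) * (real k ^ (k - 1) / real k) * Beta (real k) (real (k * (n - k))) \<le>
      (real n ^ k / fact k) * (real k ^ (k - 1) / real k) * (fact (k - 1) / real (k * (n - k)) ^ k)"
  proof (intro mult_mono binom Beta_nat_le[OF assms(1) m])
    show "0 \<le> Beta (real k) (real (k * (n - k)))"
      using assms(1) m unfolding Beta_def
      by (intro divide_nonneg_pos mult_nonneg_nonneg less_imp_le Gamma_real_pos) (auto intro: add_pos_pos)
  qed auto
  also have "\<dots> = (real n ^ k / (fact (k - 1) * real k)) * (real k ^ (k - 1) / real k) *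
      (fact (k - 1) / (real k ^ (k - 1) * real k * (real n - real k) ^ k))"
    unfolding kf kk by (simp add: nk power_mult_distrib)
  also have "\<dots> = (1 / real k ^ 3) * (real n / (real n - real k)) ^ k"
  proof -
    have "N / (F * R) * (P / R) * (F / (P * R * D)) = 1 / R ^ 3 * (N / D)"
      if "F \<noteq> 0" "R \<noteq> 0" "P \<noteq> 0" "D \<noteq> 0" for N F R P D :: real
      using that by (simp add: power3_eq_cube field_simps)
    from this[of "fact (k - 1)" "real k" "real k ^ (k - 1)" "(real n - real k) ^ k" "real n ^ k"] assms nk(2)
    show ?thesis
      unfolding power_divide by simp
  qed
  finally show ?thesis .
qed

lemma exp_half_ge:
  fixes x :: real
  assumes "100 \<le> x"
  shows "exp 1 * x * exp (- x / 2) \<le> 1 / 2"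
proof -
  \<comment> \<open>This holds from \<open>x = 96\<close> on, which explains the threshold 100; the
    6 is twice the bound 3 for \<open>exp 1\<close>.\<close>
  have "6 * x \<le> (x / 4) ^ 2"
    using assms by (simp add: power2_eq_square)
  also have "\<dots> \<le> (exp (x / 4)) ^ 2"
  proof (rule power_mono)
    show "x / 4 \<le> exp (x / 4)"
      using exp_ge_add_one_self[of "x / 4"] by linarith
  qed (use assms in auto)
  also have "\<dots> = exp (x / 2)"
    by (simp flip: exp_of_nat_mult)
  finally have "6 * x * exp (- x / 2) \<le> 1"
    by (simp add: exp_minus field_simps)
  moreover have "exp 1 * x * exp (- x / 2) \<le> 3 * x * exp (- x / 2)"
    using assms exp_le by (intro mult_right_mono) auto
  ultimately show ?thesis by simp
qed

text \<open>For \<open>n q \<ge> 100\<close> the factor gained per additional vertex, \<open>e (n q) exp (- n q / 2)\<close>, is at most 1/2.\<close>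

lemma cluster_bound_tail:
  assumes "1 \<le> k" "2 * k \<le> n" and q: "100 / real n \<le> q" "0 < q" "q < 1"
  shows "cluster_bound n k q / (1 - q) \<le> 9 * real n * exp (- real n / 2 * q) * (1 / 2) ^ (k - 1)"
proof -
  define x where "x = real n * q"
  define m where "m = k * (n - k)"
  have n: "0 < real n" using assms(1,2) by auto
  have x: "100 \<le> x"
    using q(1) n by (simp add: x_def field_simps)
  have m: "0 < m" using assms(1,2) by (simp add: m_def)
  have kk: "real k ^ (k - 1) / real k \<le> real k ^ k"
  proof -
    have "real k ^ (k - 1) / real k \<le> real k ^ (k - 1) / 1"
      using assms(1) by (intro divide_left_mono) auto
    also have "\<dots> \<le> real k ^ k"
      using assms(1) by (simp add: power_increasing)
    finally show ?thesis .
  qed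
  \<comment> \<open>A single term of the exponential series at \<open>k\<close>.\<close>
  have "real k ^ k / fact k \<le> exp (real k)"
  proof -
    have "(\<Sum>i\<in>{k}. real k ^ i /\<^sub>R fact i) \<le> (\<Sum>i. real k ^ i /\<^sub>R fact i)"
      by (intro sum_le_suminf summable_exp_generic) auto
    then show ?thesis
      by (simp add: exp_def field_simps)
  qed
  have c: "real (n choose k) * (real k ^ (k - 1) / real k) \<le> (real n * exp 1) ^ k"
  proof -
    have "real (n choose k) * fact k \<le> real n ^ k"
      using binomial_fact_pow[of n k] by (metis of_nat_fact of_nat_le_iff of_nat_mult of_nat_power)
    then have "real (n choose k) \<le> real n ^ k / fact k"
      by (simp add: pos_le_divide_eq)
    then have "real (n choose k) * (real k ^ (k - 1) / real k) \<le> (real n ^ k / fact k) * real k ^ k"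
      using kk by (intro mult_mono) auto
    also have "\<dots> = real n ^ k * (real k ^ k / fact k)" by simp
    also have "\<dots> \<le> real n ^ k * exp (real k)"
      using \<open>real k ^ k / fact k \<le> exp (real k)\<close> by (intro mult_left_mono) auto
    also have "\<dots> = (real n * exp 1) ^ k"
      by (simp add: power_mult_distrib flip: exp_of_nat_mult)
    finally show ?thesis .
  qed
  \<comment> \<open>From \<open>2 * k \<le> n\<close> at least \<open>k * n / 2\<close> pairs leave
    the set. The exponent lost through dividing by \<open>1 - q\<close> costs at most the factor
    \<open>exp 1\<close>, since \<open>q < 1\<close>.\<close>
  have e: "(1 - q) ^ (m - 1) \<le> exp 1 * exp (- x / 2) ^ k"
  proof -
    have "real k * real n / 2 \<le> real k * (real n - real k)"
      using assms(1,2) by (simp add: field_simps)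
    then have mk: "real k * real n / 2 - 1 \<le> real (m - 1)"
    proof -
      have "real m = real k * (real n - real k)"
        using assms(2) by (simp add: m_def of_nat_diff)
      moreover have "real (m - 1) = real m - 1"
        using m by (simp add: of_nat_diff Suc_leI)
      ultimately show ?thesis
        using \<open>real k * real n / 2 \<le> real k * (real n - real k)\<close> by simp
    qed
    have "(1 - q) ^ (m - 1) \<le> exp (- q) ^ (m - 1)"
      using q exp_ge_add_one_self[of "- q"] by (intro power_mono) auto
    also have "\<dots> = exp (- (q * real (m - 1)))"
      by (simp add: mult.commute flip: exp_of_nat_mult)
    also have "\<dots> \<le> exp (- (q * (real k * real n / 2 - 1)))"
      using mk q by simp
    also have "\<dots> \<le> exp (1 + real k * (- x / 2))"
      using q by (simp add: x_def algebra_simps)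
    also have "\<dots> = exp 1 * exp (- x / 2) ^ k"
      by (simp only: exp_add exp_of_nat_mult)
    finally show ?thesis .
  qed
  have "cluster_bound n k q / (1 - q) =
      real (n choose k) * (real k ^ (k - 1) / real k) * q ^ (k - 1) * (1 - q) ^ (m - 1)"
    using m q by (cases m) (auto simp: cluster_bound_def m_def)
  also have "\<dots> \<le> (real n * exp 1) ^ k * q ^ (k - 1) * (exp 1 * exp (- x / 2) ^ k)"
    using c e q by (intro mult_mono) auto
  \<comment> \<open>One of the \<open>k\<close> factors \<open>n * exp 1\<close> has no matching
    \<open>q\<close>; together with the \<open>exp 1\<close> from the lost exponent it gives
    \<open>exp 1 ^ 2 * n\<close>, hence the 9 below.\<close>
  also have "\<dots> = exp 1 ^ 2 * real n * exp (- x / 2) * (exp 1 * x * exp (- x / 2)) ^ (k - 1)"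
    using assms(1) by (cases k) (auto simp: x_def power_mult_distrib power2_eq_square)
  also have "\<dots> \<le> 9 * real n * exp (- x / 2) * (1 / 2) ^ (k - 1)"
  proof (intro mult_mono power_mono exp_half_ge x)
    show "exp 1 ^ 2 \<le> (9 :: real)"
      using power_mono[OF exp_le, of 2] by simp
  qed (use x in auto)
  finally show ?thesis
    by (simp add: x_def)
qed

lemma sum_half_power_le: "(\<Sum>k=Suc K..N. (1 / 2 :: real) ^ (k - 1)) \<le> 2 * (1 / 2) ^ K"
proof -
  have "(\<Sum>k=Suc K..N. (1 / 2 :: real) ^ (k - 1)) \<le> 2 * (1 / 2) ^ K - 2 * (1 / 2) ^ N" if "K \<le> N"
    using that
  proof (induction N rule: dec_induct)
    case (step N)
    then show ?case by simp
  qed simp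
  moreover have "(\<Sum>k=Suc K..N. (1 / 2 :: real) ^ (k - 1)) = 0" if "\<not> K \<le> N"
    using that by simp
  ultimately show ?thesis
    by (cases "K \<le> N") (auto intro: order_trans)
qed

text \<open>The bound is \<open>1 + 1/8 + 1/12\<close>: from \<open>k = 3\<close> on,
  \<open>1 / k^3\<close> is at most \<open>1 / ((k - 1) k (k + 1))\<close>, whose sum telescopes to
  at most \<open>1 / (2 * 2 * 3)\<close>.\<close>

lemma sum_inverse_cubes_le: "(\<Sum>k=1..K. 1 / real k ^ 3) \<le> 29 / 24"
proof -
  have "(\<Sum>k=1..K. 1 / real k ^ 3) \<le> 29 / 24 - 1 / (2 * (real K * (real K + 1)))" if "2 \<le> K"
    using that
  proof (induction K rule: dec_induct)
    case base
    have "{1..2} = {1, 2::nat}" by auto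
    then show ?case by simp
  next
    case (step K)
    define x where "x = real K"
    have x: "2 \<le> x" using step.hyps by (simp add: x_def)
    have pos: "0 < x * ((x + 1) * (x + 2))"
      using x by simp
    have "x * ((x + 1) * (x + 2)) \<le> (x + 1) ^ 3"
      using x by (simp add: power3_eq_cube algebra_simps)
    then have "1 / (x + 1) ^ 3 \<le> 1 / (x * ((x + 1) * (x + 2)))"
      using pos x by (intro divide_left_mono) auto
    also have "\<dots> = 1 / (2 * (x * (x + 1))) - 1 / (2 * ((x + 1) * (x + 2)))"
    proof -
      have "x \<noteq> 0" "x + 1 \<noteq> 0" "x + 2 \<noteq> 0" using x by auto
      then show ?thesis by (simp add: divide_simps)
    qed
    finally show ?case
      using step.IH step.hyps by (simp add: x_def add.commute)
  qed
  moreover have "(\<Sum>k=1..K. 1 / real k ^ 3) \<le> 29 / 24" if "\<not> 2 \<le> K"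
  proof -
    have "K = 0 \<or> K = 1" using that by auto
    then show ?thesis by auto
  qed
  ultimately show ?thesis
    using divide_nonneg_nonneg[of 1 "2 * (real K * (real K + 1))"] by (smt (verit) mult_nonneg_nonneg of_nat_0_le_iff)
qed

text \<open>Any size with \<open>236 / split_size < 31 / 25 - 29 / 24\<close> would do.\<close>

definition split_size :: nat where "split_size = 10000"

text \<open>Majorant of the integrand of \<open>L\<close>: small clusters for all \<open>q\<close>;
  the at most \<open>n / split_size\<close> larger clusters for \<open>q < 100 / n\<close>, doubled
  since \<open>1 / (1 - q) \<le> 2\<close> there; and the geometric tail of
  \<open>cluster_bound_tail\<close>, whose ratio 1/2 turns 9 into 18.\<close>

definition excess_bound :: "nat \<Rightarrow> real \<Rightarrow> real" where
  "excess_bound n q =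
     (\<Sum>k=1..split_size. cluster_bound n k q / (1 - q)) +
     2 * real n / real split_size * indicator {..<100 / real n} q +
     18 * real n * (1 / 2) ^ split_size * exp (- real n / 2 * q)"

lemma excess_bound:
  fixes V :: "'v set"
  assumes V: "finite V" and n: "200 \<le> card V" and q: "0 < q" "q < 1"
  defines "E \<equiv> [V]\<^bsup>2\<^esup>"
  shows "(\<integral>\<^sup>+W. ennreal (real (card (clusters V (below E W q))) - 1) \<partial>iid E) / ennreal (1 - q) \<le>
    ennreal (excess_bound (card V) q)" (is "?L / _ \<le> _")
proof -
  let ?n = "card V" and ?K = split_size
  have pos: "0 \<le> cluster_bound ?n k q" for k
    using q by (simp add: cluster_bound_def)
  have "?L \<le> ennreal ((1 - q) * excess_bound ?n q)"
  proof (cases "q < 100 / real ?n")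
    case True
    \<comment> \<open>The assumption of at least 200 vertices keeps \<open>q\<close> below 1/2 in
      this case, so that dividing by \<open>1 - q\<close> at most doubles.\<close>
    moreover have "100 / real ?n \<le> 100 / 200"
      using n by (intro divide_left_mono) auto
    ultimately have "q \<le> 1 / 2"
      by simp
    then have "1 * (real ?n / real ?K) \<le> ((1 - q) * 2) * (real ?n / real ?K)"
      by (intro mult_right_mono) auto
    then have "real ?n / real ?K \<le> (1 - q) * (2 * real ?n / real ?K)"
      by (simp only: mult_1 mult.assoc times_divide_eq_right)
    moreover have "0 \<le> (1 - q) * (18 * real ?n * (1 / 2) ^ ?K * exp (- real ?n / 2 * q))"
      using q by simp
    moreover have "(1 - q) * (\<Sum>k=1..?K. cluster_bound ?n k q / (1 - q)) = (\<Sum>k=1..?K. cluster_bound ?n k q)"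
      using q by (simp add: sum_distrib_left)
    ultimately have le: "(\<Sum>k=1..?K. cluster_bound ?n k q) + real ?n / real ?K \<le> (1 - q) * excess_bound ?n q"
      using True by (simp add: excess_bound_def distrib_left)
    have "?L \<le> ennreal ((\<Sum>k=1..?K. cluster_bound ?n k q) + real ?n / real ?K)"
      unfolding E_def using q V by (intro expected_excess_clusters_le(2)) (auto simp: split_size_def)
    also have "\<dots> \<le> ennreal ((1 - q) * excess_bound ?n q)"
      using le by (rule ennreal_leI)
    finally show ?thesis .
  next
    case False
    have n0: "0 < real ?n" using n by simp
    \<comment> \<open>Only an inequality, since \<open>?n div 2\<close> may be smaller than
      \<open>?K\<close>; the second range is then empty.\<close>
    have "(\<Sum>k=1..?n div 2. cluster_bound ?n k q) \<le> (\<Sum>k\<in>{1..?K} \<union> {Suc ?K..?n div 2}. cluster_bound ?n k q)"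
      using pos by (intro sum_mono2) auto
    also have "\<dots> = (\<Sum>k=1..?K. cluster_bound ?n k q) + (\<Sum>k=Suc ?K..?n div 2. cluster_bound ?n k q)"
      by (intro sum.union_disjoint) auto
    also have "(\<Sum>k=Suc ?K..?n div 2. cluster_bound ?n k q) \<le>
        (\<Sum>k=Suc ?K..?n div 2. (1 - q) * (9 * real ?n * exp (- real ?n / 2 * q)) * (1 / 2) ^ (k - 1))"
    proof (rule sum_mono)
      fix k assume "k \<in> {Suc ?K..?n div 2}"
      then have "cluster_bound ?n k q / (1 - q) \<le> 9 * real ?n * exp (- real ?n / 2 * q) * (1 / 2) ^ (k - 1)"
        using False q by (intro cluster_bound_tail) auto
      then show "cluster_bound ?n k q \<le> (1 - q) * (9 * real ?n * exp (- real ?n / 2 * q)) * (1 / 2) ^ (k - 1)"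
        using q by (simp add: pos_divide_le_eq mult_ac)
    qed
    also have "\<dots> = (1 - q) * (9 * real ?n * exp (- real ?n / 2 * q)) * (\<Sum>k=Suc ?K..?n div 2. (1 / 2) ^ (k - 1))"
      by (simp add: sum_distrib_left)
    also have "\<dots> \<le> (1 - q) * (9 * real ?n * exp (- real ?n / 2 * q)) * (2 * (1 / 2) ^ ?K)"
      using q by (intro mult_left_mono sum_half_power_le) auto
    also have "(\<Sum>k=1..?K. cluster_bound ?n k q) + \<dots> = (1 - q) * excess_bound ?n q"
      using q False by (simp add: excess_bound_def distrib_left sum_distrib_left mult_ac)
    finally show ?thesis
      using order_trans[OF expected_excess_clusters_le(1)[OF V _ _ zero_less_one] ennreal_leI] q unfolding E_def
      by simp
  qed
  then have "?L / ennreal (1 - q) \<le> ennreal ((1 - q) * excess_bound ?n q) / ennreal (1 - q)"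
    by (rule divide_right_mono_ennreal)
  also have "\<dots> = ennreal (excess_bound ?n q)"
  proof -
    have "0 \<le> excess_bound ?n q"
      using pos q unfolding excess_bound_def by (intro add_nonneg_nonneg sum_nonneg) auto
    then show ?thesis
      using q by (simp add: divide_ennreal)
  qed
  finally show ?thesis .
qed

text \<open>The small clusters give Beta integrals. The middle term is integrated over an interval
  of length \<open>100 / n\<close>, giving \<open>200 / split_size\<close>, and the exponential
  contributes the factor \<open>2 / n\<close>, turning \<open>18 n\<close> into 36.\<close>

lemma excess_bound_integral:
  assumes "200 \<le> n" "split_size < n"
  shows "(\<integral>\<^sup>+q. ennreal (excess_bound n q) \<partial>unif) \<le>
    ennreal ((\<Sum>k=1..split_size. (1 / real k ^ 3) * (real n / (real n - real k)) ^ k) +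
      200 / real split_size + 36 * (1 / 2) ^ split_size)"
proof -
  let ?K = split_size
  define c where "c k = real (n choose k) * (real k ^ (k - 1) / real k)" for k
  have c: "0 \<le> c k" for k by (simp add: c_def)
  let ?f = "\<lambda>k q. c k * (q ^ (k - 1) * (1 - q) ^ (k * (n - k) - 1))"
  have n: "0 < real n" using assms by simp
  have eq: "cluster_bound n k q / (1 - q) = ?f k q" if "k \<in> {1..?K}" "q < 1" for k q
  proof -
    have "0 < k * (n - k)" using that assms by auto
    then obtain m where "k * (n - k) = Suc m" by (metis Suc_pred)
    then show ?thesis using that(2) by (simp add: cluster_bound_def c_def)
  qed
  have "(\<integral>\<^sup>+q. ennreal (excess_bound n q) \<partial>unif) =
      (\<integral>\<^sup>+q. (\<Sum>k=1..?K. ennreal (?f k q)) + ennreal (2 * real n / real ?K) * indicator {..<100 / real n} q +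
        ennreal (18 * real n * (1 / 2) ^ ?K * exp (- (real n / 2) * q)) \<partial>unif)"
  proof (rule nn_integral_cong_AE)
    show "AE q in unif. ennreal (excess_bound n q) = (\<Sum>k=1..?K. ennreal (?f k q)) +
        ennreal (2 * real n / real ?K) * indicator {..<100 / real n} q +
        ennreal (18 * real n * (1 / 2) ^ ?K * exp (- (real n / 2) * q))"
      using AE_unif
    proof eventually_elim
      case (elim q)
      have f: "0 \<le> ?f k q" for k
        using c elim by simp
      have "excess_bound n q = (\<Sum>k=1..?K. ?f k q) + 2 * real n / real ?K * indicator {..<100 / real n} q +
          18 * real n * (1 / 2) ^ ?K * exp (- (real n / 2) * q)"
        using eq elim by (simp add: excess_bound_def)
      also have "ennreal \<dots> = (\<Sum>k=1..?K. ennreal (?f k q)) +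
        ennreal (2 * real n / real ?K) * indicator {..<100 / real n} q +
        ennreal (18 * real n * (1 / 2) ^ ?K * exp (- (real n / 2) * q))"
      proof -
        have "ennreal (2 * real n / real ?K * indicator {..<100 / real n} q) =
            ennreal (2 * real n / real ?K) * indicator {..<100 / real n} q"
          by (simp split: split_indicator)
        moreover have "(\<Sum>k=1..?K. ennreal (?f k q)) = ennreal (\<Sum>k=1..?K. ?f k q)"
          using f by (rule sum_ennreal)
        moreover have "ennreal (a + b + d) = ennreal a + ennreal b + ennreal d"
          if "0 \<le> a" "0 \<le> b" "0 \<le> d" for a b d
          using that by (simp add: ennreal_plus)
        ultimately show ?thesis
          using f by (simp add: sum_nonneg)
      qed
      finally show ?case .
    qed
  qed
  also have "\<dots> = (\<Sum>k=1..?K. \<integral>\<^sup>+q. ennreal (?f k q) \<partial>unif) +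
      ennreal (2 * real n / real ?K) * emeasure unif {..<100 / real n} +
      (\<integral>\<^sup>+q. ennreal (18 * real n * (1 / 2) ^ ?K * exp (- (real n / 2) * q)) \<partial>unif)"
    by (simp add: nn_integral_add nn_integral_sum nn_integral_cmult_indicator cong: measurable_cong_sets
      del: emeasure_uniform_measure)
  also have "\<dots> \<le> (\<Sum>k=1..?K. ennreal ((1 / real k ^ 3) * (real n / (real n - real k)) ^ k)) +
      ennreal (2 * real n / real ?K) * ennreal (100 / real n) +
      ennreal (18 * real n * (1 / 2) ^ ?K / (real n / 2))"
  proof (intro add_mono sum_mono)
    fix k assume k: "k \<in> {1..?K}"
    have "(\<integral>\<^sup>+q. ennreal (?f k q) \<partial>unif) = ennreal (c k * Beta k (k * (n - k)))"
      using k assms c by (intro nn_integral_unif_beta) auto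
    also have "\<dots> \<le> ennreal ((1 / real k ^ 3) * (real n / (real n - real k)) ^ k)"
      unfolding c_def using k assms by (intro ennreal_leI cluster_bound_integral_le) auto
    finally show "(\<integral>\<^sup>+q. ennreal (?f k q) \<partial>unif) \<le> ennreal ((1 / real k ^ 3) * (real n / (real n - real k)) ^ k)" .
  next
    have "emeasure unif {..<100 / real n} = ennreal (100 / real n)"
      using assms by (intro emeasure_unif_lessThan) auto
    then show "ennreal (2 * real n / real ?K) * emeasure unif {..<100 / real n} \<le>
        ennreal (2 * real n / real ?K) * ennreal (100 / real n)"
      by simp
  next
    show "(\<integral>\<^sup>+q. ennreal (18 * real n * (1 / 2) ^ ?K * exp (- (real n / 2) * q)) \<partial>unif) \<le>
        ennreal (18 * real n * (1 / 2) ^ ?K / (real n / 2))"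
      using n by (intro nn_integral_unif_exp_le) auto
  qed
  also have "\<dots> = ennreal ((\<Sum>k=1..split_size. (1 / real k ^ 3) * (real n / (real n - real k)) ^ k) +
      200 / real split_size + 36 * (1 / 2) ^ split_size)"
  proof -
    have "(\<Sum>k=1..?K. ennreal ((1 / real k ^ 3) * (real n / (real n - real k)) ^ k)) =
        ennreal (\<Sum>k=1..?K. (1 / real k ^ 3) * (real n / (real n - real k)) ^ k)"
      using assms by (intro sum_ennreal) auto
    moreover have "ennreal (2 * real n / real ?K) * ennreal (100 / real n) = ennreal (200 / real ?K)"
      using n by (simp flip: ennreal_mult)
    moreover have "18 * real n * (1 / 2) ^ ?K / (real n / 2) = 36 * (1 / 2) ^ ?K"
      using n by simp
    moreover have "0 \<le> (\<Sum>k=1..?K. (1 / real k ^ 3) * (real n / (real n - real k)) ^ k)"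
      using assms by (intro sum_nonneg) auto
    ultimately show ?thesis
      by (simp add: ennreal_plus)
  qed
  finally show ?thesis .
qed

text \<open>The limit of the integral would be \<open>\<zeta>(3) = 1.202\<dots>\<close> if \<open>split_size\<close> were sent to infinity;
  the theorem needs a bound below 5/4.\<close>

lemma eventually_excess_bound_integral:
  "eventually (\<lambda>n. (\<integral>\<^sup>+q. ennreal (excess_bound n q) \<partial>unif) \<le> ennreal (31 / 25)) sequentially"
proof -
  let ?K = split_size
  have "(\<lambda>n. (1 / real k ^ 3) * (real n / (real n - real k)) ^ k) \<longlonglongrightarrow> (1 / real k ^ 3) * 1 ^ k" for k
  proof (intro tendsto_intros)
    show "(\<lambda>n. real n / (real n - real k)) \<longlonglongrightarrow> 1"
      by real_asymp
  qed
  then have "(\<lambda>n. \<Sum>k=1..?K. (1 / real k ^ 3) * (real n / (real n - real k)) ^ k) \<longlonglongrightarrow> (\<Sum>k=1..?K. (1 / real k ^ 3) * 1 ^ k)"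
    by (rule tendsto_sum)
  \<comment> \<open>Here \<open>29/24 = 1.2083...\<close>, so the strict bound 1.215 survives the
    limit; the remaining terms stay below 0.024, and 1.239 is less than
    \<open>31/25\<close>.\<close>
  moreover have "(\<Sum>k=1..?K. (1 / real k ^ 3) * 1 ^ k) < 1215 / 1000"
    using sum_inverse_cubes_le[of ?K] by simp
  ultimately have "eventually (\<lambda>n. (\<Sum>k=1..?K. (1 / real k ^ 3) * (real n / (real n - real k)) ^ k) < 1215 / 1000) sequentially"
    by (rule order_tendstoD(2))
  moreover have "eventually (\<lambda>n. 200 \<le> n \<and> ?K < n) sequentially"
    using eventually_ge_at_top[of 200] eventually_gt_at_top[of ?K] by eventually_elim auto
  ultimately show ?thesis
  proof eventually_elim
    case (elim n)
    have "real ?K \<le> 2 ^ ?K"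
      by (simp add: of_nat_less_two_power less_imp_le)
    moreover have "0 < real ?K"
      by (simp add: split_size_def)
    ultimately have "(1 / 2) ^ ?K \<le> 1 / real ?K"
      unfolding power_one_over by (intro divide_left_mono) auto
    then have "200 / real ?K + 36 * (1 / 2) ^ ?K \<le> 236 / real ?K"
      by simp
    also have "\<dots> \<le> 24 / 1000"
      by (simp add: split_size_def)
    finally have le: "(\<Sum>k=1..?K. (1 / real k ^ 3) * (real n / (real n - real k)) ^ k) + 200 / real ?K + 36 * (1 / 2) ^ ?K \<le> 31 / 25"
      using elim(1) by simp
    have "(\<integral>\<^sup>+q. ennreal (excess_bound n q) \<partial>unif) \<le>
      ennreal ((\<Sum>k=1..?K. (1 / real k ^ 3) * (real n / (real n - real k)) ^ k) + 200 / real ?K + 36 * (1 / 2) ^ ?K)"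
      using elim(2) by (intro excess_bound_integral) auto
    also have "\<dots> \<le> ennreal (31 / 25)"
      using le by (rule ennreal_leI)
    finally show ?case .
  qed
qed

section \<open>Symmetry\<close>

text \<open>The map is a bijection of the whole type because \<open>joined\<close> is a relation on
  the whole type. The converse direction is the forward one applied to the inverse.\<close>

lemma joined_image:
  fixes \<pi> :: "'v \<Rightarrow> 'v"
  assumes "bij \<pi>"
  shows "(\<pi> x, \<pi> y) \<in> joined ((`) \<pi> ` F) \<longleftrightarrow> (x, y) \<in> joined F"
proof -
  have push: "(\<rho> x, \<rho> y) \<in> joined ((`) \<rho> ` F)" if "(x, y) \<in> joined F" for \<rho> :: "'v \<Rightarrow> 'v" and x y F
    using that unfolding joined_def
  proof (induction rule: rtrancl_induct)
    case (step y z)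
    then have "{\<rho> y, \<rho> z} \<in> (`) \<rho> ` F"
      by (auto intro!: image_eqI[of _ _ "{y, z}"])
    then show ?case
      using step.IH by (meson case_prodI mem_Collect_eq rtrancl.rtrancl_into_rtrancl)
  qed simp
  have inv: "inv \<pi> (\<pi> x) = x" for x
    using assms by (simp add: bij_is_inj)
  have "(`) (inv \<pi>) ` (`) \<pi> ` F = F"
    using assms by (simp add: image_comp comp_def image_inv_f_f bij_is_inj)
  then show ?thesis
    using push[of x y F \<pi>] push[of "\<pi> x" "\<pi> y" "(`) \<pi> ` F" "inv \<pi>"] by (auto simp: inv)
qed

lemma linked_image:
  fixes \<pi> :: "'v \<Rightarrow> 'v"
  assumes "bij \<pi>"
  shows "linked ((`) \<pi> ` F) (\<pi> ` e) \<longleftrightarrow> linked F e"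
proof
  assume "linked F e"
  then obtain u v where "e = {u, v}" "(u, v) \<in> joined F"
    by (auto simp: linked_def)
  then show "linked ((`) \<pi> ` F) (\<pi> ` e)"
    using joined_image[OF assms] by simp
next
  assume "linked ((`) \<pi> ` F) (\<pi> ` e)"
  then obtain u v where uv: "\<pi> ` e = {u, v}" "(u, v) \<in> joined ((`) \<pi> ` F)"
    by (auto simp: linked_def)
  obtain x y where xy: "u = \<pi> x" "v = \<pi> y"
    using assms by (metis bij_pointE)
  have "\<pi> ` e = \<pi> ` {x, y}"
    using uv(1) xy by simp
  then have "e = {x, y}"
    using assms by (metis inj_image_eq_iff bij_is_inj)
  then show "linked F e"
    using uv(2) joined_image[OF assms] by (simp add: xy)
qed

text \<open>Relabelling the vertices amounts to permuting the coordinates of the weights.\<close>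

lemma kruskal_image:
  fixes \<pi> :: "'v \<Rightarrow> 'v"
  assumes "bij \<pi>" "(`) \<pi> ` E = E" "e \<in> E"
  shows "\<pi> ` e \<in> kruskal W E \<longleftrightarrow> e \<in> kruskal (\<lambda>f\<in>E. W (\<pi> ` f)) E"
proof -
  have "\<pi> ` e \<in> E" using assms(2,3) by blast
  have "{g \<in> (`) \<pi> ` E. W g < W (\<pi> ` e)} = (`) \<pi> ` {g \<in> E. W (\<pi> ` g) < W (\<pi> ` e)}"
    by auto
  then have "{g \<in> E. W g < W (\<pi> ` e)} = (`) \<pi> ` {g \<in> E. W (\<pi> ` g) < W (\<pi> ` e)}"
    by (simp only: assms(2))
  moreover have "{g \<in> E. (\<lambda>f\<in>E. W (\<pi> ` f)) g < (\<lambda>f\<in>E. W (\<pi> ` f)) e} = {g \<in> E. W (\<pi> ` g) < W (\<pi> ` e)}"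
    using assms(3) by auto
  ultimately show ?thesis
    using \<open>\<pi> ` e \<in> E\<close> assms(3) linked_image[OF assms(1)] by (simp add: kruskal_def)
qed

lemma bij_image_nsets:
  fixes \<pi> :: "'v \<Rightarrow> 'v"
  assumes "bij \<pi>" "\<pi> ` V = V"
  shows "(`) \<pi> ` [V]\<^bsup>k\<^esup> = [V]\<^bsup>k\<^esup>"
proof -
  have "inj_on \<pi> V"
    using bij_is_inj[OF assms(1)] by (rule inj_on_subset) simp
  then have "bij_betw ((`) \<pi>) ([V]\<^bsup>k\<^esup>) ([V]\<^bsup>k\<^esup>)"
    using assms(2) by (intro bij_betw_nsets) (simp add: bij_betw_def)
  then show ?thesis by (simp add: bij_betw_def)
qed

lemma measurable_kruskal_pred:
  assumes "finite E"
  shows "{W \<in> space (iid E). P (kruskal W E)} \<in> sets (iid E)"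
proof -
  have "kruskal W E = {e \<in> E. \<not> linked {g \<in> E. (g, e) \<in> ranking E W} e}" for W
    by (rule kruskal_ranking) simp
  then have "Measurable.pred (iid E) (\<lambda>W. P (kruskal W E))"
    using measurable_ranking_below[OF assms, of "\<lambda>R B. P {e \<in> E. \<not> linked {g \<in> E. (g, e) \<in> R} e}" 0] by simp
  then show ?thesis by (simp add: pred_def)
qed

text \<open>The tree law expressed through \<open>kruskal\<close>, which is determined by
  comparisons for every weight function; the passage to \<open>MST\<close> is made at the
  end.\<close>

definition kprob :: "'v set \<Rightarrow> ('v set set \<Rightarrow> bool) \<Rightarrow> real" where
  "kprob V P = measure (iid ([V]\<^bsup>2\<^esup>)) {W \<in> space (iid ([V]\<^bsup>2\<^esup>)). P (kruskal W ([V]\<^bsup>2\<^esup>))}"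

lemma kprob_nonneg: "0 \<le> kprob V P"
  by (simp add: kprob_def)

text \<open>A vertex permutation permutes the edges, and the i.i.d. law of the weights is invariant
  under permuting its coordinates.\<close>

lemma kprob_permute:
  fixes \<pi> :: "'v \<Rightarrow> 'v"
  assumes "finite V" "bij \<pi>" "\<pi> ` V = V" "e \<in> [V]\<^bsup>2\<^esup>" "f \<in> [V]\<^bsup>2\<^esup>"
  shows "kprob V (\<lambda>T. \<pi> ` e \<in> T \<and> \<pi> ` f \<in> T) = kprob V (\<lambda>T. e \<in> T \<and> f \<in> T)"
proof -
  let ?E = "[V]\<^bsup>2\<^esup>"
  have fin: "finite ?E" using assms(1) by (rule finite_imp_finite_nsets)
  have im: "(`) \<pi> ` ?E = ?E" by (rule bij_image_nsets[OF assms(2,3)])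
  have inj: "inj_on ((`) \<pi>) ?E"
    using assms(2) by (meson inj_image_eq_iff bij_is_inj inj_onI)
  \<comment> \<open>The restriction to \<open>?E\<close> keeps the permuted weights in the product
    space, whose elements are extensional.\<close>
  define t where "t = (\<lambda>W :: 'v set \<Rightarrow> real. \<lambda>f\<in>?E. W (\<pi> ` f))"
  have distr: "distr (iid ?E) (iid ?E) t = iid ?E"
    unfolding t_def using distr_PiM_reindex[of ?E "\<lambda>_. unif" "(`) \<pi>" ?E] inj im prob_space_unif by auto
  have t: "t \<in> measurable (iid ?E) (iid ?E)"
    unfolding t_def using im by (intro measurable_restrict measurable_component_singleton) auto
  have "{W \<in> space (iid ?E). \<pi> ` e \<in> kruskal W ?E \<and> \<pi> ` f \<in> kruskal W ?E} =
      t -` {W \<in> space (iid ?E). e \<in> kruskal W ?E \<and> f \<in> kruskal W ?E} \<inter> space (iid ?E)"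
    using kruskal_image[OF assms(2) im assms(4)] kruskal_image[OF assms(2) im assms(5)] measurable_space[OF t]
    unfolding t_def by auto
  also have "measure (iid ?E) \<dots> = measure (distr (iid ?E) (iid ?E) t) {W \<in> space (iid ?E). e \<in> kruskal W ?E \<and> f \<in> kruskal W ?E}"
    using t measurable_kruskal_pred[OF fin, of "\<lambda>T. e \<in> T \<and> f \<in> T"] by (simp add: measure_distr)
  finally show ?thesis
    by (simp add: kprob_def distr)
qed

lemma bij_extend_finite:
  assumes "finite V" "A \<subseteq> V" "inj_on g A" "g ` A \<subseteq> V"
  obtains \<pi> where "bij \<pi>" "\<pi> ` V = V" "\<And>a. a \<in> A \<Longrightarrow> \<pi> a = g a"
proof -
  have "finite A" using assms finite_subset by blast
  have "card (V - A) = card (V - g ` A)"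
    using assms \<open>finite A\<close> by (simp add: card_Diff_subset card_image)
  then obtain h where h: "bij_betw h (V - A) (V - g ` A)"
    using assms(1) by (meson finite_Diff finite_same_card_bij)
  define \<pi> where "\<pi> x = (if x \<in> A then g x else if x \<in> V then h x else x)" for x
  have "bij_betw \<pi> A (g ` A)"
    using assms(3) by (subst bij_betw_cong[of A \<pi> g]) (auto simp: \<pi>_def bij_betw_def)
  moreover have "bij_betw \<pi> (V - A) (V - g ` A)"
    using h by (subst bij_betw_cong[of "V - A" \<pi> h]) (auto simp: \<pi>_def)
  ultimately have "bij_betw \<pi> (A \<union> (V - A)) (g ` A \<union> (V - g ` A))"
    by (rule bij_betw_combine) auto
  then have V: "bij_betw \<pi> V V"
    using assms(2,4) by (simp add: Un_absorb1)
  moreover have "bij_betw \<pi> (- V) (- V)"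
    using assms(2) by (subst bij_betw_cong[of "- V" \<pi> id]) (auto simp: \<pi>_def)
  ultimately have "bij_betw \<pi> (V \<union> - V) (V \<union> - V)"
    by (rule bij_betw_combine) auto
  then show ?thesis
    using V by (intro that[of \<pi>]) (auto simp: \<pi>_def bij_betw_def)
qed

text \<open>Since the pairs are disjoint, bijections of \<open>e\<close> onto \<open>e'\<close> and
  of \<open>f\<close> onto \<open>f'\<close> glue to an injection, which extends to a permutation of
  \<open>V\<close>.\<close>

lemma kprob_pair_symmetric:
  assumes "finite V" "e \<in> [V]\<^bsup>2\<^esup>" "f \<in> [V]\<^bsup>2\<^esup>" "e' \<in> [V]\<^bsup>2\<^esup>" "f' \<in> [V]\<^bsup>2\<^esup>"
    "e \<inter> f = {}" "e' \<inter> f' = {}"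
  shows "kprob V (\<lambda>T. e' \<in> T \<and> f' \<in> T) = kprob V (\<lambda>T. e \<in> T \<and> f \<in> T)"
proof -
  have fin: "finite e" "finite f" "finite e'" "finite f'" "e \<subseteq> V" "f \<subseteq> V" "e' \<subseteq> V" "f' \<subseteq> V"
    and card: "card e = card e'" "card f = card f'"
    using assms(2-5) by (auto simp: nsets_def)
  obtain g h where g: "bij_betw g e e'" and h: "bij_betw h f f'"
    using fin card by (meson finite_same_card_bij)
  let ?k = "\<lambda>x. if x \<in> e then g x else h x"
  have ke: "?k ` e = e'" using g by (auto simp: bij_betw_def)
  have kf: "?k ` f = f'"
  proof -
    have "?k ` f = h ` f" using assms(6) by (intro image_cong) auto
    then show ?thesis using h by (simp add: bij_betw_def)
  qed
  have "inj_on ?k (e \<union> f)"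
  proof -
    have "inj_on ?k e" using g by (auto simp: bij_betw_def inj_on_def)
    moreover have "inj_on ?k f" using h assms(6) by (auto simp: bij_betw_def inj_on_def)
    ultimately show ?thesis
      using ke kf assms(7) by (subst inj_on_Un) blast
  qed
  moreover have "?k ` (e \<union> f) \<subseteq> V"
    unfolding image_Un ke kf using fin by blast
  ultimately obtain \<pi> where \<pi>: "bij \<pi>" "\<pi> ` V = V" "\<And>a. a \<in> e \<union> f \<Longrightarrow> \<pi> a = ?k a"
    using bij_extend_finite[OF assms(1), of "e \<union> f" ?k] fin by blast
  have "\<pi> ` e = ?k ` e" "\<pi> ` f = ?k ` f"
    using \<pi>(3) by (intro image_cong; simp)+
  then have "\<pi> ` e = e'" "\<pi> ` f = f'"
    by (simp_all only: ke kf)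
  then show ?thesis
    using kprob_permute[OF assms(1) \<pi>(1,2) assms(2,3)] by simp
qed

lemma kprob_edge_symmetric:
  assumes "finite V" "e \<in> [V]\<^bsup>2\<^esup>" "e' \<in> [V]\<^bsup>2\<^esup>"
  shows "kprob V (\<lambda>T. e' \<in> T) = kprob V (\<lambda>T. e \<in> T)"
proof -
  have fin: "finite e" "finite e'" "e \<subseteq> V" "e' \<subseteq> V" and card: "card e = card e'"
    using assms(2,3) by (auto simp: nsets_def)
  obtain g where g: "bij_betw g e e'"
    using fin card by (meson finite_same_card_bij)
  then obtain \<pi> where \<pi>: "bij \<pi>" "\<pi> ` V = V" "\<And>a. a \<in> e \<Longrightarrow> \<pi> a = g a"
    using bij_extend_finite[OF assms(1), of e g] fin by (auto simp: bij_betw_def)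
  have "\<pi> ` e = g ` e"
    using \<pi>(3) by (intro image_cong) auto
  then have "\<pi> ` e = e'"
    using g by (simp add: bij_betw_def)
  then show ?thesis
    using kprob_permute[OF assms(1) \<pi>(1,2) assms(2,2)] by simp
qed

lemma sum_kprob:
  assumes "finite V" "finite I"
  shows "ennreal (\<Sum>i\<in>I. kprob V (P i)) =
    (\<integral>\<^sup>+W. ennreal (real (card {i \<in> I. P i (kruskal W ([V]\<^bsup>2\<^esup>))})) \<partial>iid ([V]\<^bsup>2\<^esup>))"
proof -
  let ?E = "[V]\<^bsup>2\<^esup>"
  have fin: "finite ?E" using assms(1) by (rule finite_imp_finite_nsets)
  interpret prob_space "iid ?E" by (rule prob_space_iid)
  let ?X = "\<lambda>i. {W \<in> space (iid ?E). P i (kruskal W ?E)}"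
  have X: "?X i \<in> sets (iid ?E)" for i
    by (rule measurable_kruskal_pred[OF fin])
  have "ennreal (\<Sum>i\<in>I. kprob V (P i)) = (\<Sum>i\<in>I. emeasure (iid ?E) (?X i))"
    unfolding kprob_def by (simp add: emeasure_eq_measure sum_ennreal)
  also have "\<dots> = (\<integral>\<^sup>+W. (\<Sum>i\<in>I. indicator (?X i) W) \<partial>iid ?E)"
    using X by (simp add: nn_integral_sum)
  also have "\<dots> = (\<integral>\<^sup>+W. ennreal (real (card {i \<in> I. P i (kruskal W ?E)})) \<partial>iid ?E)"
  proof (rule nn_integral_cong)
    fix W assume W: "W \<in> space (iid ?E)"
    have "(\<Sum>i\<in>I. indicator (?X i) W :: ennreal) = (\<Sum>i\<in>I. if P i (kruskal W ?E) then 1 else 0)"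
      using W by (intro sum.cong) (auto simp: indicator_def)
    also have "\<dots> = of_nat (card {i \<in> I. P i (kruskal W ?E)})"
      using assms(2) by (simp add: sum.If_cases Int_def)
    finally show "(\<Sum>i\<in>I. indicator (?X i) W :: ennreal) = ennreal (real (card {i \<in> I. P i (kruskal W ?E)}))"
      by (simp add: ennreal_of_nat_eq_real_of_nat)
  qed
  finally show ?thesis .
qed

section \<open>Disjoint pairs of tree edges\<close>

lemma real_card_nsets_2:
  assumes "finite V"
  shows "real (card ([V]\<^bsup>2\<^esup>)) = real (card V) * (real (card V) - 1) / 2"
proof -
  have "card ([V]\<^bsup>2\<^esup>) = card V choose 2"
    using n_subsets[OF assms, of 2] assms by (simp add: nsets_def finite_subset cong: conj_cong)
  moreover have "even (card V * (card V - 1))"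
    by (cases "card V") auto
  ultimately have "2 * card ([V]\<^bsup>2\<^esup>) = card V * (card V - 1)"
    by (simp add: choose_two)
  then have "2 * real (card ([V]\<^bsup>2\<^esup>)) = real (card V) * real (card V - 1)"
    by (metis of_nat_mult of_nat_numeral)
  then show ?thesis
    by (cases "card V = 0") (auto simp: of_nat_diff Suc_leI)
qed

text \<open>The pairs are ordered, to match the square of the number of tree edges in
  \<open>card_pairs_split\<close>.\<close>

definition disjoint_pairs :: "'v set \<Rightarrow> ('v set \<times> 'v set) set" where
  "disjoint_pairs V = {(e, f) \<in> [V]\<^bsup>2\<^esup> \<times> [V]\<^bsup>2\<^esup>. e \<inter> f = {}}"

lemma card_disjoint_pairs:
  assumes "finite V" "2 \<le> card V"
  shows "real (card (disjoint_pairs V)) =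
    real (card V) * (real (card V) - 1) / 2 * ((real (card V) - 2) * (real (card V) - 3) / 2)"
proof -
  have "disjoint_pairs V = (SIGMA e:[V]\<^bsup>2\<^esup>. [V - e]\<^bsup>2\<^esup>)"
    by (auto simp: disjoint_pairs_def nsets_def)
  then have "real (card (disjoint_pairs V)) = (\<Sum>e\<in>[V]\<^bsup>2\<^esup>. real (card ([V - e]\<^bsup>2\<^esup>)))"
    using assms(1) by (simp add: card_SigmaI finite_imp_finite_nsets)
  also have "\<dots> = (\<Sum>e\<in>[V]\<^bsup>2\<^esup>. (real (card V) - 2) * (real (card V) - 3) / 2)"
  proof (rule sum.cong[OF refl])
    fix e assume "e \<in> [V]\<^bsup>2\<^esup>"
    then have "real (card (V - e)) = real (card V) - 2"
      using assms by (auto simp: nsets_def card_Diff_subset of_nat_diff)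
    then show "real (card ([V - e]\<^bsup>2\<^esup>)) = (real (card V) - 2) * (real (card V) - 3) / 2"
      using real_card_nsets_2[of "V - e"] assms(1) by simp
  qed
  also have "\<dots> = real (card ([V]\<^bsup>2\<^esup>)) * ((real (card V) - 2) * (real (card V) - 3) / 2)"
    by simp
  finally show ?thesis
    unfolding real_card_nsets_2[OF assms(1)] .
qed

text \<open>The square \<open>K \<times> K\<close> consists of the diagonal, the disjoint pairs and
  the adjacent pairs. The last are counted at their heavier edge and doubled for the order. As
  \<open>{}\<close> is not in \<open>K\<close>, no diagonal pair is disjoint.\<close>

lemma card_pairs_split:
  fixes W :: "'v set \<Rightarrow> real"
  assumes "finite K" "inj_on W K" "{} \<notin> K"
  shows "card K * card K = card K + card {(e, f) \<in> K \<times> K. e \<inter> f = {}} +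
    2 * (\<Sum>f\<in>K. card {e \<in> K. W e < W f \<and> e \<inter> f \<noteq> {}})"
proof -
  let ?D = "(\<lambda>e. (e, e)) ` K" and ?N = "{(e, f) \<in> K \<times> K. e \<inter> f = {}}"
  let ?L = "{(e, f) \<in> K \<times> K. W e < W f \<and> e \<inter> f \<noteq> {}}"
  let ?G = "{(e, f) \<in> K \<times> K. W f < W e \<and> e \<inter> f \<noteq> {}}"
  have fin: "finite ?D" "finite ?N" "finite ?L" "finite ?G"
    using assms(1) by (auto intro: finite_subset[of _ "K \<times> K"])
  have split: "K \<times> K = (?D \<union> ?N) \<union> (?L \<union> ?G)"
  proof (intro equalityI subsetI)
    fix p assume "p \<in> K \<times> K"
    then obtain e f where p: "p = (e, f)" "e \<in> K" "f \<in> K" by blast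
    consider "e = f" | "e \<inter> f = {}" | "e \<inter> f \<noteq> {}" "W e < W f" | "e \<inter> f \<noteq> {}" "W f < W e"
      using inj_onD[OF assms(2) _ p(2,3)] by (cases "W e" "W f" rule: linorder_cases) blast+
    then show "p \<in> (?D \<union> ?N) \<union> (?L \<union> ?G)"
      using p by cases auto
  qed auto
  have disj: "(?D \<union> ?N) \<inter> (?L \<union> ?G) = {}" "?D \<inter> ?N = {}" "?L \<inter> ?G = {}"
    using assms(3) by auto
  have "card (K \<times> K) = card ((?D \<union> ?N) \<union> (?L \<union> ?G))"
    by (rule arg_cong[OF split])
  also have "\<dots> = card (?D \<union> ?N) + card (?L \<union> ?G)"
    using fin disj by (intro card_Un_disjoint) auto
  also have "card (?D \<union> ?N) = card ?D + card ?N"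
    using fin disj by (intro card_Un_disjoint) auto
  also have "card (?L \<union> ?G) = card ?L + card ?G"
    using fin disj by (intro card_Un_disjoint) auto
  finally have "card (K \<times> K) = card ?D + card ?N + (card ?L + card ?G)" .
  moreover have "card ?D = card K"
    by (intro card_image) (auto simp: inj_on_def)
  moreover have "card ?L = (\<Sum>f\<in>K. card {e \<in> K. W e < W f \<and> e \<inter> f \<noteq> {}})"
  proof -
    have "?L = prod.swap ` (SIGMA f:K. {e \<in> K. W e < W f \<and> e \<inter> f \<noteq> {}})"
      by (auto simp: image_iff)
    then have "card ?L = card (SIGMA f:K. {e \<in> K. W e < W f \<and> e \<inter> f \<noteq> {}})"
      by (simp add: card_image)
    then show ?thesis
      using assms(1) by simp
  qed
  moreover have "card ?G = card ?L"
  proof -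
    have "?G = prod.swap ` ?L" by (auto simp: image_iff)
    then show ?thesis by (simp add: card_image)
  qed
  ultimately show ?thesis
    by (simp add: card_cartesian_product)
qed

text \<open>All \<open>n (n - 1) / 2\<close> edges are equally likely by symmetry, and the tree
  almost surely has \<open>n - 1\<close> edges.\<close>

lemma kprob_edge:
  assumes "finite V" "2 \<le> card V" "e \<in> [V]\<^bsup>2\<^esup>"
  shows "kprob V (\<lambda>T. e \<in> T) = 2 / real (card V)"
proof -
  let ?E = "[V]\<^bsup>2\<^esup>"
  have fin: "finite ?E" using assms(1) by (rule finite_imp_finite_nsets)
  have V: "V \<noteq> {}" using assms(2) by auto
  have "ennreal (\<Sum>f\<in>?E. kprob V (\<lambda>T. f \<in> T)) =
      (\<integral>\<^sup>+W. ennreal (real (card {f \<in> ?E. f \<in> kruskal W ?E})) \<partial>iid ?E)"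
    by (rule sum_kprob[OF assms(1) fin])
  also have "\<dots> = (\<integral>\<^sup>+W. ennreal (real (card V) - 1) \<partial>iid ?E)"
  proof (rule nn_integral_cong_AE)
    show "AE W in iid ?E. ennreal (real (card {f \<in> ?E. f \<in> kruskal W ?E})) = ennreal (real (card V) - 1)"
      using AE_iid_generic[OF fin]
    proof eventually_elim
      case (elim W)
      have "{f \<in> ?E. f \<in> kruskal W ?E} = kruskal W ?E" by (auto simp: kruskal_def)
      moreover have "card (kruskal W ?E) + 1 = card V"
        using card_kruskal[of V ?E W] card_clusters_connected[OF connected_complete[OF V]] assms(1) elim by auto
      then have "real (card (kruskal W ?E)) = real (card V) - 1" by linarith
      ultimately show ?case by simp
    qed
  qed
  also have "\<dots> = ennreal (real (card V) - 1)"
    using prob_space.emeasure_space_1[OF prob_space_iid, of ?E] by simp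
  finally have "(\<Sum>f\<in>?E. kprob V (\<lambda>T. f \<in> T)) = real (card V) - 1"
    using assms(2) by (subst (asm) ennreal_inj) (auto intro: sum_nonneg kprob_nonneg)
  moreover have "(\<Sum>f\<in>?E. kprob V (\<lambda>T. f \<in> T)) = (\<Sum>f\<in>?E. kprob V (\<lambda>T. e \<in> T))"
    using kprob_edge_symmetric[OF assms(1,3)] by (intro sum.cong) auto
  moreover have "\<dots> = real (card ?E) * kprob V (\<lambda>T. e \<in> T)"
    by (rule sum_constant)
  ultimately have "real (card V) * (real (card V) - 1) / 2 * kprob V (\<lambda>T. e \<in> T) = real (card V) - 1"
    unfolding real_card_nsets_2[OF assms(1)] by simp
  moreover have "(x - 1) * (x * p - 2) = 2 * (x * (x - 1) / 2 * p - (x - 1))" for x p :: real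
    by (simp add: field_simps)
  ultimately have "(real (card V) - 1) * (real (card V) * kprob V (\<lambda>T. e \<in> T) - 2) = 0"
    by simp
  then have "real (card V) * kprob V (\<lambda>T. e \<in> T) = 2"
    using assms(2) by simp
  then show ?thesis
    using assms(2) by (simp add: field_simps)
qed

text \<open>Every disjoint pair has the same probability, so bounding the expected number
  \<open>?S\<close> of ordered disjoint pairs of tree edges suffices. By
  \<open>card_pairs_split\<close> with \<open>n - 1\<close> edges,
  \<open>?S + 2 * A = (n - 1) * (n - 2)\<close>, and \<open>adjacent_pairs_lower_bound\<close>
  bounds \<open>A\<close> from below.\<close>

lemma kprob_disjoint_edges:
  assumes V: "finite V" "200 \<le> card V" and ef: "e \<in> [V]\<^bsup>2\<^esup>" "f \<in> [V]\<^bsup>2\<^esup>" "e \<inter> f = {}"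
    and excess: "(\<integral>\<^sup>+q. ennreal (excess_bound (card V) q) \<partial>unif) \<le> ennreal (31 / 25)"
  shows "kprob V (\<lambda>T. e \<in> T \<and> f \<in> T) \<le> (2 / real (card V)) * (2 / real (card V))"
proof -
  let ?E = "[V]\<^bsup>2\<^esup>"
  let ?p = "kprob V (\<lambda>T. e \<in> T \<and> f \<in> T)"
  define n where "n = real (card V)"
  have n: "200 \<le> n" using V(2) by (simp add: n_def)
  have V0: "V \<noteq> {}" using V(2) by auto
  have fin: "finite ?E" using V(1) by (rule finite_imp_finite_nsets)
  have finD: "finite (disjoint_pairs V)"
    using fin by (auto simp: disjoint_pairs_def intro: finite_subset[of _ "?E \<times> ?E"])
  define A where "A = (\<integral>\<^sup>+W. (\<Sum>f\<in>kruskal W ?E.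
      ennreal (real (card {e \<in> kruskal W ?E. W e < W f \<and> e \<inter> f \<noteq> {}}))) \<partial>iid ?E)"
  let ?S = "\<Sum>p\<in>disjoint_pairs V. kprob V (\<lambda>T. fst p \<in> T \<and> snd p \<in> T)"
  have "ennreal (4 * (n - 1)) \<le> A + ennreal (2 * n) * (\<integral>\<^sup>+q. ennreal (excess_bound (card V) q) \<partial>unif)"
    unfolding A_def n_def
  proof (rule adjacent_pairs_lower_bound[OF V(1) V0])
    show "(\<lambda>q. ennreal (excess_bound (card V) q)) \<in> borel_measurable borel"
      unfolding excess_bound_def cluster_bound_def by measurable
  qed (rule excess_bound[OF V])
  also have "\<dots> \<le> A + ennreal (2 * n) * ennreal (31 / 25)"
    by (intro add_left_mono mult_left_mono excess) simp
  finally have lower: "ennreal (4 * (n - 1)) \<le> A + ennreal (2 * n * (31 / 25))"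
    using n by (simp flip: ennreal_mult)
  define X where "X W = real (card {p \<in> disjoint_pairs V. fst p \<in> kruskal W ?E \<and> snd p \<in> kruskal W ?E})" for W
  define Y where "Y W = (\<Sum>f\<in>kruskal W ?E. real (card {e \<in> kruskal W ?E. W e < W f \<and> e \<inter> f \<noteq> {}}))" for W
  have krus: "kruskal W ?E = {e \<in> ?E. \<not> linked {g \<in> ?E. (g, e) \<in> ranking ?E W} e}" for W
    by (rule kruskal_ranking) simp
  \<comment> \<open>The weights are eliminated in favour of \<open>ranking\<close>, from which
    measurability follows.\<close>
  have Y_eq: "Y W = (\<lambda>R K. \<Sum>f\<in>K. real (card {e \<in> K. (e, f) \<in> R \<and> e \<inter> f \<noteq> {}})) (ranking ?E W) (kruskal W ?E)" for W
    unfolding Y_def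
    by (intro sum.cong refl arg_cong[of _ _ real] arg_cong[of _ _ card]) (auto simp: ranking_def kruskal_def)
  have meas_Y: "(\<lambda>W. ennreal (Y W)) \<in> borel_measurable (iid ?E)"
    unfolding Y_eq krus
    using measurable_ranking_below'[OF fin, of "\<lambda>R B. ennreal ((\<lambda>R K. \<Sum>f\<in>K. real (card {e \<in> K. (e, f) \<in> R \<and> e \<inter> f \<noteq> {}}))
      R {e \<in> ?E. \<not> linked {g \<in> ?E. (g, e) \<in> R} e})" 0] by simp
  have meas_X: "(\<lambda>W. ennreal (X W)) \<in> borel_measurable (iid ?E)"
    unfolding X_def krus
    using measurable_ranking_below'[OF fin, of "\<lambda>R B. ennreal ((\<lambda>K. real (card {p \<in> disjoint_pairs V. fst p \<in> K \<and> snd p \<in> K}))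
      {e \<in> ?E. \<not> linked {g \<in> ?E. (g, e) \<in> R} e})" 0] by simp
  have A_Y: "A = (\<integral>\<^sup>+W. ennreal (Y W) \<partial>iid ?E)"
    unfolding A_def Y_def by (simp add: sum_ennreal)
  have "ennreal ((n - 1) * (n - 2)) = (\<integral>\<^sup>+W. ennreal ((n - 1) * (n - 2)) \<partial>iid ?E)"
    using prob_space.emeasure_space_1[OF prob_space_iid, of ?E] by simp
  also have "\<dots> = (\<integral>\<^sup>+W. ennreal (X W) + 2 * ennreal (Y W) \<partial>iid ?E)"
  proof (rule nn_integral_cong_AE)
    show "AE W in iid ?E. ennreal ((n - 1) * (n - 2)) = ennreal (X W) + 2 * ennreal (Y W)"
      using AE_iid_generic[OF fin]
    proof eventually_elim
      case (elim W)
      let ?K = "kruskal W ?E"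
      have KE: "?K \<subseteq> ?E" by (auto simp: kruskal_def)
      have "card ?K + 1 = card V"
        using card_kruskal[of V ?E W] card_clusters_connected[OF connected_complete[OF V0]] V(1) elim by auto
      then have K: "real (card ?K) = n - 1" by (simp add: n_def)
      have "{} \<notin> ?K" using KE by (auto simp: nsets_def)
      then have "card ?K * card ?K = card ?K + card {(e, f) \<in> ?K \<times> ?K. e \<inter> f = {}} +
          2 * (\<Sum>f\<in>?K. card {e \<in> ?K. W e < W f \<and> e \<inter> f \<noteq> {}})"
        using KE fin finite_subset elim inj_on_subset by (intro card_pairs_split) blast+
      moreover have "{(e, f) \<in> ?K \<times> ?K. e \<inter> f = {}} = {p \<in> disjoint_pairs V. fst p \<in> ?K \<and> snd p \<in> ?K}"
        using KE by (auto simp: disjoint_pairs_def)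
      ultimately have "real (card ?K) * real (card ?K) = real (card ?K) + X W + 2 * Y W"
        unfolding X_def Y_def by (simp flip: of_nat_mult of_nat_add of_nat_sum)
      then have "(n - 1) * (n - 2) = X W + 2 * Y W"
        unfolding K by (simp add: algebra_simps)
      moreover have "0 \<le> X W" "0 \<le> Y W"
        by (auto simp: X_def Y_def intro: sum_nonneg)
      ultimately show ?case
        by (simp add: ennreal_plus ennreal_mult)
    qed
  qed
  also have "\<dots> = (\<integral>\<^sup>+W. ennreal (X W) \<partial>iid ?E) + 2 * A"
    using meas_X meas_Y by (simp add: nn_integral_add nn_integral_cmult A_Y)
  also have "(\<integral>\<^sup>+W. ennreal (X W) \<partial>iid ?E) = ennreal ?S"
    unfolding X_def by (rule sum_kprob[OF V(1) finD, symmetric])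
  finally have total: "ennreal ((n - 1) * (n - 2)) = ennreal ?S + 2 * A" .
  \<comment> \<open>Finiteness is needed before subtracting in the reals; it holds since
    \<open>2 * A\<close> is part of a finite total.\<close>
  have "A \<noteq> \<infinity>"
    using total by (auto simp: ennreal_mult_eq_top_iff)
  then obtain a where a: "A = ennreal a" "0 \<le> a"
    by (cases A) auto
  have S0: "0 \<le> ?S" by (intro sum_nonneg kprob_nonneg)
  have "ennreal ((n - 1) * (n - 2)) = ennreal (?S + 2 * a)"
    using total S0 a by (simp add: ennreal_plus ennreal_mult)
  then have total': "(n - 1) * (n - 2) = ?S + 2 * a"
    using n S0 a by (subst (asm) ennreal_inj) auto
  have "4 * (n - 1) \<le> a + 2 * n * (31 / 25)"
    using lower a n by (simp flip: ennreal_plus)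
  then have S_le: "?S \<le> (n - 1) * (n - 2) - 8 * (n - 1) + 4 * n * (31 / 25)"
    using total' by simp
  have "?S = (\<Sum>p\<in>disjoint_pairs V. ?p)"
    using kprob_pair_symmetric[OF V(1) ef(1,2) _ _ ef(3)]
    by (intro sum.cong) (auto simp: disjoint_pairs_def)
  then have "?S = n * (n - 1) / 2 * ((n - 2) * (n - 3) / 2) * ?p"
    using card_disjoint_pairs[OF V(1)] V(2) by (simp add: n_def)
  then have "(n * (n - 1) * (n - 2) * (n - 3)) * ?p = 4 * ?S"
    by simp
  then have "(n * (n - 1) * (n - 2) * (n - 3)) * ?p \<le> 4 * ((n - 1) * (n - 2) - 8 * (n - 1) + 4 * n * (31 / 25))"
    using S_le by (simp only:) (rule mult_left_mono, auto)
  also have "\<dots> \<le> (n * (n - 1) * (n - 2) * (n - 3)) * (4 / n ^ 2)"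
  proof -
    \<comment> \<open>The coefficient is \<open>151/25 = 11 - 4 * (31/25)\<close>. It exceeds the 6
      in \<open>(n - 1) (n - 2) (n - 3) / n\<close> by \<open>1/25\<close>, and this surplus is the
      term \<open>n * n / 25\<close> below.\<close>
    have eq: "(n - 1) * (n - 2) - 8 * (n - 1) + 4 * n * (31 / 25) = n * n - 151 / 25 * n + 10"
      by (simp add: algebra_simps)
    have "(n * n - 151 / 25 * n + 10) * n \<le> (n - 1) * (n - 2) * (n - 3)"
    proof -
      have "(n - 1) * (n - 2) * (n - 3) - (n * n - 151 / 25 * n + 10) * n = n * n / 25 + n - 6"
        by (simp add: algebra_simps)
      moreover have "0 \<le> n * n / 25" by simp
      ultimately show ?thesis using n by linarith
    qed
    then have "((n - 1) * (n - 2) - 8 * (n - 1) + 4 * n * (31 / 25)) * n \<le> (n - 1) * (n - 2) * (n - 3)"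
      unfolding eq .
    then have "(n - 1) * (n - 2) - 8 * (n - 1) + 4 * n * (31 / 25) \<le> (n - 1) * (n - 2) * (n - 3) / n"
      using n by (simp add: pos_le_divide_eq)
    moreover have "(n * (n - 1) * (n - 2) * (n - 3)) * (4 / n ^ 2) = 4 * ((n - 1) * (n - 2) * (n - 3) / n)"
      using n by (simp add: power2_eq_square)
    ultimately show ?thesis by simp
  qed
  finally have "?p \<le> 4 / n ^ 2"
    using n by (subst (asm) mult_le_cancel_left_pos) (auto intro!: mult_pos_pos)
  then show ?thesis
    by (simp add: n_def power2_eq_square)
qed

text \<open>Almost surely the weights are distinct and positive, and then \<open>MST\<close> is the
  Kruskal tree. The hypothesis on \<open>P\<close> and \<open>Q\<close> lets the event inspect
  \<open>\<omega>\<close> only at edges in \<open>S\<close>, because \<open>config_of\<close> agrees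
  with the indicator of the tree only on edges of the graph.\<close>

lemma prob_MST_law_complete_graph:
  assumes "0 < n" and P: "\<And>\<omega> T. (\<forall>e\<in>S. \<omega> e = 1 \<longleftrightarrow> e \<in> T) \<Longrightarrow> P \<omega> \<longleftrightarrow> Q T"
    and S: "S \<subseteq> [{..<n}]\<^bsup>2\<^esup>"
  shows "\<P>(\<omega> in MST_law (complete_graph n). P \<omega>) = kprob {..<n} Q"
proof -
  let ?G = "complete_graph n" and ?E = "[{..<n}]\<^bsup>2\<^esup>"
  have G: "?G = ({..<n}, ?E)" "snd ?G = ?E"
    by (simp_all add: complete_graph_def)
  have fin: "finite ?E" by (simp add: finite_imp_finite_nsets)
  have W: "weights ?G = iid ?E"
    by (simp add: weights_def G)
  have meas: "(\<lambda>W. config_of ?G (MST ?G W)) \<in> measurable (iid ?E) (count_space (configs ?G))"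
    using measurable_MST[of ?G] fin unfolding W G(2) by simp
  have A: "{\<omega> \<in> space (MST_law ?G). P \<omega>} = {\<omega> \<in> configs ?G. P \<omega>}"
    by (simp add: MST_law_def)
  have "\<P>(\<omega> in MST_law ?G. P \<omega>) =
      measure (iid ?E) ((\<lambda>W. config_of ?G (MST ?G W)) -` {\<omega> \<in> configs ?G. P \<omega>} \<inter> space (iid ?E))"
    unfolding A unfolding MST_law_def W using meas by (intro measure_distr) auto
  also have "\<dots> = measure (iid ?E) {W \<in> space (iid ?E). Q (kruskal W ?E)}"
  proof (rule measure_eq_AE)
    show "AE W in iid ?E. W \<in> (\<lambda>W. config_of ?G (MST ?G W)) -` {\<omega> \<in> configs ?G. P \<omega>} \<inter> space (iid ?E) \<longleftrightarrow>
        W \<in> {W \<in> space (iid ?E). Q (kruskal W ?E)}"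
      using AE_iid_generic[OF fin] AE_space
    proof eventually_elim
      case (elim W)
      have conn: "connected_graph ({..<n}, ?E)"
        using assms(1) by (intro connected_complete) auto
      have "MST ?G W = kruskal W ?E"
        unfolding G using elim(1) by (intro MST_eq_kruskal conn) auto
      moreover have "P (config_of ?G T) \<longleftrightarrow> Q T" for T
        using S by (intro P) (auto simp: config_of_def G indicator_def)
      moreover have "config_of ?G (MST ?G W) \<in> configs ?G"
        using measurable_space[OF meas elim(2)] by simp
      ultimately show ?case
        using elim(2) by simp
    qed
    show "(\<lambda>W. config_of ?G (MST ?G W)) -` {\<omega> \<in> configs ?G. P \<omega>} \<inter> space (iid ?E) \<in> sets (iid ?E)"
      by (rule measurable_sets[OF meas]) auto
    show "{W \<in> space (iid ?E). Q (kruskal W ?E)} \<in> sets (iid ?E)"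
      by (rule measurable_kruskal_pred[OF fin])
  qed
  finally show ?thesis
    by (simp add: kprob_def)
qed

theorem theorem1p1:
  shows "\<exists>C::real. C > 0 \<and> (\<forall>n::nat. real n \<ge> C \<longrightarrow>
    (\<forall>e \<in> snd (complete_graph n). \<forall>f \<in> snd (complete_graph n). e \<inter> f = {} \<longrightarrow>
      \<P>(\<omega> in MST_law (complete_graph n). \<omega> e = 1 \<and> \<omega> f = 1)
        \<le> \<P>(\<omega> in MST_law (complete_graph n). \<omega> e = 1) *
          \<P>(\<omega> in MST_law (complete_graph n). \<omega> f = 1)))"
proof -
  obtain N where N: "\<And>n. N \<le> n \<Longrightarrow> (\<integral>\<^sup>+q. ennreal (excess_bound n q) \<partial>unif) \<le> ennreal (31 / 25)"
    using eventually_excess_bound_integral unfolding eventually_sequentially by blast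
  show ?thesis
  \<comment> \<open>\<open>N\<close> makes the integral bound available, and 200 is the size
    required by \<open>kprob_disjoint_edges\<close>.\<close>
  proof (intro exI[of _ "real (max N 200)"] conjI allI impI ballI)
    show "0 < real (max N 200)" by simp
  next
    fix n :: nat and e f
    assume "real (max N 200) \<le> real n" and "e \<in> snd (complete_graph n)" "f \<in> snd (complete_graph n)" "e \<inter> f = {}"
    then have n: "N \<le> n" "200 \<le> n" and ef: "e \<in> [{..<n}]\<^bsup>2\<^esup>" "f \<in> [{..<n}]\<^bsup>2\<^esup>" "e \<inter> f = {}"
      by (auto simp: complete_graph_def)
    have single: "\<P>(\<omega> in MST_law (complete_graph n). \<omega> g = 1) = 2 / real n" if "g \<in> [{..<n}]\<^bsup>2\<^esup>" for g
      using prob_MST_law_complete_graph[of n "{g}" "\<lambda>\<omega>. \<omega> g = 1" "\<lambda>T. g \<in> T"]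
        kprob_edge[of "{..<n}" g] that n by simp
    have "\<P>(\<omega> in MST_law (complete_graph n). \<omega> e = 1 \<and> \<omega> f = 1) = kprob {..<n} (\<lambda>T. e \<in> T \<and> f \<in> T)"
      using n ef by (intro prob_MST_law_complete_graph[of n "{e, f}"]) auto
    also have "\<dots> \<le> (2 / real n) * (2 / real n)"
      using kprob_disjoint_edges[of "{..<n}" e f] n ef N[OF n(1)] by simp
    finally show "\<P>(\<omega> in MST_law (complete_graph n). \<omega> e = 1 \<and> \<omega> f = 1)
        \<le> \<P>(\<omega> in MST_law (complete_graph n). \<omega> e = 1) * \<P>(\<omega> in MST_law (complete_graph n). \<omega> f = 1)"
      using ef by (simp only: single)
  qed
qed

end
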